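(* Consider the adaptive distributed estimation scheme described in the context, and assume (A.1)–(A.5) hold with $\tau_1=1$ and $a\ge 1$. Then for each agent $n$ the estimate sequence $\{\mathbf{x}_n(t)\}$ is strongly consistent. More precisely, for each $n$ and each $\tau\in[0,1/2)$, $$\mathbb{P}_{\theta^*}\Big(\lim_{t\to\infty}(t+1)^{\tau}\|\mathbf{x}_n(t)-\theta^*\|=0\Big)=1.$$
   Context: There are $N$ agents indexed $n=1,\dots,N$ and an unknown deterministic parameter $\theta^*\in\mathbb{R}^M$. All random objects are defined on a probability space with filtration $\{\mathcal{F}_t\}_{t\ge 0}$; $\mathbb{P}_{\theta^*}$ and $\mathbb{E}_{\theta^*}$ denote probability and expectation. Inequalities between random variables are understood almost surely. Observation model: agent $n$ observes, at times $t=0,1,2,\dots$, the vector $\mathbf{y}_n(t)=H_n\theta^*+\zeta_n(t)\in\mathbb{R}^{M_n}$. Here $H_n\in\mathbb{R}^{M_n\times M}$ is deterministic. For each $n$, $\{\zeta_n(t)\}_t$ is a zero-mean, temporally i.i.d. sequence with finite covariance $R_n$, which is nonsingular and unknown to the agents. Each $\zeta_n(t)$ is $\mathcal{F}_{t+1}$-measurable and independent of $\mathcal{F}_t$. For $n\neq l$ the noise sequences are mutually uncorrelated. Communication model: $\{L_t\}$ is a sequence of random $N\times N$ Laplacians of simple undirected graphs on $\{1,\dots,N\}$. The neighborhood of agent $n$ at time $t$ is $\Omega_n(t)=\{l:(L_t)_{nl}=-1\}$. Algorithm. The weights are $\alpha_t=a/(t+1)^{\tau_1}$ and $\beta_t=b/(t+1)^{\tau_2}$,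 and $\gamma_t>0$ with $\gamma_t\to0$. The estimates have deterministic initial values $\mathbf{x}_n(0)$ and evolve as $$\mathbf{x}_n(t+1)=\mathbf{x}_n(t)-\beta_t\sum_{l\in\Omega_n(t)}(\mathbf{x}_n(t)-\mathbf{x}_l(t))+\alpha_tK_n(t)(\mathbf{y}_n(t)-H_n\mathbf{x}_n(t)).$$ The gains are $K_n(t)=(G_n(t)+\gamma_tI_M)^{-1}H_n^T(Q_n(t)+\gamma_tI_{M_n})^{-1}$. The matrices $Q_n(t)$ start from a positive semidefinite initial value and are updated as $$Q_n(t+1)=\frac1t\sum_{s=0}^t\mathbf{y}_n(s)\mathbf{y}_n(s)^T-\Big(\frac1t\sum_{s=0}^{t-1}\mathbf{y}_n(s)\Big)\Big(\frac1t\sum_{s=0}^{t-1}\mathbf{y}_n(s)\Big)^T.$$ The matrices $G_n(t)$ start from positive semidefinite $G_n(0)$ and evolve as $$G_n(t+1)=G_n(t)-\beta_t\sum_{l\in\Omega_n(t)}(G_n(t)-G_l(t))+\alpha_t\big(H_n^T(Q_n(t)+\gamma_tI_{M_n})^{-1}H_n-G_n(t)\big).$$ Assumptions: (A.1) $\overline{\Sigma}_c=\frac1N\sum_nH_n^TR_n^{-1}H_n$ is invertible. (A.2) $\{L_t\}$ is i.i.d., $L_t$ is $\mathcal{F}_{t+1}$-measurable and independent of $\mathcal{F}_t$, and $\lambda_2(\mathbb{E}_{\theta^*}[L_t])>0$, where $\lambda_2$ is the second smallest eigenvalue. (A.3) $\{L_t\}$ and the noise sequences are mutually independent. (A.4)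 There is $\varepsilon_1>0$ with $\mathbb{E}_{\theta^*}\|\zeta_n(t)\|^{2+\varepsilon_1}<\infty$ for all $n$. (A.5) $a,b>0$, $0<\tau_2\le\tau_1\le1$, and $\tau_1>\tau_2+\frac1{2+\varepsilon_1}+\frac12$.
   Formalization: The update of Q_n is undefined at t=0 because of the factor 1/t; it is used here only for t≥1, and Q_n(1), like Q_n(0), is an arbitrary deterministic positive semidefinite matrix. *)

theory Defs
  imports "HOL-Probability.Probability" "Jordan_Normal_Form.Char_Poly"
begin

definition vnorm :: "real vec \<Rightarrow> real" where
  "vnorm v = sqrt (\<Sum>i<dim_vec v. (v $ i)^2)"

text \<open>Inverse of a square matrix (only meaningful for invertible matrices).\<close>
definition mat_inv :: "real mat \<Rightarrow> real mat" where
  "mat_inv A = (SOME B. B \<in> carrier_mat (dim_row A) (dim_row A) \<and>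
                 A * B = 1\<^sub>m (dim_row A) \<and> B * A = 1\<^sub>m (dim_row A))"

definition psd_mat :: "nat \<Rightarrow> real mat \<Rightarrow> bool" where
  "psd_mat d A \<longleftrightarrow> A \<in> carrier_mat d d \<and> A\<^sup>T = A \<and>
     (\<forall>v \<in> carrier_vec d. 0 \<le> v \<bullet> (A *\<^sub>v v))"

definition is_graph_laplacian :: "nat \<Rightarrow> real mat \<Rightarrow> bool" where
  "is_graph_laplacian N A \<longleftrightarrow> (\<exists>E :: nat \<Rightarrow> nat \<Rightarrow> bool.
     (\<forall>i j. E i j = E j i) \<and> (\<forall>i. \<not> E i i) \<and>
     A = mat N N (\<lambda>(i,j). if i = j then real (card {k. k < N \<and> E i k})
                          else if E i j then -1 else 0))"

text \<open>Second smallest eigenvalue (counted with multiplicity) of a real square matrix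
  (all eigenvalues of the symmetric matrices used here are real).\<close>
definition lambda2 :: "real mat \<Rightarrow> real" where
  "lambda2 A = sorted_list_of_multiset (proots (char_poly A)) ! 1"

definition gen_sets :: "'a measure \<Rightarrow> ('i \<Rightarrow> 'a \<Rightarrow> real) \<Rightarrow> 'i set \<Rightarrow> 'a set set" where
  "gen_sets M Z I = sets (sigma (space M) {Z i -` B \<inter> space M | i B. i \<in> I \<and> B \<in> sets borel})"

definition joint_law :: "'a measure \<Rightarrow> ('i \<Rightarrow> 'a \<Rightarrow> real) \<Rightarrow> 'i set \<Rightarrow> ('i \<Rightarrow> real) measure" where
  "joint_law M Z I = distr M (Pi\<^sub>M I (\<lambda>_. borel)) (\<lambda>\<omega>. restrict (\<lambda>i. Z i \<omega>) I)"

end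

theory Submission
  imports Defs "HOL-Real_Asymp.Real_Asymp"
begin

text \<open>The randomness enters only through four almost sure facts: laws of large numbers for the noise
  and its products, the growth bound \<open>|\<zeta>(t)| = O(t\<^sup>p)\<close> for \<open>p > 1/(2 + \<epsilon>\<^sub>1)\<close>, the bound
  \<open>O(t\<^sup>r)\<close>, \<open>r > 1/2\<close>, for noise sums with predictable coefficients, and the decay of the consensus
  kernel (the product of the matrices \<open>I - \<beta>\<^sub>t L\<^sub>t\<close>, minus averaging) over time windows of length
  \<open>t\<^sup>q\<close>, \<open>q > \<tau>\<^sub>2\<close>. The rest is deterministic along a fixed path. By variation of constants the
  disagreement between agents is \<open>O(t\<^bsup>p+q-1\<^esup>) = o(t\<^bsup>-1/2\<^esup>)\<close>, which is where \<open>p + q < 1/2\<close> is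
  used. The network average, after subtracting the averaged noise \<open>(a/t) \<Sum> \<xi>(s)\<close>, obeys a scalar
  recursion with contraction factor \<open>1 - (a - o(1))/t\<close>, and \<open>a \<ge> 1 > \<tau>\<close> gives the rate. The same
  deterministic lemma is applied first to the entries of \<open>G\<^sub>n(t)\<close>, to show that the gains converge,
  and then to the estimation errors. The matrices \<open>G\<^sub>n(t) + \<gamma>\<^sub>t I\<close> may be singular at early
  times, but they are eventually invertible because \<open>G\<^sub>n(t)\<close> converges to \<open>\<Sigma>\<^sub>c\<close>.\<close>

section \<open>Linear recursions with harmonic steps\<close>

text \<open>The disagreement bound presupposes a bound on the errors, because the innovation
  contains the error itself, and a bound on the errors in turn needs small disagreement. A bootstrap
  breaks the circle: errors of size \<open>X\<close> produce disagreement at most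
  \<open>o(1) * X + o(1)\<close>, uniformly in \<open>X\<close>, so an induction on time preserves
  one large bound. The exponent \<open>p + q - 1\<close> arises because only about
  \<open>t powr q\<close> recent forcing terms are remembered, each of order
  \<open>t powr (p - 1)\<close>. Noise sums need no general martingale theory: centred increments
  independent of the past are orthogonal, and second moments along dyadic times suffice. The gains
  have no deterministic bound, so they are truncated around their deterministic limit; along almost
  every path the truncation is eventually inactive. Products of noise entries have moments of order
  only slightly above one, hence a strong law by truncation. The eigenvalue condition is converted
  into connectivity of the mean graph, from which a Poincare inequality follows by chaining along
  paths.\<close>

lemma tendsto_0_linear_recursion:
  fixes g h :: "nat \<Rightarrow> real"
  assumes nn: "\<And>t. g t \<ge> 0" and c: "0 < c" "c \<le> 1"
    and rec: "\<forall>\<^sub>F t in sequentially. g (Suc t) \<le> (1 - c / (real t + 1)) * g t + h t / (real t + 1)"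
    and h: "h \<longlonglongrightarrow> 0"
  shows "g \<longlonglongrightarrow> 0"
proof (rule LIMSEQ_I)
  fix r :: real assume r: "r > 0"
  define e where "e = r / 2"
  have e: "e > 0" using r by (simp add: e_def)
  have "\<forall>\<^sub>F t in sequentially. h t < c * e"
    using h c e by (intro order_tendstoD(2)[OF h]) auto
  with rec obtain T where T: "\<And>t. t \<ge> T \<Longrightarrow> g (Suc t) \<le> (1 - c / (real t + 1)) * g t + h t / (real t + 1)"
    "\<And>t. t \<ge> T \<Longrightarrow> h t < c * e"
    using eventually_conj[OF rec] unfolding eventually_sequentially
    by (metis (no_types, lifting) nat_le_linear le_trans)
  define S where "S t = (\<Sum>s<t. c / (real s + 1))" for t
  \<comment> \<open>\<open>e\<close> is the fixed point of the recursion with \<open>h\<close>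
    replaced by its bound \<open>c * e\<close>, so the excess \<open>g - e\<close> obeys the
    homogeneous recursion. The product of its factors is at most the exponential of minus a harmonic
    sum and tends to zero.\<close>
  have *: "g t - e \<le> exp (S T - S t) * g T" if "t \<ge> T" for t
    using that
  proof (induction t rule: dec_induct)
    case base then show ?case using e by simp
  next
    case (step t)
    have k: "0 \<le> 1 - c / (real t + 1)" using c by (simp add: field_simps)
    have "g (Suc t) - e \<le> (1 - c / (real t + 1)) * g t + c * e / (real t + 1) - e"
      using T[OF step(1)] divide_right_mono[of "h t" "c * e" "real t + 1"] by linarith
    also have "\<dots> = (1 - c / (real t + 1)) * (g t - e)"
      by (simp add: algebra_simps diff_divide_distrib)
    also have "\<dots> \<le> (1 - c / (real t + 1)) * (exp (S T - S t) * g T)"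
      using step.IH k by (rule mult_left_mono)
    also have "\<dots> \<le> exp (- (c / (real t + 1))) * (exp (S T - S t) * g T)"
      using exp_ge_add_one_self[of "- (c / (real t + 1))"] nn by (intro mult_right_mono) auto
    also have "\<dots> = exp (S T - S (Suc t)) * g T"
      by (simp add: S_def mult.assoc[symmetric] exp_add[symmetric] algebra_simps)
    finally show ?case .
  qed
  have "filterlim (\<lambda>t. \<Sum>s<t. 1 / (real s + 1)) at_top sequentially"
  proof -
    have "(\<Sum>s<t. 1 / (real s + 1)) = harm t" for t
      by (induction t) (auto simp: harm_Suc inverse_eq_divide harm_def)
    then show ?thesis using harm_at_top by simp
  qed
  then have "filterlim (\<lambda>t. c * (\<Sum>s<t. 1 / (real s + 1))) at_top sequentially"
    using c by (intro filterlim_tendsto_pos_mult_at_top[OF tendsto_const]) auto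
  then have S: "filterlim S at_top sequentially"
    unfolding S_def by (simp add: sum_distrib_left)
  have "filterlim (\<lambda>t. - S t) at_bot sequentially"
    using S by (simp add: filterlim_uminus_at_top)
  then have "(\<lambda>t. exp (- S t)) \<longlonglongrightarrow> 0"
    by (rule filterlim_compose[OF exp_at_bot])
  then have "(\<lambda>t. exp (S T) * g T * exp (- S t)) \<longlonglongrightarrow> 0"
    using tendsto_mult_right_zero by blast
  then have "\<forall>\<^sub>F t in sequentially. exp (S T) * g T * exp (- S t) < e"
    by (rule order_tendstoD(2)) (rule e)
  then obtain T' where T': "\<And>t. t \<ge> T' \<Longrightarrow> exp (S T) * g T * exp (- S t) < e"
    unfolding eventually_sequentially by blast
  show "\<exists>no. \<forall>n\<ge>no. norm (g n - 0) < r"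
  proof (intro exI allI impI)
    fix t assume "max T T' \<le> t"
    then have "g t - e \<le> exp (S T) * g T * exp (- S t)" "exp (S T) * g T * exp (- S t) < e"
      using *[of t] T'[of t] by (auto simp: exp_diff exp_minus field_simps)
    then show "norm (g t - 0) < r" using nn[of t] by (simp add: e_def)
  qed
qed

text \<open>Bernoulli's inequality for exponents in [0, 1], from weighted AM-GM with weights
  \<open>r\<close> and \<open>1 - r\<close> on the numbers \<open>1 + 1 / (t + 1)\<close> and
  \<open>1\<close>.\<close>

lemma powr_Suc_le:
  assumes "0 \<le> r" "r \<le> 1"
  shows "(real (Suc t) + 1) powr r \<le> (1 + r / (real t + 1)) * (real t + 1) powr r"
proof -
  have "(real (Suc t) + 1) powr r = ((1 + 1 / (real t + 1)) * (real t + 1)) powr r"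
    by (simp add: distrib_right)
  also have "\<dots> = (1 + 1 / (real t + 1)) powr r * (real t + 1) powr r"
    by (rule powr_mult)
  also have "\<dots> \<le> (1 + r / (real t + 1)) * (real t + 1) powr r"
  proof (rule mult_right_mono)
    have "(1 + 1 / (real t + 1)) powr r * 1 powr (1 - r) \<le> r * (1 + 1 / (real t + 1)) + (1 - r) * 1"
      using assms by (intro Youngs_inequality_0) (auto intro: add_pos_nonneg)
    then show "(1 + 1 / (real t + 1)) powr r \<le> 1 + r / (real t + 1)"
      by (simp add: algebra_simps)
  qed simp
  finally show ?thesis .
qed

text \<open>The weight \<open>(t + 1) powr r\<close> grows by a factor of at most
  \<open>1 + r / (t + 1)\<close> per step, which uses up \<open>r\<close> of the contraction rate
  \<open>c\<close>. The weighted sequence contracts at the rate \<open>c - r > 0\<close>, and the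
  unweighted lemma applies to it.\<close>

lemma powr_tendsto_0_linear_recursion:
  fixes g h :: "nat \<Rightarrow> real"
  assumes nn: "\<And>t. g t \<ge> 0" and c: "0 \<le> r" "r < c" "c \<le> 1"
    and rec: "\<forall>\<^sub>F t in sequentially. g (Suc t) \<le> (1 - c / (real t + 1)) * g t + h t / (real t + 1)"
    and h: "(\<lambda>t. (real t + 1) powr r * h t) \<longlonglongrightarrow> 0" 
  shows "(\<lambda>t. (real t + 1) powr r * g t) \<longlonglongrightarrow> 0"
proof (rule tendsto_0_linear_recursion)
  show "0 \<le> (real t + 1) powr r * g t" for t using nn by simp
  show "0 < c - r" "c - r \<le> 1" using c by auto
  define h' where "h' t = (1 + r / (real t + 1)) * ((real t + 1) powr r * \<bar>h t\<bar>)" for t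
  have "(\<lambda>t. 1 + r / (real t + 1)) \<longlonglongrightarrow> 1" by real_asymp
  moreover have "(\<lambda>t. (real t + 1) powr r * \<bar>h t\<bar>) \<longlonglongrightarrow> 0"
    using tendsto_rabs_zero[OF h] by (simp add: abs_mult)
  ultimately show "h' \<longlonglongrightarrow> 0" unfolding h'_def using tendsto_mult by fastforce
  show "\<forall>\<^sub>F t in sequentially. (real (Suc t) + 1) powr r * g (Suc t)
     \<le> (1 - (c - r) / (real t + 1)) * ((real t + 1) powr r * g t) + h' t / (real t + 1)"
    using rec
  proof eventually_elim
    case (elim t)
    let ?u = "real t + 1" let ?p = "?u powr r"
    have k: "0 \<le> 1 - c / ?u" using c by (simp add: field_simps)
    have "(real (Suc t) + 1) powr r * g (Suc t) \<le> (1 + r / ?u) * ?p * g (Suc t)"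
      using nn powr_Suc_le[of r t] c by (intro mult_right_mono) auto
    also have "\<dots> \<le> (1 + r / ?u) * ?p * ((1 - c / ?u) * g t + \<bar>h t\<bar> / ?u)"
    proof (rule mult_left_mono)
      have "h t / ?u \<le> \<bar>h t\<bar> / ?u" by (intro divide_right_mono) auto
      with elim show "g (Suc t) \<le> (1 - c / ?u) * g t + \<bar>h t\<bar> / ?u" by linarith
    qed (use c in auto)
    also have "\<dots> = (1 + r / ?u) * (1 - c / ?u) * (?p * g t) + h' t / ?u"
      by (simp add: h'_def algebra_simps add_divide_distrib)
    also have "\<dots> \<le> (1 - (c - r) / ?u) * (?p * g t) + h' t / ?u"
    proof -
      have "(1 + r / ?u) * (1 - c / ?u) = 1 - (c - r) / ?u - (r / ?u) * (c / ?u)"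
        by (simp add: algebra_simps diff_divide_distrib)
      also have "\<dots> \<le> 1 - (c - r) / ?u"
        using c by simp
      finally show ?thesis using nn by (intro add_right_mono mult_right_mono) auto
    qed
    finally show ?case .
  qed
qed

text \<open>The absolute value of a running mean satisfies the harmonic recursion with rate
  \<open>c = 1\<close> and forcing \<open>\<bar>u t\<bar>\<close>.\<close>

lemma cesaro_mean_tendsto_0:
  fixes u :: "nat \<Rightarrow> real"
  assumes "u \<longlonglongrightarrow> 0"
  shows "(\<lambda>t. (\<Sum>s<t. u s) / real t) \<longlonglongrightarrow> 0"
proof -
  have "(\<lambda>t. \<bar>(\<Sum>s<t. u s) / real t\<bar>) \<longlonglongrightarrow> 0"
  proof (rule tendsto_0_linear_recursion[where c = 1 and h = "\<lambda>t. \<bar>u t\<bar>"])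
    show "\<forall>\<^sub>F t in sequentially. \<bar>(\<Sum>s<Suc t. u s) / real (Suc t)\<bar>
       \<le> (1 - 1 / (real t + 1)) * \<bar>(\<Sum>s<t. u s) / real t\<bar> + \<bar>u t\<bar> / (real t + 1)"
      using eventually_gt_at_top[of 0]
    proof eventually_elim
      case (elim t)
      have "\<bar>(\<Sum>s<Suc t. u s) / real (Suc t)\<bar> \<le> (\<bar>\<Sum>s<t. u s\<bar> + \<bar>u t\<bar>) / (real t + 1)"
        by (simp add: divide_right_mono abs_divide add.commute)
      also have "\<dots> = (1 - 1 / (real t + 1)) * \<bar>(\<Sum>s<t. u s) / real t\<bar> + \<bar>u t\<bar> / (real t + 1)"
        using elim by (simp add: divide_simps abs_divide)
      finally show ?case .
    qed
  qed (use assms tendsto_rabs_zero in auto)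
  then show ?thesis by (rule tendsto_rabs_zero_cancel)
qed

section \<open>The consensus kernel\<close>

text \<open>One application of \<open>I - c L\<close>, with \<open>L\<close> the Laplacian of the
  edge weights \<open>w\<close>. Working with weights and scalar values \<open>z n\<close> lets
  every entry of the vector and matrix estimates be processed separately.\<close>

definition consensus_step :: "nat \<Rightarrow> real \<Rightarrow> (nat \<Rightarrow> nat \<Rightarrow> real) \<Rightarrow> (nat \<Rightarrow> real) \<Rightarrow> nat \<Rightarrow> real" where
  "consensus_step N c w z n = z n - c * (\<Sum>l<N. w n l * (z n - z l))"

text \<open>Entry \<open>(n, l)\<close> of the product of the \<open>k\<close> consensus matrices at
  times \<open>s\<close> to \<open>s + k - 1\<close>. It is generated by columns: column
  \<open>l\<close> is the consensus path started from unit vector \<open>l\<close>. The averaging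
  matrix is not subtracted here but appears as an explicit \<open>- 1 / N\<close> later.\<close>

primrec consensus_kernel ::
  "nat \<Rightarrow> (nat \<Rightarrow> real) \<Rightarrow> (nat \<Rightarrow> nat \<Rightarrow> nat \<Rightarrow> real) \<Rightarrow> nat \<Rightarrow> nat \<Rightarrow> nat \<Rightarrow> nat \<Rightarrow> real" where
  "consensus_kernel N \<beta> w s 0 n l = of_bool (n = l)"
| "consensus_kernel N \<beta> w s (Suc k) n l =
     consensus_step N (\<beta> (s + k)) (w (s + k)) (\<lambda>n. consensus_kernel N \<beta> w s k n l) n"

lemma consensus_step_add:
  "consensus_step N c w (\<lambda>n. z n + z' n) n = consensus_step N c w z n + consensus_step N c w z' n"
  unfolding consensus_step_def
  by (simp add: algebra_simps sum.distrib sum_subtractf)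

lemma consensus_step_mult:
  "consensus_step N c w (\<lambda>n. z n * r) n = consensus_step N c w z n * r"
  unfolding consensus_step_def sum_distrib_left left_diff_distrib sum_distrib_right
  by (intro arg_cong2[of _ _ _ _ "(-)"] sum.cong) (auto simp: algebra_simps)

lemma consensus_step_sum:
  "consensus_step N c w (\<lambda>n. \<Sum>i\<in>A. z i n) n = (\<Sum>i\<in>A. consensus_step N c w (z i) n)"
proof (induction A rule: infinite_finite_induct)
  case (insert i A) then show ?case by (simp add: consensus_step_add)
qed (auto simp: consensus_step_def)

lemma consensus_step_cong:
  "(\<And>n. n < N \<Longrightarrow> z n = z' n) \<Longrightarrow> n < N \<Longrightarrow> consensus_step N c w z n = consensus_step N c w z' n"
  unfolding consensus_step_def by (auto intro!: arg_cong2[of _ _ _ _ "(-)"] sum.cong)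

text \<open>Symmetric weights make the exchanges within each pair of agents cancel, so consensus
  never moves the network average.\<close>

lemma sum_consensus_step:
  assumes "\<And>n l. n < N \<Longrightarrow> l < N \<Longrightarrow> w n l = w l n"
  shows "(\<Sum>n<N. consensus_step N c w z n) = (\<Sum>n<N. z n)"
proof -
  have "(\<Sum>n<N. \<Sum>l<N. w n l * z l) = (\<Sum>n<N. \<Sum>l<N. w n l * z n)"
    by (subst sum.swap, intro sum.cong refl) (use assms in auto)
  then have "(\<Sum>n<N. \<Sum>l<N. w n l * (z n - z l)) = 0"
    by (simp add: right_diff_distrib sum_subtractf)
  then have "(\<Sum>n<N. c * (\<Sum>l<N. w n l * (z n - z l))) = 0"
    by (simp flip: sum_distrib_left)
  then show ?thesis
    unfolding consensus_step_def by (simp add: sum_subtractf)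
qed

text \<open>The new value is a convex combination of old ones: the total weight \<open>W\<close> of
  the neighbours is at most \<open>N\<close>, so the own weight \<open>1 - c * W\<close> stays
  nonnegative.\<close>

lemma consensus_step_bounds:
  assumes w: "\<And>l. l < N \<Longrightarrow> 0 \<le> w n l" "\<And>l. l < N \<Longrightarrow> w n l \<le> 1"
    and c: "0 \<le> c" "c * real N \<le> 1"
    and z: "\<And>n. n < N \<Longrightarrow> lo \<le> z n" "\<And>n. n < N \<Longrightarrow> z n \<le> hi" and n: "n < N"
  shows "lo \<le> consensus_step N c w z n" "consensus_step N c w z n \<le> hi"
proof -
  define W where "W = (\<Sum>l<N. w n l)"
  have "W \<le> real N" unfolding W_def using sum_bounded_above[of "{..<N}" "w n" 1] w by simp
  then have cW: "0 \<le> 1 - c * W" using c mult_left_mono[of W "real N" c] by simp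
  have eq: "consensus_step N c w z n = (1 - c * W) * z n + c * (\<Sum>l<N. w n l * z l)"
    unfolding consensus_step_def W_def
    by (simp add: algebra_simps sum_subtractf sum_distrib_left)
  have "W * lo \<le> (\<Sum>l<N. w n l * z l)" unfolding W_def sum_distrib_right
    using w z by (intro sum_mono mult_left_mono) auto
  then have "(1 - c * W) * lo + c * (W * lo) \<le> (1 - c * W) * z n + c * (\<Sum>l<N. w n l * z l)"
    using z(1)[OF n] c cW by (intro add_mono mult_left_mono) auto
  then show "lo \<le> consensus_step N c w z n" unfolding eq by (simp add: algebra_simps)
  have "(\<Sum>l<N. w n l * z l) \<le> W * hi" unfolding W_def sum_distrib_right
    using w z by (intro sum_mono mult_left_mono) auto
  then have "(1 - c * W) * z n + c * (\<Sum>l<N. w n l * z l) \<le> (1 - c * W) * hi + c * (W * hi)"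
    using z(2)[OF n] c cW by (intro add_mono mult_left_mono) auto
  then show "consensus_step N c w z n \<le> hi" unfolding eq by (simp add: algebra_simps)
qed

lemma sum_consensus_kernel:
  assumes "\<And>t n l. n < N \<Longrightarrow> l < N \<Longrightarrow> w t n l = w t l n" and "l < N"
  shows "(\<Sum>n<N. consensus_kernel N \<beta> w s k n l) = 1"
proof (induction k)
  case 0 then show ?case using assms(2) by (simp add: of_bool_def)
next
  case (Suc k)
  then show ?case by (simp add: sum_consensus_step assms(1))
qed

lemma consensus_kernel_bounds:
  assumes "\<And>t n l. n < N \<Longrightarrow> l < N \<Longrightarrow> 0 \<le> w t n l \<and> w t n l \<le> 1"
    and "\<And>t. s \<le> t \<Longrightarrow> 0 \<le> \<beta> t \<and> \<beta> t * real N \<le> 1" and "n < N"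
  shows "0 \<le> consensus_kernel N \<beta> w s k n l \<and> consensus_kernel N \<beta> w s k n l \<le> 1"
  using assms(3)
proof (induction k arbitrary: n)
  case (Suc k)
  then show ?case using consensus_step_bounds[of N "w (s+k)" n "\<beta> (s+k)" 0 "\<lambda>n. consensus_kernel N \<beta> w s k n l" 1]
      assms(1,2) by simp
qed simp

lemma consensus_kernel_dist:
  assumes "\<And>t n l. n < N \<Longrightarrow> l < N \<Longrightarrow> 0 \<le> w t n l \<and> w t n l \<le> 1"
    and "\<And>t. s \<le> t \<Longrightarrow> 0 \<le> \<beta> t \<and> \<beta> t * real N \<le> 1 / 2" and n: "n < N"
  shows "\<bar>consensus_kernel N \<beta> w s k n l - 1 / N\<bar> \<le> 1"
proof -
  have "0 \<le> \<beta> t \<and> \<beta> t * real N \<le> 1" if "s \<le> t" for t using assms(2)[OF that] by linarith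
  then have "0 \<le> consensus_kernel N \<beta> w s k n l \<and> consensus_kernel N \<beta> w s k n l \<le> 1"
    by (intro consensus_kernel_bounds assms(1) n)
  moreover have "0 \<le> 1 / real N" "1 / real N \<le> 1" using n by auto
  ultimately show ?thesis by linarith
qed

text \<open>The discrete Duhamel formula. The forcing of time \<open>T + j\<close> enters the state
  at time \<open>T + Suc j\<close>, so it is propagated by the kernel that starts there and runs for
  the remaining \<open>k - Suc j\<close> steps.\<close>

lemma variation_of_constants:
  fixes z f :: "nat \<Rightarrow> nat \<Rightarrow> real"
  assumes rec: "\<And>t n. t \<ge> T \<Longrightarrow> n < N \<Longrightarrow> z (Suc t) n = consensus_step N (\<beta> t) (w t) (z t) n + f t n"
    and "n < N"
  shows "z (T + k) n = (\<Sum>l<N. consensus_kernel N \<beta> w T k n l * z T l)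
      + (\<Sum>j<k. \<Sum>l<N. consensus_kernel N \<beta> w (T + Suc j) (k - Suc j) n l * f (T + j) l)"
  using \<open>n < N\<close>
proof (induction k arbitrary: n)
  case 0
  have "(\<Sum>l<N. consensus_kernel N \<beta> w T 0 n l * z T l) = (\<Sum>l<N. if n = l then z T l else 0)"
    by (intro sum.cong) auto
  then show ?case using 0 by simp
next
  case (Suc k)
  let ?K = "consensus_kernel N \<beta> w"
  have "z (T + Suc k) n = consensus_step N (\<beta> (T + k)) (w (T + k)) (z (T + k)) n + f (T + k) n"
    using rec[of "T + k" n] Suc.prems by simp
  also have "consensus_step N (\<beta> (T + k)) (w (T + k)) (z (T + k)) n =
      consensus_step N (\<beta> (T + k)) (w (T + k)) (\<lambda>n. (\<Sum>l<N. ?K T k n l * z T l)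
      + (\<Sum>j<k. \<Sum>l<N. ?K (T + Suc j) (k - Suc j) n l * f (T + j) l)) n"
    using Suc by (intro consensus_step_cong) auto
  also have "\<dots> = (\<Sum>l<N. ?K T (Suc k) n l * z T l)
      + (\<Sum>j<k. \<Sum>l<N. ?K (T + Suc j) (Suc k - Suc j) n l * f (T + j) l)"
    unfolding consensus_step_add consensus_step_sum consensus_step_mult
  proof (intro arg_cong2[of _ _ _ _ "(+)"] sum.cong refl)
    fix j l assume "j \<in> {..<k}"
    then have e: "Suc k - Suc j = Suc (k - Suc j)" "T + Suc j + (k - Suc j) = T + k" by auto
    show "consensus_step N (\<beta> (T + k)) (w (T + k)) (\<lambda>n. ?K (T + Suc j) (k - Suc j) n l) n * f (T + j) l
       = ?K (T + Suc j) (Suc k - Suc j) n l * f (T + j) l"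
      unfolding e(1) consensus_kernel.simps(2) e(2) ..
  qed simp
  also have "f (T + k) n = (\<Sum>l<N. ?K (T + Suc k) (Suc k - Suc k) n l * f (T + k) l)"
  proof -
    have "(\<Sum>l<N. ?K (T + Suc k) 0 n l * f (T + k) l) = (\<Sum>l<N. if n = l then f (T + k) l else 0)"
      by (intro sum.cong) auto
    then show ?thesis using Suc.prems by simp
  qed
  finally show ?case by simp
qed

text \<open>The average evolves by adding the averaged forcing alone. Subtracting it from the
  Duhamel formula replaces each kernel entry by its deviation from \<open>1 / N\<close>.\<close>

lemma consensus_disagreement_eq:
  fixes z f :: "nat \<Rightarrow> nat \<Rightarrow> real"
  assumes rec: "\<And>t n. t \<ge> T \<Longrightarrow> n < N \<Longrightarrow> z (Suc t) n = consensus_step N (\<beta> t) (w t) (z t) n + f t n"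
    and sym: "\<And>t n l. n < N \<Longrightarrow> l < N \<Longrightarrow> w t n l = w t l n"
    and n: "n < N"
  shows "z (T + k) n - (\<Sum>l<N. z (T + k) l) / N =
      (\<Sum>l<N. (consensus_kernel N \<beta> w T k n l - 1 / N) * z T l)
      + (\<Sum>j<k. \<Sum>l<N. (consensus_kernel N \<beta> w (T + Suc j) (k - Suc j) n l - 1 / N) * f (T + j) l)"
proof -
  have "(\<Sum>l<N. z (T + k) l) = (\<Sum>l<N. z T l) + (\<Sum>j<k. \<Sum>l<N. f (T + j) l)"
  proof (induction k)
    case (Suc k)
    have "(\<Sum>l<N. z (T + Suc k) l) = (\<Sum>l<N. z (T + k) l) + (\<Sum>l<N. f (T + k) l)"
      using rec[of "T + k"] by (simp add: sum.distrib sum_consensus_step sym)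
    with Suc show ?case by simp
  qed simp
  then show ?thesis
    unfolding variation_of_constants[where z = z and T = T and f = f, OF rec n, simplified]
    by (simp add: left_diff_distrib sum_subtractf sum_divide_distrib add_divide_distrib)
qed

text \<open>Forcing at least \<open>t powr q\<close> steps old is damped to
  \<open>1 / t\<^sup>2\<close> by the kernel; the at most \<open>t powr q + 1\<close> more recent
  terms each carry a step size of order \<open>1 / t\<close>. The state bound \<open>X\<close>
  enters linearly and apart from the noise growth \<open>t powr p\<close>, which is the form the
  bootstrap works with.\<close>

lemma consensus_disagreement_bound:
  fixes z f :: "nat \<Rightarrow> nat \<Rightarrow> real"
  assumes rec: "\<And>t n. t \<ge> T \<Longrightarrow> n < N \<Longrightarrow> z (Suc t) n = consensus_step N (\<beta> t) (w t) (z t) n + f t n"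
    and sym: "\<And>t n l. n < N \<Longrightarrow> l < N \<Longrightarrow> w t n l = w t l n"
    and ker1: "\<And>s k n l. s \<ge> T \<Longrightarrow> n < N \<Longrightarrow> l < N \<Longrightarrow> \<bar>consensus_kernel N \<beta> w s k n l - 1 / N\<bar> \<le> 1"
    and ker2: "\<And>s k n l. s \<ge> T \<Longrightarrow> n < N \<Longrightarrow> l < N \<Longrightarrow> s + k = t \<Longrightarrow> real t powr q \<le> real k \<Longrightarrow>
        \<bar>consensus_kernel N \<beta> w s k n l - 1 / N\<bar> \<le> 1 / (real t)\<^sup>2"
    and f: "\<And>s l. s \<ge> T \<Longrightarrow> s < t \<Longrightarrow> l < N \<Longrightarrow> \<bar>f s l\<bar> \<le> C / (real s + 1) * (X + (real s + 1) powr p)"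
    and z: "\<And>l. l < N \<Longrightarrow> \<bar>z T l\<bar> \<le> X"
    and t: "t \<ge> 1" "real T + real t powr q \<le> real t" "2 * real t powr q \<le> real t"
    and pq: "0 \<le> p" "0 \<le> q" and C: "C \<ge> 0" and X: "X \<ge> 0" and n: "n < N"
  shows "\<bar>z t n - (\<Sum>l<N. z t l) / N\<bar> \<le> N * (1 + 5 * C) * (real t powr (q - 1) * (X + real t powr p))"
proof -
  let ?K = "consensus_kernel N \<beta> w" let ?t = "real t"
  have tT: "T \<le> t" using t(2) powr_ge_zero[of ?t q] by linarith
  define k where "k = t - T"
  have tk: "t = T + k" using tT by (simp add: k_def)
  have q1: "1 \<le> ?t powr q" using t(1) pq by (intro ge_one_powr_ge_zero) auto
  define Y where "Y = X + ?t powr p"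
  have Y: "X \<le> Y" "Y \<ge> 0" using X by (auto simp: Y_def)
  define near where "near j \<longleftrightarrow> real (k - Suc j) < ?t powr q" for j
  \<comment> \<open>The second summand is the step size of recent forcing:
    \<open>2 * t powr q \<le> t\<close> places recent times beyond \<open>t / 2\<close>, where
    \<open>1 / (s + 1) \<le> 2 / t\<close>.\<close>
  let ?W = "\<lambda>j. 1 / ?t\<^sup>2 + (if near j then 2 / ?t else 0)"
  have init: "\<bar>\<Sum>l<N. (?K T k n l - 1 / N) * z T l\<bar> \<le> N * (1 / ?t\<^sup>2 * X)"
  proof -
    have "\<bar>(?K T k n l - 1 / N) * z T l\<bar> \<le> 1 / ?t\<^sup>2 * X" if "l < N" for l
      unfolding abs_mult using that n tk t(2) z by (intro mult_mono ker2) auto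
    then have "\<bar>\<Sum>l<N. (?K T k n l - 1 / N) * z T l\<bar> \<le> (\<Sum>l<N. 1 / ?t\<^sup>2 * X)"
      by (intro order_trans[OF sum_abs] sum_mono) auto
    then show ?thesis by simp
  qed
  have trm: "\<bar>\<Sum>l<N. (?K (T + Suc j) (k - Suc j) n l - 1 / N) * f (T + j) l\<bar>
      \<le> N * (?W j * (C * Y))" if j: "j < k" for j
  proof -
    have "\<bar>(?K (T + Suc j) (k - Suc j) n l - 1 / N) * f (T + j) l\<bar>
      \<le> ?W j * (C * Y)" if l: "l < N" for l
    proof -
      have fb: "\<bar>f (T + j) l\<bar> \<le> 1 / (real (T + j) + 1) * (C * Y)"
      proof -
        have "\<bar>f (T + j) l\<bar> \<le> C / (real (T + j) + 1) * (X + (real (T + j) + 1) powr p)"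
          using f[of "T + j" l] j l tk by simp
        also have "\<dots> \<le> C / (real (T + j) + 1) * Y"
          unfolding Y_def using j tk C pq by (intro mult_left_mono add_left_mono powr_mono2) auto
        finally show ?thesis by simp
      qed
      have CY: "0 \<le> C * Y" using C Y by simp
      show ?thesis
      proof (cases "near j")
        case True
        have "?t / 2 \<le> real (T + j) + 1"
          using True j t(3) tk unfolding near_def by (auto simp: of_nat_diff)
        then have "1 / (real (T + j) + 1) \<le> 2 / ?t" using t(1) by (simp add: field_simps)
        then have "\<bar>f (T + j) l\<bar> \<le> 2 / ?t * (C * Y)"
          using fb mult_right_mono[OF _ CY] order_trans by blast
        then have "\<bar>(?K (T + Suc j) (k - Suc j) n l - 1 / N) * f (T + j) l\<bar> \<le> 1 * (2 / ?t * (C * Y))"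
          unfolding abs_mult using ker1[OF _ n l] by (intro mult_mono) auto
        also have "\<dots> \<le> (1 / ?t\<^sup>2 + 2 / ?t) * (C * Y)"
          unfolding mult_1 using CY by (intro mult_right_mono) auto
        finally show ?thesis using True by simp
      next
        case False
        have "1 / (real (T + j) + 1) * (C * Y) \<le> 1 * (C * Y)"
          using CY by (intro mult_right_mono) auto
        then have "\<bar>f (T + j) l\<bar> \<le> C * Y" using fb by linarith
        moreover have "\<bar>?K (T + Suc j) (k - Suc j) n l - 1 / N\<bar> \<le> 1 / ?t\<^sup>2"
          using False j n l tk unfolding near_def by (intro ker2) auto
        ultimately have "\<bar>(?K (T + Suc j) (k - Suc j) n l - 1 / N) * f (T + j) l\<bar> \<le> 1 / ?t\<^sup>2 * (C * Y)"
          unfolding abs_mult by (intro mult_mono) auto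
        then show ?thesis using False by simp
      qed
    qed
    then have "(\<Sum>l<N. \<bar>(?K (T + Suc j) (k - Suc j) n l - 1 / N) * f (T + j) l\<bar>)
      \<le> (\<Sum>l<N. ?W j * (C * Y))"
      by (intro sum_mono) auto
    then show ?thesis
      using order_trans[OF sum_abs] by (simp only: sum_constant card_lessThan)
  qed
  \<comment> \<open>The age \<open>k - Suc j\<close> is injective in \<open>j < k\<close>, so the
    recent indices are no more numerous than the natural numbers below
    \<open>t powr q\<close>.\<close>
  have count: "real (card {j. j < k \<and> near j}) \<le> ?t powr q + 1"
  proof -
    have "card {j. j < k \<and> near j} \<le> card {..<nat \<lceil>?t powr q\<rceil>}"
    proof (rule card_inj_on_le)
      show "inj_on (\<lambda>j. k - Suc j) {j. j < k \<and> near j}" by (auto simp: inj_on_def)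
      show "(\<lambda>j. k - Suc j) ` {j. j < k \<and> near j} \<subseteq> {..<nat \<lceil>?t powr q\<rceil>}"
        unfolding near_def by (auto simp: less_ceiling_iff zless_nat_eq_int_zless)
    qed simp
    then have "card {j. j < k \<and> near j} \<le> nat \<lceil>?t powr q\<rceil>" by simp
    then have "real (card {j. j < k \<and> near j}) \<le> real (nat \<lceil>?t powr q\<rceil>)" by (rule of_nat_mono)
    then show ?thesis using powr_ge_zero[of ?t q] by linarith
  qed
  have "(\<Sum>j<k. ?W j) = k / ?t\<^sup>2 + card {j. j < k \<and> near j} * (2 / ?t)"
  proof -
    have "(\<Sum>j<k. if near j then 2 / ?t else 0) = (\<Sum>j\<in>{j. j < k \<and> near j}. 2 / ?t)"
      by (rule sum.mono_neutral_cong_right) auto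
    then show ?thesis by (simp add: sum.distrib)
  qed
  also have "\<dots> \<le> ?t / ?t\<^sup>2 + (?t powr q + 1) * (2 / ?t)"
    using count tk by (intro add_mono divide_right_mono mult_right_mono) auto
  also have "\<dots> = (1 + (?t powr q + 1) * 2) / ?t"
    using t(1) by (simp add: field_simps power2_eq_square)
  \<comment> \<open>The constant 5 is \<open>1 + 2 + 2\<close>: the damped terms, the recent terms,
    and the rounding up of their number, with \<open>1 \<le> t powr q\<close> absorbing the first
    and the last.\<close>
  also have "\<dots> \<le> (5 * ?t powr q) / ?t" using q1 by (intro divide_right_mono) auto
  also have "\<dots> = 5 * ?t powr (q - 1)" using t(1) by (simp add: powr_diff)
  finally have weights: "(\<Sum>j<k. ?W j) \<le> 5 * ?t powr (q - 1)" .
  have t2: "1 / ?t\<^sup>2 \<le> ?t powr (q - 1)"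
  proof -
    have "1 / ?t\<^sup>2 = ?t powr (-2)" using t(1) by (simp add: powr_minus_divide)
    also have "\<dots> \<le> ?t powr (q - 1)" using t(1) pq by (intro powr_mono) auto
    finally show ?thesis .
  qed
  have "z t n - (\<Sum>l<N. z t l) / N = (\<Sum>l<N. (?K T k n l - 1 / N) * z T l)
      + (\<Sum>j<k. \<Sum>l<N. (?K (T + Suc j) (k - Suc j) n l - 1 / N) * f (T + j) l)"
    unfolding tk using n by (intro consensus_disagreement_eq rec sym)
  then have "\<bar>z t n - (\<Sum>l<N. z t l) / N\<bar> \<le> \<bar>\<Sum>l<N. (?K T k n l - 1 / N) * z T l\<bar>
      + \<bar>\<Sum>j<k. \<Sum>l<N. (?K (T + Suc j) (k - Suc j) n l - 1 / N) * f (T + j) l\<bar>"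
    by (simp only: abs_triangle_ineq)
  also have "\<dots> \<le> N * (1 / ?t\<^sup>2 * X) + (\<Sum>j<k. N * (?W j * (C * Y)))"
    by (intro add_mono init order_trans[OF sum_abs sum_mono] trm) auto
  also have "\<dots> = N * (1 / ?t\<^sup>2 * X) + N * ((\<Sum>j<k. ?W j) * (C * Y))"
    by (simp add: sum_distrib_left sum_distrib_right)
  also have "\<dots> \<le> N * (?t powr (q - 1) * Y) + N * (5 * ?t powr (q - 1) * (C * Y))"
    using weights t2 X Y C by (intro add_mono mult_left_mono mult_mono) auto
  also have "\<dots> = N * (1 + 5 * C) * (?t powr (q - 1) * Y)" by (simp add: algebra_simps)
  finally show ?thesis unfolding Y_def .
qed

section \<open>Consensus plus innovation along a path\<close>

text \<open>An error splits into the disagreement \<open>e - m\<close>, the averaged noise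
  \<open>v\<close> and the remainder \<open>g = m - v\<close> of the network average. Subtracting
  \<open>v\<close> cancels the noise exactly, so \<open>g\<close> is driven only by \<open>v\<close>
  and by the disagreement. Only the network mean of the matrices \<open>C t n\<close> is known to
  approach the identity, which is why contraction is sought for the average and not agent by
  agent.\<close>

lemma consensus_innovation_tendsto_0:
  fixes e \<xi> :: "nat \<Rightarrow> nat \<Rightarrow> nat \<Rightarrow> real" and C :: "nat \<Rightarrow> nat \<Rightarrow> nat \<Rightarrow> nat \<Rightarrow> real"
  assumes rec: "\<And>t n i. t \<ge> T \<Longrightarrow> n < N \<Longrightarrow> i < d \<Longrightarrow>
        e (Suc t) n i = consensus_step N (\<beta> t) (w t) (\<lambda>n. e t n i) n
          + a / (real t + 1) * (\<xi> t n i - (\<Sum>j<d. C t n i j * e t n j))"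
    and sym: "\<And>t n l. n < N \<Longrightarrow> l < N \<Longrightarrow> w t n l = w t l n"
    and ker1: "\<And>s k n l. s \<ge> T \<Longrightarrow> n < N \<Longrightarrow> l < N \<Longrightarrow> \<bar>consensus_kernel N \<beta> w s k n l - 1 / N\<bar> \<le> 1"
    and ker2: "\<And>s k n l. s \<ge> T \<Longrightarrow> n < N \<Longrightarrow> l < N \<Longrightarrow> T' \<le> s + k \<Longrightarrow> real (s + k) powr q \<le> real k \<Longrightarrow>
        \<bar>consensus_kernel N \<beta> w s k n l - 1 / N\<bar> \<le> 1 / (real (s + k))\<^sup>2"
    and C: "\<And>t n i j. t \<ge> T \<Longrightarrow> n < N \<Longrightarrow> i < d \<Longrightarrow> j < d \<Longrightarrow> \<bar>C t n i j\<bar> \<le> B"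
    and C_lim: "\<And>i j. i < d \<Longrightarrow> j < d \<Longrightarrow> (\<lambda>t. (\<Sum>n<N. C t n i j) / N) \<longlonglongrightarrow> of_bool (i = j)"
    and xi: "\<And>t n i. t \<ge> T \<Longrightarrow> n < N \<Longrightarrow> i < d \<Longrightarrow> \<bar>\<xi> t n i\<bar> \<le> B * (real t + 1) powr p"
    and xi_lim: "\<And>i. i < d \<Longrightarrow>
        (\<lambda>t. (real t + 1) powr r * ((\<Sum>s<t. (\<Sum>n<N. \<xi> s n i) / N) / real t)) \<longlonglongrightarrow> 0"
    and a: "a \<ge> 1" and B: "B \<ge> 0" and N: "N > 0"
    and pq: "0 \<le> p" "0 \<le> q" "p + q < 1 / 2" and r: "0 \<le> r" "r < 1 / 2"
    and ni: "n < N" "i < d"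
  shows "(\<lambda>t. (real t + 1) powr r * e t n i) \<longlonglongrightarrow> 0"
proof -
  define m where "m t i = (\<Sum>n<N. e t n i) / N" for t i
  define x where "x t i = (\<Sum>n<N. \<xi> t n i) / N" for t i
  define A where "A t i j = (\<Sum>n<N. C t n i j) / N" for t i j
  define v where "v t i = a * ((\<Sum>s<t. x s i) / real t)" for t i
  define g where "g t i = m t i - v t i" for t i
  define gs where "gs t = (\<Sum>i<d. \<bar>g t i\<bar>)" for t
  define vs where "vs t = (\<Sum>i<d. \<bar>v t i\<bar>)" for t
  define Cf where "Cf = a * (B * d + B)"
  have Cf: "Cf \<ge> 0" using a B by (simp add: Cf_def)
  have v_lim: "(\<lambda>t. (real t + 1) powr r * v t i) \<longlonglongrightarrow> 0" if "i < d" for i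
    using tendsto_mult_right_zero[OF xi_lim[OF that], of a]
    by (simp add: v_def x_def mult_ac)
  have vs_lim: "(\<lambda>t. (real t + 1) powr r * vs t) \<longlonglongrightarrow> 0"
    unfolding vs_def sum_distrib_left
    by (intro tendsto_null_sum) (use v_lim tendsto_rabs_zero in \<open>fastforce simp: abs_mult\<close>)

  \<comment> \<open>Disagreement under an a priori bound on the errors\<close>
  define D where "D X t = N * (1 + 5 * Cf) * (real t powr (q - 1) * (X + real t powr p))" for X :: real and t :: nat
  let ?near = "\<lambda>t c. \<forall>n i. n < N \<longrightarrow> i < d \<longrightarrow> \<bar>e t n i - m t i\<bar> \<le> c"
  let ?bdd = "\<lambda>t c. \<forall>s n i. T \<le> s \<longrightarrow> s < t \<longrightarrow> n < N \<longrightarrow> i < d \<longrightarrow> \<bar>e s n i\<bar> \<le> c"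
  \<comment> \<open>The quantifier over \<open>X\<close> stands inside the eventuality: the
    threshold time does not depend on \<open>X\<close>, so the bootstrap may choose its bound after
    the threshold.\<close>
  have disagree: "\<forall>\<^sub>F t in sequentially. t > T \<and> (\<forall>X\<ge>0. ?bdd t X
      \<longrightarrow> ?near t (D X t))"
  proof -
    have q1: "q < 1" using pq by simp
    have "(\<lambda>t. real t powr q / real t) \<longlonglongrightarrow> 0"
      using q1 by real_asymp
    then have ev1: "\<forall>\<^sub>F t in sequentially. real t powr q / real t < 1 / 2"
      by (rule order_tendstoD(2)) simp
    show ?thesis
      using ev1 eventually_ge_at_top[of "max (max 1 T') (2 * T + 1)"]
    proof eventually_elim
      case (elim t)
      then have t: "t \<ge> 1" "t \<ge> T'" "t \<ge> 2 * T + 1" by auto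
      have h: "2 * real t powr q \<le> real t" using elim t(1) by (simp add: field_simps)
      show ?case
      proof (intro conjI allI impI)
        show "T < t" using t(3) by simp
        fix X :: real and n i
        assume X: "0 \<le> X" and bd: "?bdd t X"
          and n: "n < N" and i: "i < d"
        show "\<bar>e t n i - m t i\<bar> \<le> D X t"
          unfolding D_def m_def
        proof (rule consensus_disagreement_bound[where z = "\<lambda>t n. e t n i" and T = T and p = p and q = q and \<beta> = \<beta> and w = w
              and f = "\<lambda>t n. a / (real t + 1) * (\<xi> t n i - (\<Sum>j<d. C t n i j * e t n j))"])
          fix s l assume s: "T \<le> s" "s < t" and l: "l < N"
          have "\<bar>\<Sum>j<d. C s l i j * e s l j\<bar> \<le> (\<Sum>j<d. B * X)"
            using C[OF s(1) l i] bd s l B X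
            by (intro order_trans[OF sum_abs] sum_mono) (auto simp: abs_mult intro!: mult_mono)
          then have "\<bar>\<xi> s l i - (\<Sum>j<d. C s l i j * e s l j)\<bar> \<le> B * (real s + 1) powr p + d * (B * X)"
            using xi[OF s(1) l i] by simp
          also have "\<dots> \<le> (B * d + B) * (X + (real s + 1) powr p)"
            using B X by (simp add: algebra_simps)
          finally have "\<bar>a / (real s + 1) * (\<xi> s l i - (\<Sum>j<d. C s l i j * e s l j))\<bar>
              \<le> a / (real s + 1) * ((B * d + B) * (X + (real s + 1) powr p))"
            using a by (simp add: abs_mult mult_left_mono divide_right_mono)
          then show "\<bar>a / (real s + 1) * (\<xi> s l i - (\<Sum>j<d. C s l i j * e s l j))\<bar>
              \<le> Cf / (real s + 1) * (X + (real s + 1) powr p)"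
            by (simp add: Cf_def mult_ac)
        next
          fix l assume "l < N" then show "\<bar>e T l i\<bar> \<le> X" using bd t(3) i by auto
        next
          show "real T + real t powr q \<le> real t" using h t(3) by linarith
        qed (use rec sym ker1 ker2 t h pq Cf X n i in auto)
      qed
    qed
  qed

  \<comment> \<open>The network average with its noise subtracted\<close>
  have e_le: "\<bar>e t n i\<bar> \<le> gs t + vs t + \<bar>e t n i - m t i\<bar>" if "i < d" for t n i
  proof -
    have "\<bar>g t i\<bar> \<le> gs t" "\<bar>v t i\<bar> \<le> vs t"
      unfolding gs_def vs_def using that member_le_sum[of i "{..<d}" "\<lambda>i. \<bar>g t i\<bar>"]
        member_le_sum[of i "{..<d}" "\<lambda>i. \<bar>v t i\<bar>"] by auto
    then show ?thesis unfolding g_def by linarith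
  qed

  \<comment> \<open>A running mean obeys a harmonic recursion itself, and its input
    \<open>a * x / (t + 1)\<close> is exactly the noise term in the recursion of \<open>m\<close>.
    At time 0 the division by zero gives \<open>v 0 = 0\<close>, which fits the recursion.\<close>
  have v_rec: "v (Suc t) i = v t i - v t i / (real t + 1) + a / (real t + 1) * x t i" for t i
    by (cases "t = 0") (simp_all add: v_def divide_simps, simp_all add: algebra_simps)

  have m_rec: "m (Suc t) i = m t i + a / (real t + 1) * x t i
      - a / (real t + 1) * ((\<Sum>j<d. A t i j * m t j) + (\<Sum>j<d. (\<Sum>n<N. C t n i j * (e t n j - m t j)) / N))"
    if t: "t \<ge> T" and i: "i < d" for t i
  proof -
    have "(\<Sum>n<N. e (Suc t) n i) = (\<Sum>n<N. e t n i)
        + a / (real t + 1) * ((\<Sum>n<N. \<xi> t n i) - (\<Sum>n<N. \<Sum>j<d. C t n i j * e t n j))"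
      using rec[OF t _ i] by (simp add: sum.distrib sum_consensus_step sym sum_distrib_left sum_subtractf right_diff_distrib)
    moreover have *: "(\<Sum>n<N. \<Sum>j<d. C t n i j * e t n j) / N
        = (\<Sum>j<d. A t i j * m t j) + (\<Sum>j<d. (\<Sum>n<N. C t n i j * (e t n j - m t j)) / N)"
    proof -
      have "(\<Sum>n<N. \<Sum>j<d. C t n i j * e t n j) / N = (\<Sum>j<d. (\<Sum>n<N. C t n i j * e t n j) / N)"
        by (subst sum.swap) (simp add: sum_divide_distrib)
      also have "\<dots> = (\<Sum>j<d. A t i j * m t j + (\<Sum>n<N. C t n i j * (e t n j - m t j)) / N)"
        by (intro sum.cong refl)
           (simp add: A_def right_diff_distrib sum_subtractf sum_distrib_right[symmetric] diff_divide_distrib)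
      finally show ?thesis by (simp add: sum.distrib)
    qed
    ultimately have "m (Suc t) i = ((\<Sum>n<N. e t n i)
        + a / (real t + 1) * ((\<Sum>n<N. \<xi> t n i) - (\<Sum>n<N. \<Sum>j<d. C t n i j * e t n j))) / N"
      by (simp only: m_def)
    also have "\<dots> = m t i + a / (real t + 1) * x t i - a / (real t + 1) * ((\<Sum>n<N. \<Sum>j<d. C t n i j * e t n j) / N)"
      by (simp add: m_def x_def add_divide_distrib diff_divide_distrib right_diff_distrib)
    finally show ?thesis by (simp only: *)
  qed

  define \<eta> where "\<eta> t = (\<Sum>i<d. \<Sum>j<d. \<bar>A t i j - of_bool (i = j)\<bar>)" for t
  have eta0: "\<eta> \<longlonglongrightarrow> 0"
    unfolding \<eta>_def
    by (intro tendsto_null_sum tendsto_rabs_zero Lim_null[THEN iffD1]) (use C_lim in \<open>auto simp: A_def\<close>)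
  \<comment> \<open>The part \<open>1 + 2 * a\<close> bounds the coefficient of \<open>vs\<close>
    once \<open>\<eta> \<le> 1\<close>; the part \<open>a * (d * d * B)\<close> is the coefficient
    of the disagreement after summation over the \<open>d\<close> coordinates.\<close>
  define C2 where "C2 = 1 + 2 * a + a * (d * d * B)"
  have C2: "C2 > 0" using a B by (simp add: C2_def add_pos_nonneg)
  define h where "h \<delta> t = C2 * (vs t + \<delta>)" for \<delta> :: real and t
  \<comment> \<open>The rate is \<open>a * (1 - \<eta> t) \<ge> 3 / 4\<close> once
    \<open>\<eta> t < 1 / 4\<close>. The value 3/4 exceeds every admissible \<open>r < 1 / 2\<close>
    and stays below 1, as the weighted recursion lemma demands. \<open>\<delta>\<close> is left free
    because it is first a bootstrap bound and afterwards a decaying one.\<close>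
  have gs_rec: "\<forall>\<^sub>F t in sequentially. \<forall>\<delta>\<ge>0. ?near t (\<delta>) \<longrightarrow>
      gs (Suc t) \<le> (1 - (3/4) / (real t + 1)) * gs t + h \<delta> t / (real t + 1)"
  proof -
    have ev: "\<forall>\<^sub>F t in sequentially. \<eta> t < 1 / 4" using eta0 by (rule order_tendstoD(2)) simp
    \<comment> \<open>This keeps the factor \<open>1 - a / (t + 1)\<close> nonnegative, although
      \<open>a\<close> may exceed 1.\<close>
    have ev2: "\<forall>\<^sub>F t in sequentially. real t \<ge> a"
      using filterlim_real_sequentially filterlim_at_top by blast
    show ?thesis using ev ev2 eventually_ge_at_top[of T]
    proof (eventually_elim, intro allI impI)
      fix t :: nat and \<delta> :: real
      assume eta: "\<eta> t < 1 / 4" and at: "a \<le> real t" and t: "T \<le> t"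
        and \<delta>: "0 \<le> \<delta>" "?near t \<delta>"
      let ?u = "real t + 1"
      have eta_nn: "0 \<le> \<eta> t" unfolding \<eta>_def by (intro sum_nonneg) auto
      define q1 where "q1 i = (\<Sum>j<d. \<bar>A t i j - of_bool (i = j)\<bar>)" for i
      have q1: "(\<Sum>i<d. q1 i) = \<eta> t" by (simp add: q1_def \<eta>_def)
      have q1nn: "0 \<le> q1 i" for i unfolding q1_def by (intro sum_nonneg) auto
      have one: "\<bar>g (Suc t) i\<bar> \<le> (1 - a / ?u) * \<bar>g t i\<bar> + a / ?u * (q1 i * gs t)
          + (\<bar>v t i\<bar> + a * \<bar>v t i\<bar> + a * (q1 i * vs t) + a * (d * B * \<delta>)) / ?u" if i: "i < d" for i
      proof -
        let ?D = "\<lambda>z. \<Sum>j<d. (A t i j - of_bool (i = j)) * z j"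
        define E where "E = (\<Sum>j<d. (\<Sum>n<N. C t n i j * (e t n j - m t j)) / N)"
        have "\<bar>\<Sum>n<N. C t n i j * (e t n j - m t j)\<bar> \<le> (\<Sum>n<N. B * \<delta>)" if "j < d" for j
          using C[OF t _ i that] \<delta> that B
          by (intro order_trans[OF sum_abs] sum_mono) (auto simp: abs_mult intro!: mult_mono)
        then have "\<bar>(\<Sum>n<N. C t n i j * (e t n j - m t j)) / N\<bar> \<le> B * \<delta>" if "j < d" for j
          using that N by (simp add: field_simps)
        then have "\<bar>E\<bar> \<le> (\<Sum>j<d. B * \<delta>)"
          unfolding E_def by (intro order_trans[OF sum_abs] sum_mono) auto
        then have E: "\<bar>E\<bar> \<le> d * B * \<delta>" by simp
        have dec: "(\<Sum>j<d. A t i j * z j) = z i + ?D z" for z :: "nat \<Rightarrow> real"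
        proof -
          have "(\<Sum>j<d. of_bool (i = j) * z j) = (\<Sum>j<d. if i = j then z j else 0)"
            by (intro sum.cong) auto
          then show ?thesis using i by (simp add: left_diff_distrib sum_subtractf)
        qed
        have small: "\<bar>?D z\<bar> \<le> q1 i * (\<Sum>j<d. \<bar>z j\<bar>)" for z :: "nat \<Rightarrow> real"
          unfolding q1_def sum_distrib_right
          by (intro order_trans[OF sum_abs] sum_mono)
             (auto simp: abs_mult intro!: mult_left_mono member_le_sum)
        have mg: "m t j = g t j + v t j" for j by (simp add: g_def)
        have "g (Suc t) i = m t i - v t i + v t i / ?u - a / ?u * ((\<Sum>j<d. A t i j * m t j) + E)"
          unfolding g_def m_rec[OF t i] v_rec E_def by simp
        also have "(\<Sum>j<d. A t i j * m t j) = g t i + v t i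
            + ?D (g t) + ?D (v t)"
          unfolding dec mg by (simp add: distrib_left sum.distrib)
        finally have "g (Suc t) i = (1 - a / ?u) * g t i - a / ?u * ?D (g t)
          + (v t i - a * v t i - a * ?D (v t) - a * E) / ?u"
          by (simp add: g_def algebra_simps add_divide_distrib diff_divide_distrib)
        then have "\<bar>g (Suc t) i\<bar> \<le> \<bar>(1 - a / ?u) * g t i\<bar> + \<bar>a / ?u * ?D (g t)\<bar>
          + \<bar>(v t i - a * v t i - a * ?D (v t) - a * E) / ?u\<bar>"
          by linarith
        also have "\<dots> \<le> (1 - a / ?u) * \<bar>g t i\<bar> + a / ?u * (q1 i * gs t)
          + (\<bar>v t i\<bar> + a * \<bar>v t i\<bar> + a * (q1 i * vs t) + a * (d * B * \<delta>)) / ?u"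
        proof (intro add_mono)
          show "\<bar>(1 - a / ?u) * g t i\<bar> \<le> (1 - a / ?u) * \<bar>g t i\<bar>"
            using at by (simp add: abs_mult)
          show "\<bar>a / ?u * ?D (g t)\<bar> \<le> a / ?u * (q1 i * gs t)"
            unfolding abs_mult gs_def using a small by (intro mult_mono) auto
          have "\<bar>a * v t i\<bar> = a * \<bar>v t i\<bar>" "\<bar>a * ?D (v t)\<bar> \<le> a * (q1 i * vs t)"
            "\<bar>a * E\<bar> \<le> a * (d * B * \<delta>)"
            unfolding vs_def abs_mult using a small E by (auto intro!: mult_left_mono)
          then have "\<bar>v t i - a * v t i - a * ?D (v t) - a * E\<bar>
             \<le> \<bar>v t i\<bar> + a * \<bar>v t i\<bar> + a * (q1 i * vs t) + a * (d * B * \<delta>)"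
            by linarith
          then show "\<bar>(v t i - a * v t i - a * ?D (v t) - a * E) / ?u\<bar>
             \<le> (\<bar>v t i\<bar> + a * \<bar>v t i\<bar> + a * (q1 i * vs t) + a * (d * B * \<delta>)) / ?u"
            by (simp add: abs_divide divide_right_mono)
        qed
        finally show ?thesis .
      qed
      have gsnn: "0 \<le> gs t" "0 \<le> vs t" by (auto simp: gs_def vs_def intro: sum_nonneg)
      have "gs (Suc t) \<le> (\<Sum>i<d. (1 - a / ?u) * \<bar>g t i\<bar> + a / ?u * (q1 i * gs t)
          + (\<bar>v t i\<bar> + a * \<bar>v t i\<bar> + a * (q1 i * vs t) + a * (d * B * \<delta>)) / ?u)"
        unfolding gs_def[of "Suc t"] using one by (intro sum_mono) auto
      also have "\<dots> = (1 - a / ?u) * gs t + a / ?u * (\<eta> t * gs t)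
          + (vs t + a * vs t + a * (\<eta> t * vs t) + d * (a * (d * B * \<delta>))) / ?u"
        by (simp only: sum.distrib sum_divide_distrib[symmetric] sum_distrib_left[symmetric]
            sum_distrib_right[symmetric] q1 gs_def[symmetric] vs_def[symmetric])
           (simp add: gs_def vs_def)
      also have "\<dots> \<le> (1 - (3/4) / ?u) * gs t + h \<delta> t / ?u"
      proof (rule add_mono)
        have "(1 - a / ?u) * gs t + a / ?u * (\<eta> t * gs t) = (1 - (a * (1 - \<eta> t)) / ?u) * gs t"
          by (simp add: algebra_simps diff_divide_distrib)
        also have "\<dots> \<le> (1 - (3/4) / ?u) * gs t"
        proof -
          have "1 * (3/4) \<le> a * (1 - \<eta> t)" using a eta by (intro mult_mono) auto
          then show ?thesis using gsnn by (intro mult_right_mono diff_left_mono divide_right_mono) auto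
        qed
        finally show "(1 - a / ?u) * gs t + a / ?u * (\<eta> t * gs t) \<le> (1 - (3/4) / ?u) * gs t" .
        have "\<eta> t * vs t \<le> 1 * vs t" using eta gsnn by (intro mult_right_mono) auto
        then have "a * (\<eta> t * vs t) \<le> a * vs t" using a by simp
        then have "vs t + a * vs t + a * (\<eta> t * vs t) + d * (a * (d * B * \<delta>))
           \<le> (1 + 2 * a) * vs t + a * (d * d * B) * \<delta>" by (simp add: algebra_simps)
        also have "\<dots> \<le> C2 * vs t + C2 * \<delta>"
        proof -
          have "1 + 2 * a \<le> C2" "a * (d * d * B) \<le> C2" using a B by (auto simp: C2_def)
          then show ?thesis using gsnn \<delta>(1) by (intro add_mono mult_right_mono)
        qed
        finally have "vs t + a * vs t + a * (\<eta> t * vs t) + d * (a * (d * B * \<delta>)) \<le> h \<delta> t"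
          by (simp add: h_def distrib_left)
        then show "(vs t + a * vs t + a * (\<eta> t * vs t) + d * (a * (d * B * \<delta>))) / ?u \<le> h \<delta> t / ?u"
          by (intro divide_right_mono) auto
      qed
      finally show "gs (Suc t) \<le> (1 - (3/4) / ?u) * gs t + h \<delta> t / ?u" .
    qed
  qed

  \<comment> \<open>Bootstrap to a uniform bound on the errors\<close>
  obtain X where X: "0 \<le> X" "\<And>s n i. T \<le> s \<Longrightarrow> n < N \<Longrightarrow> i < d \<Longrightarrow> \<bar>e s n i\<bar> \<le> X"
  proof -
    \<comment> \<open>Errors up to \<open>2 * Y\<close> produce disagreement at most
      \<open>1 + \<epsilon> * (2 * Y)\<close>. The condition
      \<open>C2 * \<epsilon> \<le> 1 / 8\<close> keeps its effect on \<open>gs\<close> below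
      \<open>Y / 4\<close>, and \<open>\<epsilon> \<le> 1 / 8\<close> keeps its direct share of the
      error below \<open>Y / 4\<close>.\<close>
    define \<epsilon> where "\<epsilon> = min (1 / 8) (1 / (8 * C2))"
    have \<epsilon>: "0 < \<epsilon>" "\<epsilon> \<le> 1 / 8" "C2 * \<epsilon> \<le> 1 / 8"
      using C2 by (auto simp: \<epsilon>_def min_def field_simps)
    have vs0: "vs \<longlonglongrightarrow> 0"
    proof (rule Lim_null_comparison[OF _ vs_lim])
      show "\<forall>\<^sub>F t in sequentially. norm (vs t) \<le> (real t + 1) powr r * vs t"
      proof (rule always_eventually, rule allI)
        fix t
        have "0 \<le> vs t" by (auto simp: vs_def intro: sum_nonneg)
        moreover have "1 \<le> (real t + 1) powr r" using r by (intro ge_one_powr_ge_zero) auto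
        ultimately show "norm (vs t) \<le> (real t + 1) powr r * vs t"
          using mult_right_mono[of 1 "(real t + 1) powr r" "vs t"] by simp
      qed
    qed
    have "(\<lambda>t. N * (1 + 5 * Cf) * real t powr (q - 1)) \<longlonglongrightarrow> 0"
      using pq by (intro tendsto_mult_right_zero) real_asymp
    then have e1: "\<forall>\<^sub>F t in sequentially. N * (1 + 5 * Cf) * real t powr (q - 1) < \<epsilon>"
      by (rule order_tendstoD(2)) (rule \<epsilon>)
    have "(\<lambda>t. N * (1 + 5 * Cf) * (real t powr (q - 1) * real t powr p)) \<longlonglongrightarrow> 0"
      using pq by (intro tendsto_mult_right_zero) real_asymp
    then have e2: "\<forall>\<^sub>F t in sequentially. N * (1 + 5 * Cf) * (real t powr (q - 1) * real t powr p) < 1"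
      by (rule order_tendstoD(2)) simp
    have e3: "\<forall>\<^sub>F t in sequentially. vs t < 1" by (rule order_tendstoD(2)[OF vs0]) simp
    obtain T2 where T2: "\<And>t. t \<ge> T2 \<Longrightarrow> N * (1 + 5 * Cf) * real t powr (q - 1) < \<epsilon>"
      "\<And>t. t \<ge> T2 \<Longrightarrow> N * (1 + 5 * Cf) * (real t powr (q - 1) * real t powr p) < 1"
      "\<And>t. t \<ge> T2 \<Longrightarrow> vs t < 1"
      "\<And>t. t \<ge> T2 \<Longrightarrow> t > T \<and> (\<forall>X\<ge>0. ?bdd t X
        \<longrightarrow> ?near t (D X t))"
      "\<And>t. t \<ge> T2 \<Longrightarrow> \<forall>\<delta>\<ge>0. ?near t (\<delta>) \<longrightarrow>
        gs (Suc t) \<le> (1 - (3/4) / (real t + 1)) * gs t + h \<delta> t / (real t + 1)"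
      using eventually_conj[OF e1 eventually_conj[OF e2 eventually_conj[OF e3 eventually_conj[OF disagree gs_rec]]]]
      unfolding eventually_sequentially by blast
    \<comment> \<open>\<open>4 * C2 \<le> Y\<close> absorbs the constant forcing
      \<open>2 * C2\<close> into \<open>Y / 2\<close>, and \<open>4 \<le> Y\<close> absorbs the
      additive constants in the error bound. The other summands cover the state at \<open>T2\<close>
      and the whole history before it.\<close>
    define Y where "Y = 4 + 4 * C2 + gs T2 + (\<Sum>s\<le>T2. \<Sum>n<N. \<Sum>i<d. \<bar>e s n i\<bar>)"
    have snn: "0 \<le> (\<Sum>s\<le>T2. \<Sum>n<N. \<Sum>i<d. \<bar>e s n i\<bar>)" by (intro sum_nonneg) auto
    have gnn: "0 \<le> gs t" for t by (auto simp: gs_def intro: sum_nonneg)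
    have Y: "Y \<ge> 4" "Y \<ge> 4 * C2" "gs T2 \<le> Y" using C2 snn gnn[of T2] unfolding Y_def by linarith+
    have init: "\<bar>e s n i\<bar> \<le> 2 * Y" if "s \<le> T2" "n < N" "i < d" for s n i
    proof -
      have "\<bar>e s n i\<bar> \<le> (\<Sum>i<d. \<bar>e s n i\<bar>)" using that by (intro member_le_sum) auto
      also have "\<dots> \<le> (\<Sum>n<N. \<Sum>i<d. \<bar>e s n i\<bar>)"
        using that by (intro member_le_sum[of n _ "\<lambda>n. \<Sum>i<d. \<bar>e s n i\<bar>"]) (auto intro: sum_nonneg)
      also have "\<dots> \<le> (\<Sum>s\<le>T2. \<Sum>n<N. \<Sum>i<d. \<bar>e s n i\<bar>)"
        using that by (intro member_le_sum[of s _ "\<lambda>s. \<Sum>n<N. \<Sum>i<d. \<bar>e s n i\<bar>"]) (auto intro: sum_nonneg)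
      also have "\<dots> \<le> Y" using C2 gnn[of T2] unfolding Y_def by simp
      also have "Y \<le> 2 * Y" using Y(1) by simp
      finally show ?thesis .
    qed
    have DY: "D (2 * Y) t \<le> 1 + \<epsilon> * (2 * Y)" if "t \<ge> T2" for t
    proof -
      have "D (2 * Y) t = N * (1 + 5 * Cf) * (real t powr (q - 1) * real t powr p)
          + N * (1 + 5 * Cf) * real t powr (q - 1) * (2 * Y)"
        unfolding D_def by (simp add: algebra_simps)
      also have "\<dots> \<le> 1 + \<epsilon> * (2 * Y)"
        using T2(1,2)[OF that] Y(1) by (intro add_mono mult_right_mono) auto
      finally show ?thesis .
    qed
    \<comment> \<open>The forcing stays below \<open>3/4 * Y\<close>, so \<open>Y\<close> is a fixed
      point of the majorising recursion and \<open>gs\<close> cannot cross it.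
      \<open>?bdd (Suc t)\<close> concerns times strictly before \<open>Suc t\<close>, which is all
      that the disagreement at \<open>Suc t\<close> depends on; hence the induction is not
      circular.\<close>
    have key: "gs t \<le> Y \<and> ?bdd (Suc t) (2 * Y)" if "t \<ge> T2" for t
      using that
    proof (induction t rule: dec_induct)
      case base
      then show ?case using init Y by auto
    next
      case (step t)
      have "\<bar>e t n i - m t i\<bar> \<le> 1 + \<epsilon> * (2 * Y)" if "n < N" "i < d" for n i
      proof -
        have "\<bar>e t n i - m t i\<bar> \<le> D (2 * Y) t"
          using T2(4)[OF step(1)] step.IH that Y(1) by auto
        then show ?thesis using DY[OF step(1)] by linarith
      qed
      moreover have "0 \<le> 1 + \<epsilon> * (2 * Y)" using \<epsilon> Y by simp
      ultimately have "gs (Suc t) \<le> (1 - (3/4) / (real t + 1)) * gs t + h (1 + \<epsilon> * (2 * Y)) t / (real t + 1)"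
        using T2(5)[OF step(1)] by blast
      also have "\<dots> \<le> (1 - (3/4) / (real t + 1)) * Y + (3/4 * Y) / (real t + 1)"
      proof (intro add_mono mult_left_mono divide_right_mono)
        have "h (1 + \<epsilon> * (2 * Y)) t \<le> C2 * (2 + \<epsilon> * (2 * Y))"
          unfolding h_def using T2(3)[OF step(1)] C2 by (intro mult_left_mono) auto
        also have "\<dots> = 2 * C2 + 2 * Y * (C2 * \<epsilon>)" by (simp add: algebra_simps)
        also have "\<dots> \<le> 2 * C2 + 2 * Y * (1 / 8)" using \<epsilon> Y by (intro add_left_mono mult_left_mono) auto
        also have "\<dots> \<le> 3/4 * Y" using Y(2) by simp
        finally show "h (1 + \<epsilon> * (2 * Y)) t \<le> 3/4 * Y" .
      qed (use step.IH in auto)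
      also have "\<dots> = Y" by (simp add: algebra_simps)
      finally have g1: "gs (Suc t) \<le> Y" .
      have "\<bar>e (Suc t) n i\<bar> \<le> 2 * Y" if ni: "n < N" "i < d" for n i
      proof -
        have S: "T2 \<le> Suc t" using step(1) by simp
        have "\<bar>e (Suc t) n i - m (Suc t) i\<bar> \<le> D (2 * Y) (Suc t)"
          using T2(4)[OF S] step.IH ni Y(1) by auto
        then have "\<bar>e (Suc t) n i\<bar> \<le> Y + 1 + (1 + \<epsilon> * (2 * Y))"
          using e_le[OF ni(2), of "Suc t" n] g1 T2(3)[OF S] DY[OF S] by linarith
        moreover have "\<epsilon> * (2 * Y) \<le> 1 / 8 * (2 * Y)" using \<epsilon> Y by (intro mult_right_mono) auto
        ultimately show ?thesis using Y(1) by linarith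
      qed
      with g1 step.IH show ?case by (auto simp: less_Suc_eq)
    qed
    show thesis
    proof
      show "0 \<le> 2 * Y" using Y by simp
      fix s n i assume "T \<le> s" "n < N" "i < d"
      then show "\<bar>e s n i\<bar> \<le> 2 * Y" using key[of "max s T2"] by (auto simp: le_imp_less_Suc)
    qed
  qed

  \<comment> \<open>Rates from the uniform bound\<close>
  have dis: "\<forall>\<^sub>F t in sequentially. ?near t (D X t)"
    using disagree by eventually_elim (use X in blast)
  \<comment> \<open>\<open>r < 1 / 2\<close> and \<open>p + q < 1 / 2\<close> make the exponent
    \<open>r + p + q - 1\<close> negative.\<close>
  have D_lim: "(\<lambda>t. (real t + 1) powr r * D X t) \<longlonglongrightarrow> 0"
  proof -
    have "(\<lambda>t. (real t + 1) powr r * (real t powr (q - 1) * (X + real t powr p))) \<longlonglongrightarrow> 0"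
    proof -
      have "(\<lambda>t::nat. (real t + 1) powr r * real t powr (q - 1)) \<longlonglongrightarrow> 0"
        "(\<lambda>t::nat. (real t + 1) powr r * (real t powr (q - 1) * real t powr p)) \<longlonglongrightarrow> 0"
        using pq r by real_asymp+
      from tendsto_add[OF tendsto_mult_right_zero[OF this(1), of X] this(2)] show ?thesis
        by (simp add: algebra_simps)
    qed
    from tendsto_mult_right_zero[OF this, of "N * (1 + 5 * Cf)"] show ?thesis
      unfolding D_def by (simp add: mult_ac)
  qed
  have D_nn: "D X t \<ge> 0" for t unfolding D_def using Cf X by simp
  have gs_lim: "(\<lambda>t. (real t + 1) powr r * gs t) \<longlonglongrightarrow> 0"
  proof (rule powr_tendsto_0_linear_recursion[where c = "3/4" and h = "\<lambda>t. h (D X t) t"])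
    show "0 \<le> gs t" for t by (auto simp: gs_def intro: sum_nonneg)
    show "\<forall>\<^sub>F t in sequentially. gs (Suc t) \<le> (1 - (3/4) / (real t + 1)) * gs t + h (D X t) t / (real t + 1)"
      using dis gs_rec by eventually_elim (use D_nn in blast)
    show "(\<lambda>t. (real t + 1) powr r * h (D X t) t) \<longlonglongrightarrow> 0"
      using tendsto_mult_right_zero[OF tendsto_add_zero[OF vs_lim D_lim], of C2]
      by (simp add: h_def algebra_simps)
  qed (use r in auto)
  show ?thesis
  proof (rule Lim_null_comparison)
    show "(\<lambda>t. (real t + 1) powr r * gs t + (real t + 1) powr r * vs t + (real t + 1) powr r * D X t) \<longlonglongrightarrow> 0"
      using tendsto_add[OF tendsto_add[OF gs_lim vs_lim] D_lim] by simp
    show "\<forall>\<^sub>F t in sequentially. norm ((real t + 1) powr r * e t n i)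
       \<le> (real t + 1) powr r * gs t + (real t + 1) powr r * vs t + (real t + 1) powr r * D X t"
      using dis
    proof eventually_elim
      case (elim t)
      then have "\<bar>e t n i\<bar> \<le> gs t + vs t + D X t" using e_le[OF ni(2), of t n] ni by force
      then have "(real t + 1) powr r * \<bar>e t n i\<bar> \<le> (real t + 1) powr r * (gs t + vs t + D X t)"
        by (rule mult_left_mono) simp
      then show ?case by (simp add: abs_mult distrib_left)
    qed
  qed
qed

section \<open>Sums with predictable coefficients\<close>

context prob_space
begin

text \<open>Markov's inequality makes the probabilities of \<open>1 \<le> X k\<close> summable, and
  Borel-Cantelli applies. The almost sure bounds on sums, single terms and kernels are all brought
  into this form by normalising.\<close>

lemma AE_eventually_less_1:
  fixes X :: "nat \<Rightarrow> 'a \<Rightarrow> real"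
  assumes [simp]: "\<And>k. integrable M (X k)" and nn: "\<And>k x. x \<in> space M \<Longrightarrow> 0 \<le> X k x"
    and sm: "summable (\<lambda>k. expectation (X k))"
  shows "AE x in M. \<forall>\<^sub>F k in sequentially. X k x < 1"
proof -
  have [measurable]: "X k \<in> borel_measurable M" for k by (rule borel_measurable_integrable) simp
  have "prob {x \<in> space M. 1 \<le> X k x} \<le> expectation (X k)" for k
    using integral_Markov_inequality_measure[of M "X k" "space M" 1] nn by (simp add: AE_I2)
  then have "summable (\<lambda>k. prob {x \<in> space M. 1 \<le> X k x})"
    by (intro summable_comparison_test'[OF sm]) auto
  then have "AE x in M. \<forall>\<^sub>F k in sequentially. x \<in> space M - {x \<in> space M. 1 \<le> X k x}"
    by (intro borel_cantelli_AE1) (auto simp: less_top[symmetric])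
  then show ?thesis
    by (rule AE_mp) (auto intro!: AE_I2 elim!: eventually_mono)
qed

text \<open>The preimages of Borel sets under one function already form a sigma-algebra, so
  independence of the two given families passes to the sigma-algebras generated by \<open>X\<close>
  and \<open>U\<close>.\<close>

lemma indep_varI_indep_set:
  assumes "indep_set A (sets G)" "subalgebra M G" "U \<in> borel_measurable G"
    and X: "X \<in> borel_measurable M" "\<And>B. B \<in> sets borel \<Longrightarrow> X -` B \<inter> space M \<in> A"
  shows "indep_var borel (X :: 'a \<Rightarrow> real) borel (U :: 'a \<Rightarrow> real)"
proof -
  have sp: "space G = space M" using assms(2) by (simp add: subalgebra_def)
  have vim: "sigma_sets (space M) {Y -` B \<inter> space M | B. B \<in> sets borel} = {Y -` B \<inter> space M | B. B \<in> sets borel}"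
    for Y :: "'a \<Rightarrow> real"
    by (rule sigma_sets_vimage_commute[of Y "space M" UNIV "sets borel", simplified sets.sigma_sets_eq[of borel, simplified], symmetric, THEN trans])
      (auto simp: sets.sigma_sets_eq[of borel, simplified])
  have "indep_set {X -` B \<inter> space M | B. B \<in> sets borel} {U -` B \<inter> space M | B. B \<in> sets borel}"
    using assms(1) unfolding indep_set_def
  proof (rule indep_sets_mono_sets)
    fix i :: bool
    show "(case i of True \<Rightarrow> {X -` B \<inter> space M | B. B \<in> sets borel} | False \<Rightarrow> {U -` B \<inter> space M | B. B \<in> sets borel})
      \<subseteq> (case i of True \<Rightarrow> A | False \<Rightarrow> sets G)"
      using X(2) measurable_sets[OF assms(3)] sp by (auto split: bool.split)
  qed
  then show ?thesis
    unfolding indep_var_eq vim using X(1) measurable_from_subalg[OF assms(2,3)] by simp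
qed

lemma filtration_measurable_mono:
  assumes "\<And>t. subalgebra M (F t)" "\<And>s t. s \<le> t \<Longrightarrow> sets (F s) \<subseteq> sets (F t)"
    and "f \<in> borel_measurable (F s)" "s \<le> (t :: nat)"
  shows "f \<in> borel_measurable (F t)"
  by (rule measurable_from_subalg[of "F t" "F s"]) (use assms in \<open>auto simp: subalgebra_def\<close>)

text \<open>Orthogonality of increments: the earlier sum times \<open>c t\<close> is
  \<open>F t\<close>-measurable, hence independent of the centred \<open>D t\<close>, and the cross
  term of the square has mean zero.\<close>

lemma second_moment_predictable_sum:
  fixes F :: "nat \<Rightarrow> 'a measure" and D c :: "nat \<Rightarrow> 'a \<Rightarrow> real"
  assumes sub: "\<And>t. subalgebra M (F t)" and mono: "\<And>s t. s \<le> t \<Longrightarrow> sets (F s) \<subseteq> sets (F t)"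
    and D_meas: "\<And>s. D s \<in> borel_measurable (F (Suc s))"
    and ind: "\<And>s U. U \<in> borel_measurable (F s) \<Longrightarrow> indep_var borel (D s) borel U"
    and D_sq: "\<And>s. integrable M (\<lambda>x. (D s x)\<^sup>2)" and D_mean: "\<And>s. expectation (D s) = 0"
    and c_meas: "\<And>s. c s \<in> borel_measurable (F s)" and c_bd: "\<And>s x. x \<in> space M \<Longrightarrow> \<bar>c s x\<bar> \<le> B"
  shows "integrable M (\<lambda>x. (\<Sum>s<t. c s x * D s x)\<^sup>2) \<and>
    expectation (\<lambda>x. (\<Sum>s<t. c s x * D s x)\<^sup>2) \<le> B\<^sup>2 * (\<Sum>s<t. expectation (\<lambda>x. (D s x)\<^sup>2))"
proof (induction t)
  case (Suc t)
  have up: "f \<in> borel_measurable (F s) \<Longrightarrow> s \<le> t \<Longrightarrow> f \<in> borel_measurable (F t)" for f :: "'a \<Rightarrow> real" and s t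
    by (rule filtration_measurable_mono[of F]) (use sub mono in auto)
  let ?S = "\<lambda>x. \<Sum>s<t. c s x * D s x"
  have SF: "?S \<in> borel_measurable (F t)"
    by (intro borel_measurable_sum borel_measurable_times up[OF c_meas] up[OF D_meas]) auto
  have cF: "c t \<in> borel_measurable (F t)" by (rule c_meas)
  have [measurable]: "?S \<in> borel_measurable M" "c t \<in> borel_measurable M" "D t \<in> borel_measurable M"
    by (rule measurable_from_subalg[OF sub], rule SF cF D_meas)+
  have B: "0 \<le> B" using c_bd not_empty abs_ge_zero order_trans by (metis all_not_in_conv)
  have iS: "integrable M ?S" by (rule square_integrable_imp_integrable[OF _ conjunct1[OF Suc]]) fact
  have iD: "integrable M (D t)" by (rule square_integrable_imp_integrable[OF _ D_sq]) fact
  have iSc: "integrable M (\<lambda>x. ?S x * c t x)"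
    by (rule Bochner_Integration.integrable_bound[of M "\<lambda>x. B * ?S x"])
       (use iS c_bd B in \<open>auto simp: abs_mult mult.commute[of _ "\<bar>c t _\<bar>"] intro!: AE_I2 mult_right_mono\<close>)
  have iv: "indep_var borel (D t) borel (\<lambda>x. ?S x * c t x)"
    using SF cF by (intro ind borel_measurable_times)
  have iX: "integrable M (\<lambda>x. D t x * (?S x * c t x))" by (rule indep_var_integrable[OF iv iD iSc])
  have X0: "expectation (\<lambda>x. D t x * (?S x * c t x)) = 0"
    using indep_var_lebesgue_integral[OF iv iD iSc] D_mean by simp
  have bd: "(c t x)\<^sup>2 * (D t x)\<^sup>2 \<le> B\<^sup>2 * (D t x)\<^sup>2" if "x \<in> space M" for x
    using c_bd[OF that, of t] by (intro mult_right_mono) (auto simp: abs_le_square_iff[symmetric] B)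
  have iQ: "integrable M (\<lambda>x. (c t x)\<^sup>2 * (D t x)\<^sup>2)"
    by (rule Bochner_Integration.integrable_bound[of M "\<lambda>x. B\<^sup>2 * (D t x)\<^sup>2"])
       (use D_sq bd in \<open>auto intro!: AE_I2\<close>)
  have Q: "expectation (\<lambda>x. (c t x)\<^sup>2 * (D t x)\<^sup>2) \<le> B\<^sup>2 * expectation (\<lambda>x. (D t x)\<^sup>2)"
    using integral_mono[OF iQ, of "\<lambda>x. B\<^sup>2 * (D t x)\<^sup>2"] D_sq bd by simp
  have eq: "(\<Sum>s<Suc t. c s x * D s x)\<^sup>2 = (?S x)\<^sup>2 + 2 * (D t x * (?S x * c t x)) + (c t x)\<^sup>2 * (D t x)\<^sup>2" for x
    by (simp add: power2_eq_square algebra_simps)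
  show ?case
    unfolding eq using Suc iX iQ X0 Q by (simp add: distrib_left)
qed simp

text \<open>Freezing the coefficients once the partial sums leave \<open>(-\<lambda>, \<lambda>)\<close> turns the second-moment
  bound into a maximal inequality, which is applied along dyadic times.\<close>

lemma AE_predictable_sum_bound:
  fixes F :: "nat \<Rightarrow> 'a measure" and D c :: "nat \<Rightarrow> 'a \<Rightarrow> real"
  assumes sub: "\<And>t. subalgebra M (F t)" and mono: "\<And>s t. s \<le> t \<Longrightarrow> sets (F s) \<subseteq> sets (F t)"
    and D_meas: "\<And>s. D s \<in> borel_measurable (F (Suc s))"
    and ind: "\<And>s U. U \<in> borel_measurable (F s) \<Longrightarrow> indep_var borel (D s) borel U"
    and D_sq: "\<And>s. integrable M (\<lambda>x. (D s x)\<^sup>2)" and D_mean: "\<And>s. expectation (D s) = 0"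
    and D_var: "\<And>s. expectation (\<lambda>x. (D s x)\<^sup>2) \<le> V * (real s + 1) powr q"
    and c_meas: "\<And>s. c s \<in> borel_measurable (F s)" and c_bd: "\<And>s x. x \<in> space M \<Longrightarrow> \<bar>c s x\<bar> \<le> B"
    and q: "q \<ge> 0" "(q + 1) / 2 < r"
  shows "AE x in M. \<exists>C\<ge>0. \<forall>t. \<bar>\<Sum>s<t. c s x * D s x\<bar> \<le> C * (real t + 1) powr r"
proof -
  have up: "f \<in> borel_measurable (F s) \<Longrightarrow> s \<le> t \<Longrightarrow> f \<in> borel_measurable (F t)" for f :: "'a \<Rightarrow> real" and s t
    by (rule filtration_measurable_mono[of F]) (use sub mono in auto)
  define S where "S t x = (\<Sum>s<t. c s x * D s x)" for t x
  define lam where "lam k = (2 powr r) ^ k" for k :: nat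
  define c' where "c' k s x = (if \<forall>u\<in>{..s}. \<bar>S u x\<bar> < lam k then c s x else 0)" for k s x
  define X where "X k x = (\<Sum>s<2^k. c' k s x * D s x)\<^sup>2 / (lam k)\<^sup>2" for k x
  have lam: "lam k > 0" for k by (simp add: lam_def)
  have V: "0 \<le> V"
  proof -
    have "0 \<le> expectation (\<lambda>x. (D 0 x)\<^sup>2)" by (rule integral_nonneg_AE) auto
    also have "\<dots> \<le> V" using D_var[of 0] by simp
    finally show ?thesis .
  qed
  have B: "0 \<le> B" using c_bd not_empty abs_ge_zero order_trans by (metis all_not_in_conv)
  have SF: "S u \<in> borel_measurable (F s)" if "u \<le> s" for u s
    unfolding S_def using that
    by (intro borel_measurable_sum borel_measurable_times up[OF c_meas] up[OF D_meas]) auto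
  have cm: "c' k s \<in> borel_measurable (F s)" for k s
  proof -
    have [measurable]: "c s \<in> borel_measurable (F s)" by (rule c_meas)
    have "Measurable.pred (F s) (\<lambda>x. \<forall>u\<in>{..s}. \<bar>S u x\<bar> < lam k)"
    proof (rule pred_intros_finite)
      fix u assume "u \<in> {..s}"
      then have [measurable]: "S u \<in> borel_measurable (F s)" by (intro SF) auto
      show "Measurable.pred (F s) (\<lambda>x. \<bar>S u x\<bar> < lam k)" by measurable
    qed simp
    then have [measurable]: "Measurable.pred (F s) (\<lambda>x. \<forall>u\<in>{..s}. \<bar>S u x\<bar> < lam k)" .
    have "(\<lambda>x. if \<forall>u\<in>{..s}. \<bar>S u x\<bar> < lam k then c s x else 0) \<in> borel_measurable (F s)"
      by (rule measurable_If[OF c_meas borel_measurable_const predE]) fact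
    then show ?thesis unfolding c'_def .
  qed
  have m2: "integrable M (\<lambda>x. (\<Sum>s<2^k. c' k s x * D s x)\<^sup>2)"
    "expectation (\<lambda>x. (\<Sum>s<2^k. c' k s x * D s x)\<^sup>2) \<le> B\<^sup>2 * (\<Sum>s<2^k. expectation (\<lambda>x. (D s x)\<^sup>2))" for k
    using second_moment_predictable_sum[of F D "c' k" B "2^k", OF sub mono D_meas ind D_sq D_mean cm] c_bd B
    by (auto simp: c'_def)
  \<comment> \<open>The variances up to \<open>2 ^ k\<close> add up to order
    \<open>2 powr (k * (q + 1))\<close>, while \<open>(lam k)\<^sup>2\<close> is
    \<open>2 powr (2 * r * k)\<close>. Their quotient is geometric with ratio \<open>\<rho>\<close>,
    and \<open>(q + 1) / 2 < r\<close> makes it less than 1.\<close>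
  define \<rho> where "\<rho> = 2 powr (q + 1 - 2 * r)"
  have rho: "0 \<le> \<rho>" "\<rho> < 1" using q powr_less_mono[of "q + 1 - 2 * r" 0 2] by (auto simp: \<rho>_def)
  have EX: "expectation (X k) \<le> B\<^sup>2 * V * \<rho> ^ k" for k
  proof -
    have "(\<Sum>s<2^k. expectation (\<lambda>x. (D s x)\<^sup>2)) \<le> (\<Sum>s<(2^k::nat). V * (2^k) powr q)"
    proof (intro sum_mono order_trans[OF D_var] mult_left_mono powr_mono2)
      fix s assume "s \<in> {..<(2::nat)^k}"
      then have "real (Suc s) \<le> real (2^k)" by (intro of_nat_mono) auto
      then show "real s + 1 \<le> 2^k" by simp
    qed (use q V in auto)
    also have "\<dots> = V * ((2^k) powr (q + 1))" by (simp add: powr_add)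
    finally have "expectation (\<lambda>x. (\<Sum>s<2^k. c' k s x * D s x)\<^sup>2) \<le> B\<^sup>2 * (V * ((2^k) powr (q + 1)))"
      using m2(2)[of k] mult_left_mono[of _ _ "B\<^sup>2"] by (meson order_trans zero_le_power2)
    then have "expectation (X k) \<le> B\<^sup>2 * (V * ((2^k) powr (q + 1))) / (lam k)\<^sup>2"
      unfolding X_def using lam[of k] by (simp add: divide_right_mono)
    also have "(lam k)\<^sup>2 = (2^k) powr (2 * r)"
      by (simp add: lam_def power2_eq_square powr_power powr_powr powr_add[symmetric] powr_realpow[symmetric] mult_ac)
    also have "B\<^sup>2 * (V * ((2^k) powr (q + 1))) / (2^k) powr (2 * r) = B\<^sup>2 * V * ((2^k) powr (q + 1 - 2 * r))"
      by (simp add: powr_diff)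
    also have "((2::real)^k) powr (q + 1 - 2 * r) = \<rho> ^ k"
      by (simp add: \<rho>_def powr_realpow[symmetric] powr_powr powr_power mult_ac)
    finally show ?thesis .
  qed
  have "AE x in M. \<forall>\<^sub>F k in sequentially. X k x < 1"
  proof (rule AE_eventually_less_1)
    show "integrable M (X k)" for k unfolding X_def using m2(1)[of k] by simp
    show "0 \<le> X k x" for k x by (simp add: X_def)
    have "0 \<le> expectation (X k)" for k by (rule integral_nonneg_AE) (simp add: X_def)
    then have "norm (expectation (X k)) \<le> B\<^sup>2 * V * \<rho> ^ k" for k
      using EX[of k] by (simp only: real_norm_def abs_of_nonneg)
    moreover have "summable (\<lambda>k. B\<^sup>2 * V * \<rho> ^ k)"
      using rho by (intro summable_mult summable_geometric) simp
    ultimately show "summable (\<lambda>k. expectation (X k))"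
      by (rule summable_comparison_test'[rotated])
  qed
  then show ?thesis
  proof (rule AE_mp, intro AE_I2 impI)
    fix x assume "\<forall>\<^sub>F k in sequentially. X k x < 1"
    then obtain k0 where k0: "\<And>k. k \<ge> k0 \<Longrightarrow> X k x < 1" unfolding eventually_sequentially by blast
    have small: "\<bar>S t x\<bar> < lam k" if k: "k \<ge> k0" and t: "t \<le> 2^k" for k t
    proof (rule ccontr)
      assume "\<not> \<bar>S t x\<bar> < lam k"
      then have ex: "\<exists>u. \<not> \<bar>S u x\<bar> < lam k" by blast
      define u where "u = (LEAST u. \<not> \<bar>S u x\<bar> < lam k)"
      have u: "\<not> \<bar>S u x\<bar> < lam k" unfolding u_def by (rule LeastI_ex[OF ex])
      have u_le: "u \<le> t" unfolding u_def by (rule Least_le) fact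
      have below: "\<bar>S v x\<bar> < lam k" if "v < u" for v using not_less_Least[of v] that unfolding u_def by blast
      have "(\<Sum>s<2^k. c' k s x * D s x) = (\<Sum>s<u. c s x * D s x)"
      proof (rule sum.mono_neutral_cong_right)
        show "{..<u} \<subseteq> {..<2^k}" using u_le t by auto
        show "\<forall>s\<in>{..<2^k} - {..<u}. c' k s x * D s x = 0"
        proof
          fix s assume "s \<in> {..<2^k} - {..<u}"
          then have "\<not> (\<forall>v\<in>{..s}. \<bar>S v x\<bar> < lam k)" using u by auto
          then show "c' k s x * D s x = 0" unfolding c'_def by (simp only: if_False mult_zero_left)
        qed
        show "c' k s x * D s x = c s x * D s x" if "s \<in> {..<u}" for s
          using that below unfolding c'_def by auto
      qed simp
      then have "X k x = (S u x)\<^sup>2 / (lam k)\<^sup>2" by (simp add: X_def S_def)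
      moreover have "(lam k)\<^sup>2 \<le> (S u x)\<^sup>2" using u lam[of k] by (simp add: abs_le_square_iff[symmetric])
      ultimately have "1 \<le> X k x" using lam[of k] by (simp only: le_divide_eq_1_pos zero_less_power)
      with k0[OF k] show False by simp
    qed
    \<comment> \<open>\<open>lam k0\<close> covers the times up to \<open>2 ^ k0\<close>. Later, the
      least \<open>k\<close> with \<open>t \<le> 2 ^ k\<close> overshoots \<open>t\<close> by less
      than a factor 2, which costs \<open>2 powr r\<close>.\<close>
    define C where "C = lam k0 + 2 powr r"
    have r0: "0 \<le> r" using q by (auto simp: field_simps)
    show "\<exists>C\<ge>0. \<forall>t. \<bar>\<Sum>s<t. c s x * D s x\<bar> \<le> C * (real t + 1) powr r"
    proof (intro exI[of _ C] conjI allI)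
      show "0 \<le> C" unfolding C_def using lam[of k0] by simp
      fix t :: nat
      have p1: "1 \<le> (real t + 1) powr r" using r0 by (intro ge_one_powr_ge_zero) auto
      have "\<bar>S t x\<bar> \<le> C * (real t + 1) powr r"
      proof (cases "t \<le> 2^k0")
        case True
        then have "\<bar>S t x\<bar> \<le> lam k0 * 1" using small[of k0 t] by simp
        also have "\<dots> \<le> C * (real t + 1) powr r"
          using p1 lam[of k0] by (intro mult_mono) (auto simp: C_def)
        finally show ?thesis .
      next
        case False
        define k where "k = (LEAST k. t \<le> 2^k)"
        have ex: "\<exists>k. t \<le> 2^k" by (metis less_imp_le less_exp)
        have k: "t \<le> 2^k" unfolding k_def by (rule LeastI_ex[OF ex])
        have kk: "k0 < k"
        proof (rule ccontr)
          assume "\<not> k0 < k" then have "(2::nat)^k \<le> 2^k0" by (intro power_increasing) auto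
          with k False show False by simp
        qed
        then obtain j where j: "k = Suc j" by (cases k) auto
        then have "\<not> t \<le> 2^j" using not_less_Least[of j "\<lambda>k. t \<le> 2^k"] unfolding k_def by simp
        then have "real (2^j) \<le> real t" by (intro of_nat_mono) auto
        then have "(2::real)^j \<le> real t" unfolding of_nat_power by simp
        then have tj: "2^j \<le> real t + 1" by linarith
        have "\<bar>S t x\<bar> \<le> lam k" using small[of k t] k kk by simp
        also have "lam k = 2 powr r * (2^j) powr r"
          by (simp add: lam_def j powr_realpow[symmetric] powr_powr powr_power mult_ac)
        also have "\<dots> \<le> C * (real t + 1) powr r"
          using tj r0 lam[of k0] by (intro mult_mono powr_mono2) (auto simp: C_def)
        finally show ?thesis .
      qed
      then show "\<bar>\<Sum>s<t. c s x * D s x\<bar> \<le> C * (real t + 1) powr r" by (simp add: S_def)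
    qed
  qed
qed

end

context prob_space
begin

text \<open>By Markov for the moment of order \<open>\<kappa>\<close>, the probability of exceeding
  the bound at time \<open>s\<close> is at most \<open>V / (s + 1) powr (p * \<kappa>)\<close>,
  which is summable for \<open>p * \<kappa> > 1\<close>.\<close>

lemma AE_eventually_powr_bound:
  fixes Y :: "nat \<Rightarrow> 'a \<Rightarrow> real"
  assumes int: "\<And>s. integrable M (\<lambda>x. \<bar>Y s x\<bar> powr \<kappa>)"
    and mom: "\<And>s. expectation (\<lambda>x. \<bar>Y s x\<bar> powr \<kappa>) \<le> V"
    and \<kappa>: "0 < \<kappa>" "1 < p * \<kappa>"
  shows "AE x in M. \<forall>\<^sub>F s in sequentially. \<bar>Y s x\<bar> \<le> (real s + 1) powr p"
proof -
  define X where "X s x = \<bar>Y s x\<bar> powr \<kappa> / (real s + 1) powr (p * \<kappa>)" for s x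
  have "AE x in M. \<forall>\<^sub>F s in sequentially. X s x < 1"
  proof (rule AE_eventually_less_1)
    show "integrable M (X s)" for s unfolding X_def using int[of s] by simp
    show "0 \<le> X s x" for s x by (simp add: X_def)
    have sm: "summable (\<lambda>s. V * (real (Suc s) powr (- (p * \<kappa>))))"
      using \<kappa> by (intro summable_mult) (subst summable_Suc_iff[of "\<lambda>s. real s powr (- (p * \<kappa>))"], simp add: summable_real_powr_iff)
    have "norm (expectation (X s)) \<le> V * (real (Suc s) powr (- (p * \<kappa>)))" for s
    proof -
      have "0 \<le> expectation (X s)" by (rule integral_nonneg_AE) (simp add: X_def)
      moreover have "expectation (X s) \<le> V / (real s + 1) powr (p * \<kappa>)"
        unfolding X_def using mom[of s] by (simp add: divide_right_mono)
      ultimately show ?thesis by (simp add: powr_minus_divide add.commute)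
    qed
    then show "summable (\<lambda>s. expectation (X s))"
      by (rule summable_comparison_test'[OF sm])
  qed
  then show ?thesis
  proof (rule AE_mp, intro AE_I2 impI)
    fix x assume "\<forall>\<^sub>F s in sequentially. X s x < 1"
    then show "\<forall>\<^sub>F s in sequentially. \<bar>Y s x\<bar> \<le> (real s + 1) powr p"
    proof eventually_elim
      case (elim s)
      then have "\<bar>Y s x\<bar> powr \<kappa> < ((real s + 1) powr p) powr \<kappa>"
        unfolding X_def by (simp add: powr_powr divide_less_eq)
      then show ?case using \<kappa>(1) powr_mono2[of \<kappa> "(real s + 1) powr p" "\<bar>Y s x\<bar>"] by fastforce
    qed
  qed
qed

text \<open>A strong law with a moment of order \<open>1 + \<delta>\<close> only, as available for
  products of two noise entries. Truncation at level \<open>s + 1\<close> yields second moments of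
  order \<open>s powr (1 - \<delta>)\<close>. The average splits into the truncation error, which is
  eventually zero termwise, the centred truncated sum, and the bias of the truncated means.\<close>

lemma AE_average_tendsto_mean:
  fixes F :: "nat \<Rightarrow> 'a measure" and Y :: "nat \<Rightarrow> 'a \<Rightarrow> real"
  assumes sub: "\<And>t. subalgebra M (F t)" and mono: "\<And>s t. s \<le> t \<Longrightarrow> sets (F s) \<subseteq> sets (F t)"
    and Y_meas: "\<And>s. Y s \<in> borel_measurable (F (Suc s))"
    and ind: "\<And>s U. U \<in> borel_measurable (F s) \<Longrightarrow> indep_var borel (Y s) borel U"
    and int: "\<And>s. integrable M (\<lambda>x. \<bar>Y s x\<bar> powr (1 + \<delta>))"
    and mom: "\<And>s. expectation (\<lambda>x. \<bar>Y s x\<bar> powr (1 + \<delta>)) \<le> V"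
    and Y_int: "\<And>s. integrable M (Y s)" and mean: "\<And>s. expectation (Y s) = \<mu>"
    and \<delta>: "0 < \<delta>" "\<delta> \<le> 1"
  shows "AE x in M. (\<lambda>t. (\<Sum>s<t. Y s x) / real t) \<longlonglongrightarrow> \<mu>"
proof -
  define tr where "tr s y = (if \<bar>y\<bar> \<le> real s + 1 then y else 0)" for s :: nat and y :: real
  have tr_meas[measurable]: "tr s \<in> borel_measurable borel" for s
    unfolding tr_def by measurable
  define Z where "Z s x = tr s (Y s x)" for s x
  have YM[measurable]: "Y s \<in> borel_measurable M" for s by (rule measurable_from_subalg[OF sub Y_meas])
  have ZM[measurable]: "Z s \<in> borel_measurable M" for s unfolding Z_def by measurable
  define D where "D s x = Z s x - expectation (Z s)" for s x
  have Zb: "\<bar>Z s x\<bar> \<le> real s + 1" for s x by (simp add: Z_def tr_def)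
  have Zint: "integrable M (Z s)" for s
    by (rule integrable_const_bound[where B = "real s + 1"]) (auto simp: Zb)
  have Zsq: "integrable M (\<lambda>x. (Z s x)\<^sup>2)" for s
    by (rule integrable_const_bound[where B = "(real s + 1)\<^sup>2"]) 
       (use Zb power_mono[OF Zb abs_ge_zero, of _ _ 2] in auto)
  have V: "0 \<le> V"
    by (rule order_trans[OF _ mom[of 0]], rule integral_nonneg_AE) auto
  have EZ2: "expectation (\<lambda>x. (Z s x)\<^sup>2) \<le> V * (real s + 1) powr (1 - \<delta>)" for s
  proof -
    have "(Z s x)\<^sup>2 \<le> (real s + 1) powr (1 - \<delta>) * \<bar>Y s x\<bar> powr (1 + \<delta>)" for x
    proof (cases "\<bar>Y s x\<bar> \<le> real s + 1")
      case True
      have "(Z s x)\<^sup>2 = \<bar>Y s x\<bar> powr (1 - \<delta>) * \<bar>Y s x\<bar> powr (1 + \<delta>)"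
        using True by (cases "Y s x = 0") (auto simp: Z_def tr_def powr_add[symmetric])
      also have "\<dots> \<le> (real s + 1) powr (1 - \<delta>) * \<bar>Y s x\<bar> powr (1 + \<delta>)"
        using True \<delta> by (intro mult_right_mono powr_mono2) auto
      finally show ?thesis .
    qed (simp add: Z_def tr_def)
    then have "expectation (\<lambda>x. (Z s x)\<^sup>2) \<le> expectation (\<lambda>x. (real s + 1) powr (1 - \<delta>) * \<bar>Y s x\<bar> powr (1 + \<delta>))"
      using int[of s] Zsq[of s] by (intro integral_mono) auto
    also have "\<dots> \<le> (real s + 1) powr (1 - \<delta>) * V"
      using mom[of s] by (simp add: mult_left_mono)
    finally show ?thesis by (simp add: mult.commute)
  qed
  have Dsq: "integrable M (\<lambda>x. (D s x)\<^sup>2)" for s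
    unfolding D_def power2_diff using Zsq[of s] Zint[of s] by simp
  have Dmean: "expectation (D s) = 0" for s
    unfolding D_def using Zint[of s] by (simp add: prob_space)
  have Dvar: "expectation (\<lambda>x. (D s x)\<^sup>2) \<le> V * (real s + 1) powr (1 - \<delta>)" for s
  proof -
    have "expectation (\<lambda>x. (D s x)\<^sup>2) = expectation (\<lambda>x. (Z s x)\<^sup>2) - (expectation (Z s))\<^sup>2"
      unfolding D_def by (rule variance_eq[OF Zint Zsq])
    also have "\<dots> \<le> expectation (\<lambda>x. (Z s x)\<^sup>2)" by simp
    finally show ?thesis using EZ2[of s] by linarith
  qed
  have Dmeas: "D s \<in> borel_measurable (F (Suc s))" for s
    unfolding D_def Z_def by (intro borel_measurable_diff measurable_compose[OF Y_meas tr_meas] borel_measurable_const)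
  have Dind: "indep_var borel (D s) borel U" if "U \<in> borel_measurable (F s)" for s U
  proof -
    have "indep_var borel ((\<lambda>y. tr s y - expectation (Z s)) \<circ> Y s) borel ((\<lambda>u. u) \<circ> U)"
      by (rule indep_var_compose[OF ind[OF that]]) simp_all
    moreover have "(\<lambda>y. tr s y - expectation (Z s)) \<circ> Y s = D s"
      unfolding D_def by (simp only: fun_eq_iff comp_apply Z_def simp_thms)
    moreover have "(\<lambda>u. u) \<circ> U = U" by (simp only: fun_eq_iff comp_apply simp_thms)
    ultimately show ?thesis by (simp only:)
  qed
  \<comment> \<open>The exponent has to exceed
    \<open>((1 - \<delta>) + 1) / 2 = 1 - \<delta> / 2\<close> and stay below 1;
    \<open>1 - \<delta> / 4\<close> does both.\<close>
  have "AE x in M. \<exists>C\<ge>0. \<forall>t. \<bar>\<Sum>s<t. 1 * D s x\<bar> \<le> C * (real t + 1) powr (1 - \<delta> / 4)"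
    by (rule AE_predictable_sum_bound[where F = F and q = "1 - \<delta>" and V = V and B = 1])
       (use sub mono Dmeas Dind Dsq Dmean Dvar \<delta> in auto)
  moreover have "AE x in M. \<forall>\<^sub>F s in sequentially. \<bar>Y s x\<bar> \<le> (real s + 1) powr 1"
    by (rule AE_eventually_powr_bound[where \<kappa> = "1 + \<delta>", OF int mom]) (use \<delta> in auto)
  ultimately show ?thesis
  proof (rule AE_mp[OF AE_conjI], intro AE_I2 impI)
    fix x
    assume "(\<exists>C\<ge>0. \<forall>t. \<bar>\<Sum>s<t. 1 * D s x\<bar> \<le> C * (real t + 1) powr (1 - \<delta> / 4)) \<and>
        (\<forall>\<^sub>F s in sequentially. \<bar>Y s x\<bar> \<le> (real s + 1) powr 1)"
    then obtain C where C: "\<And>t. \<bar>\<Sum>s<t. D s x\<bar> \<le> C * (real t + 1) powr (1 - \<delta> / 4)"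
      and ev: "\<forall>\<^sub>F s in sequentially. \<bar>Y s x\<bar> \<le> real s + 1" by auto
    have "\<forall>\<^sub>F s in sequentially. Y s x - Z s x = 0"
      using ev by eventually_elim (simp add: Z_def tr_def)
    then have l1: "(\<lambda>t. (\<Sum>s<t. Y s x - Z s x) / real t) \<longlonglongrightarrow> 0"
      by (intro cesaro_mean_tendsto_0 tendsto_eventually)
    have "(\<lambda>t::nat. C * ((real t + 1) powr (1 - \<delta> / 4) / real t)) \<longlonglongrightarrow> 0"
      using \<delta> by (intro tendsto_mult_right_zero) real_asymp
    then have l2: "(\<lambda>t. (\<Sum>s<t. D s x) / real t) \<longlonglongrightarrow> 0"
    proof (rule Lim_null_comparison[rotated], intro always_eventually allI)
      fix t
      show "norm ((\<Sum>s<t. D s x) / real t) \<le> C * ((real t + 1) powr (1 - \<delta> / 4) / real t)"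
        using divide_right_mono[OF C[of t], of "real t"] by simp
    qed
    have "(\<lambda>s. expectation (Z s) - \<mu>) \<longlonglongrightarrow> 0"
    proof (rule Lim_null_comparison)
      show "(\<lambda>s. V * (real s + 1) powr (- \<delta>)) \<longlonglongrightarrow> 0"
        using \<delta> by (intro tendsto_mult_right_zero) real_asymp
      show "\<forall>\<^sub>F s in sequentially. norm (expectation (Z s) - \<mu>) \<le> V * (real s + 1) powr (- \<delta>)"
      proof (intro always_eventually allI)
        fix s
        have pt: "\<bar>Z s x - Y s x\<bar> \<le> (real s + 1) powr (- \<delta>) * \<bar>Y s x\<bar> powr (1 + \<delta>)" for x
        proof (cases "\<bar>Y s x\<bar> \<le> real s + 1")
          case False
          have "\<bar>Y s x\<bar> * (real s + 1) powr \<delta> \<le> \<bar>Y s x\<bar> * \<bar>Y s x\<bar> powr \<delta>"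
            using False \<delta> by (intro mult_left_mono powr_mono2) auto
          also have "\<dots> = \<bar>Y s x\<bar> powr (1 + \<delta>)" using False by (simp add: powr_add)
          finally show ?thesis using False by (simp add: Z_def tr_def powr_minus_divide field_simps)
        qed (simp add: Z_def tr_def)
        have "norm (expectation (Z s) - \<mu>) = norm (expectation (\<lambda>x. Z s x - Y s x))"
          using mean[of s] Zint[of s] Y_int[of s] by simp
        also have "\<dots> \<le> expectation (\<lambda>x. \<bar>Z s x - Y s x\<bar>)"
          using integral_norm_bound[of M "\<lambda>x. Z s x - Y s x"] by simp
        also have "\<dots> \<le> expectation (\<lambda>x. (real s + 1) powr (- \<delta>) * \<bar>Y s x\<bar> powr (1 + \<delta>))"
          using pt int[of s] Zint[of s] Y_int[of s] by (intro integral_mono) auto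
        also have "\<dots> \<le> (real s + 1) powr (- \<delta>) * V"
          using mom[of s] by (simp add: mult_left_mono)
        finally show "norm (expectation (Z s) - \<mu>) \<le> V * (real s + 1) powr (- \<delta>)"
          by (simp add: mult.commute)
      qed
    qed
    then have l3: "(\<lambda>t. (\<Sum>s<t. expectation (Z s) - \<mu>) / real t) \<longlonglongrightarrow> 0"
      by (rule cesaro_mean_tendsto_0)
    have "(\<lambda>t. ((\<Sum>s<t. Y s x - Z s x) / real t + (\<Sum>s<t. D s x) / real t
        + (\<Sum>s<t. expectation (Z s) - \<mu>) / real t) + \<mu>) \<longlonglongrightarrow> 0 + 0 + 0 + \<mu>"
      by (intro tendsto_add l1 l2 l3 tendsto_const)
    then have "(\<lambda>t. ((\<Sum>s<t. Y s x - Z s x) / real t + (\<Sum>s<t. D s x) / real t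
        + (\<Sum>s<t. expectation (Z s) - \<mu>) / real t) + \<mu>) \<longlonglongrightarrow> \<mu>" by simp
    moreover have "\<forall>\<^sub>F t in sequentially. ((\<Sum>s<t. Y s x - Z s x) / real t + (\<Sum>s<t. D s x) / real t
        + (\<Sum>s<t. expectation (Z s) - \<mu>) / real t) + \<mu> = (\<Sum>s<t. Y s x) / real t"
      using eventually_gt_at_top[of 0]
      by eventually_elim (simp add: D_def sum_subtractf field_simps)
    ultimately show "(\<lambda>t. (\<Sum>s<t. Y s x) / real t) \<longlonglongrightarrow> \<mu>"
      by (rule Lim_transform_eventually)
  qed
qed

end

text \<open>Expanding the square of \<open>u - c * g\<close>, the cross term gives
  \<open>- c * q\<close> with \<open>q\<close> the Dirichlet form. Cauchy-Schwarz and
  \<open>c * N \<le> 1 / 2\<close> bound the quadratic term by \<open>c / 2 * q\<close>, so half of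
  the dissipation survives.\<close>

lemma consensus_step_energy:
  assumes sym: "\<And>n l. n < N \<Longrightarrow> l < N \<Longrightarrow> w n l = w l n"
    and w: "\<And>n l. n < N \<Longrightarrow> l < N \<Longrightarrow> 0 \<le> w n l \<and> w n l \<le> 1"
    and c: "0 \<le> c" "c * real N \<le> 1 / 2"
  shows "(\<Sum>n<N. (consensus_step N c w u n)\<^sup>2) \<le> (\<Sum>n<N. (u n)\<^sup>2) - c / 2 * (\<Sum>n<N. \<Sum>l<N. w n l * (u n - u l)\<^sup>2)"
proof -
  define g where "g n = (\<Sum>l<N. w n l * (u n - u l))" for n
  define q where "q = (\<Sum>n<N. \<Sum>l<N. w n l * (u n - u l)\<^sup>2)"
  have "(\<Sum>n<N. u n * g n) = (\<Sum>n<N. \<Sum>l<N. w n l * (u n - u l) * u n)"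
    by (simp add: g_def sum_distrib_left mult_ac)
  moreover have "(\<Sum>n<N. \<Sum>l<N. w n l * (u n - u l) * u n) = (\<Sum>n<N. \<Sum>l<N. w n l * (u l - u n) * u l)"
    by (subst sum.swap, intro sum.cong refl) (use sym in auto)
  moreover have "(\<Sum>n<N. \<Sum>l<N. w n l * (u n - u l) * u n) + (\<Sum>n<N. \<Sum>l<N. w n l * (u l - u n) * u l) = q"
    unfolding q_def sum.distrib[symmetric] by (intro sum.cong refl) (simp add: power2_eq_square algebra_simps)
  \<comment> \<open>Averaging the sum with its copy under exchange of \<open>n\<close> and
    \<open>l\<close> turns the pairing of \<open>u\<close> with its Laplacian into half the
    Dirichlet form.\<close>
  ultimately have ug: "2 * (\<Sum>n<N. u n * g n) = q" by simp
  have gg: "(g n)\<^sup>2 \<le> N * (\<Sum>l<N. w n l * (u n - u l)\<^sup>2)" if "n < N" for n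
  proof -
    have "(g n)\<^sup>2 \<le> N * (\<Sum>l<N. (w n l * (u n - u l))\<^sup>2)"
      unfolding g_def using sum_squared_le_sum_of_squares[of "\<lambda>l. w n l * (u n - u l)" "{..<N}"] by (simp add: mult.commute)
    also have "\<dots> \<le> N * (\<Sum>l<N. w n l * (u n - u l)\<^sup>2)"
    proof (intro mult_left_mono sum_mono)
      fix l assume "l \<in> {..<N}"
      then have "w n l * w n l \<le> w n l" using w[OF that, of l] mult_left_le by auto
      then show "(w n l * (u n - u l))\<^sup>2 \<le> w n l * (u n - u l)\<^sup>2"
        unfolding power_mult_distrib by (intro mult_right_mono) (auto simp: power2_eq_square)
    qed simp
    finally show ?thesis .
  qed
  have "(\<Sum>n<N. (g n)\<^sup>2) \<le> N * q"
    unfolding q_def sum_distrib_left[of "real N"] using gg by (intro sum_mono) (simp add: sum_distrib_left)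
  then have "c * c * (\<Sum>n<N. (g n)\<^sup>2) \<le> c * c * (N * q)" using c by (intro mult_left_mono) auto
  also have "\<dots> = (c * N) * (c * q)" by simp
  also have "\<dots> \<le> 1 / 2 * (c * q)"
    using c w by (intro mult_right_mono mult_nonneg_nonneg) (auto simp: q_def intro!: sum_nonneg)
  finally have cg: "c * c * (\<Sum>n<N. (g n)\<^sup>2) \<le> c / 2 * q" by simp
  have "(\<Sum>n<N. (consensus_step N c w u n)\<^sup>2) = (\<Sum>n<N. (u n)\<^sup>2 - 2 * c * (u n * g n) + c * c * (g n)\<^sup>2)"
    by (intro sum.cong refl) (simp add: consensus_step_def g_def power2_eq_square algebra_simps)
  also have "\<dots> = (\<Sum>n<N. (u n)\<^sup>2) - c * q + c * c * (\<Sum>n<N. (g n)\<^sup>2)"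
    by (simp add: sum.distrib sum_subtractf sum_distrib_left[symmetric] ug[symmetric])
  finally show ?thesis using cg unfolding q_def by linarith
qed

section \<open>Decay of the random consensus kernel\<close>

context prob_space
begin

text \<open>\<open>S s k l\<close> is the squared distance of column \<open>l\<close> from the
  average. The weights of time \<open>s + k\<close> are independent of the column, which is built
  from earlier ones, so in expectation they may be replaced by \<open>wb\<close>; the gap inequality
  then turns the energy loss into a factor \<open>1 - c / 2 * \<beta> (s + k)\<close>. In a window
  of length \<open>t powr q\<close> ending at \<open>t\<close> every step is at least
  \<open>b / t powr \<tau>\<close>, which gives decay exponential in
  \<open>t powr (q - \<tau>)\<close>. This beats every power of \<open>t\<close>, including the
  number of start times.\<close>

lemma AE_consensus_kernel_decay:
  fixes F :: "nat \<Rightarrow> 'a measure" and w :: "nat \<Rightarrow> 'a \<Rightarrow> nat \<Rightarrow> nat \<Rightarrow> real"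
  assumes sub: "\<And>t. subalgebra M (F t)" and mono: "\<And>s t. s \<le> t \<Longrightarrow> sets (F s) \<subseteq> sets (F t)"
    and w_meas: "\<And>t n l. n < N \<Longrightarrow> l < N \<Longrightarrow> (\<lambda>x. w t x n l) \<in> borel_measurable (F (Suc t))"
    and ind: "\<And>t n l U. n < N \<Longrightarrow> l < N \<Longrightarrow> U \<in> borel_measurable (F t) \<Longrightarrow> indep_var borel (\<lambda>x. w t x n l) borel U"
    and sym: "\<And>t x n l. n < N \<Longrightarrow> l < N \<Longrightarrow> w t x n l = w t x l n"
    and w01: "\<And>t x n l. n < N \<Longrightarrow> l < N \<Longrightarrow> 0 \<le> w t x n l \<and> w t x n l \<le> 1"
    and mean: "\<And>t n l. n < N \<Longrightarrow> l < N \<Longrightarrow> expectation (\<lambda>x. w t x n l) = wb n l"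
    and c: "c > 0" "\<And>u. (\<Sum>n<N. u n) = 0 \<Longrightarrow> c * (\<Sum>n<N. (u n)\<^sup>2) \<le> (\<Sum>n<N. \<Sum>l<N. wb n l * (u n - u l)\<^sup>2)"
    and \<beta>: "\<And>t. \<beta> t = b / (real t + 1) powr \<tau>" and b: "b > 0" "\<tau> > 0" "\<tau> < q"
    and T: "\<And>t. t \<ge> T \<Longrightarrow> \<beta> t * real N \<le> 1 / 2" and N: "N > 0"
  shows "AE x in M. \<exists>T'. \<forall>s k n l. T \<le> s \<longrightarrow> n < N \<longrightarrow> l < N \<longrightarrow> T' \<le> s + k \<longrightarrow> real (s + k) powr q \<le> real k \<longrightarrow>
        \<bar>consensus_kernel N \<beta> (\<lambda>t. w t x) s k n l - 1 / N\<bar> \<le> 1 / (real (s + k))\<^sup>2"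
proof -
  have up: "f \<in> borel_measurable (F s) \<Longrightarrow> s \<le> t \<Longrightarrow> f \<in> borel_measurable (F t)" for f :: "'a \<Rightarrow> real" and s t
    by (rule filtration_measurable_mono[of F]) (use sub mono in auto)
  have \<beta>0: "\<beta> t \<ge> 0" for t using b by (simp add: \<beta>)
  define u where "u s k l x n = consensus_kernel N \<beta> (\<lambda>t. w t x) s k n l - 1 / N" for s k l x n
  define S where "S s k l x = (\<Sum>n<N. (u s k l x n)\<^sup>2)" for s k l x
  have u_step: "u s (Suc k) l x n = consensus_step N (\<beta> (s + k)) (w (s + k) x) (u s k l x) n" for s k l x n
    by (simp add: u_def consensus_step_def)
  have u_sum: "(\<Sum>n<N. u s k l x n) = 0" if "l < N" for s k l x
  proof -
    have "(\<Sum>n<N. consensus_kernel N \<beta> (\<lambda>t. w t x) s k n l) = 1"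
      by (rule sum_consensus_kernel) (use sym that in auto)
    then show ?thesis unfolding u_def sum_subtractf using N by simp
  qed
  have u_bd: "\<bar>u s k l x n\<bar> \<le> 1" if "s \<ge> T" "n < N" for s k l x n
    unfolding u_def using that w01 T \<beta>0 by (intro consensus_kernel_dist) auto
  have u_meas: "(\<lambda>x. u s k l x n) \<in> borel_measurable (F (s + k))" if "n < N" for s k l n
    using that
  proof (induction k arbitrary: n)
    case 0 then show ?case by (simp add: u_def)
  next
    case (Suc k)
    have "(\<lambda>x. u s k l x n) \<in> borel_measurable (F (Suc (s + k)))" if "n < N" for n
      using up[OF Suc.IH[OF that]] by simp
    then show ?case
      unfolding u_step consensus_step_def add_Suc_right using Suc.prems
      by (intro borel_measurable_diff borel_measurable_times borel_measurable_sum borel_measurable_const w_meas) auto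
  qed
  have u_measM: "(\<lambda>x. u s k l x n) \<in> borel_measurable M" if "n < N" for s k l n
    by (rule measurable_from_subalg[OF sub u_meas[OF that]])
  have S_bd: "0 \<le> S s k l x \<and> S s k l x \<le> N" if "s \<ge> T" for s k l x
  proof -
    have "(u s k l x n)\<^sup>2 \<le> 1" if "n < N" for n
      using u_bd[OF \<open>s \<ge> T\<close> that, of k l x] by (simp add: abs_square_le_1)
    then have "S s k l x \<le> (\<Sum>n<N. 1)" unfolding S_def by (intro sum_mono) auto
    then show ?thesis unfolding S_def by (auto intro: sum_nonneg)
  qed
  have S_meas: "S s k l \<in> borel_measurable M" for s k l
    unfolding S_def by (intro borel_measurable_sum borel_measurable_power u_measM) auto
  have S_int: "integrable M (S s k l)" if "s \<ge> T" for s k l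
    by (rule integrable_const_bound[where B = "real N"]) (use S_bd[OF that] S_meas in auto)
  have S_step: "expectation (S s (Suc k) l) \<le> (1 - c / 2 * \<beta> (s + k)) * expectation (S s k l)"
    if s: "s \<ge> T" and l: "l < N" for s k l
  proof -
    define d where "d n m x = (u s k l x n - u s k l x m)\<^sup>2" for n m x
    have dF: "d n m \<in> borel_measurable (F (s + k))" if "n < N" "m < N" for n m
      unfolding d_def using that by (intro borel_measurable_power borel_measurable_diff u_meas)
    have d_bd: "\<bar>d n m x\<bar> \<le> 4" if "n < N" "m < N" for n m x
    proof -
      have "\<bar>u s k l x n - u s k l x m\<bar> \<le> 2"
        using u_bd[OF s that(1), of k l x] u_bd[OF s that(2), of k l x] by linarith
      then have "\<bar>u s k l x n - u s k l x m\<bar>\<^sup>2 \<le> 2\<^sup>2" by (intro power_mono) auto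
      then show ?thesis by (simp add: d_def)
    qed
    have d_int: "integrable M (d n m)" if "n < N" "m < N" for n m
      by (rule integrable_const_bound[where B = 4]) (use d_bd that measurable_from_subalg[OF sub dF] in auto)
    have w_int: "integrable M (\<lambda>x. w (s + k) x n m)" if "n < N" "m < N" for n m
      by (rule integrable_const_bound[where B = 1]) (use w01 that measurable_from_subalg[OF sub w_meas] in auto)
    have iv: "indep_var borel (\<lambda>x. w (s + k) x n m) borel (d n m)" if "n < N" "m < N" for n m
      using that by (intro ind dF)
    have wd_int: "integrable M (\<lambda>x. w (s + k) x n m * d n m x)" if "n < N" "m < N" for n m
      by (rule indep_var_integrable[OF iv[OF that] w_int[OF that] d_int[OF that]])
    have wd: "expectation (\<lambda>x. w (s + k) x n m * d n m x) = expectation (\<lambda>x. wb n m * d n m x)"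
      if "n < N" "m < N" for n m
      using indep_var_lebesgue_integral[OF iv[OF that] w_int[OF that] d_int[OF that]] mean[OF that] by simp
    let ?W = "\<lambda>x. \<Sum>n<N. \<Sum>m<N. w (s + k) x n m * d n m x"
    let ?V = "\<lambda>x. \<Sum>n<N. \<Sum>m<N. wb n m * d n m x"
    have Wint: "integrable M ?W" by (intro Bochner_Integration.integrable_sum) (auto intro: wd_int)
    have Vint: "integrable M ?V"
      by (intro Bochner_Integration.integrable_sum integrable_mult_right) (auto intro: d_int)
    have "expectation ?W = (\<Sum>n<N. \<Sum>m<N. expectation (\<lambda>x. w (s + k) x n m * d n m x))"
      by (subst Bochner_Integration.integral_sum, intro Bochner_Integration.integrable_sum, use wd_int in blast)
         (intro sum.cong refl Bochner_Integration.integral_sum, use wd_int in blast)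
    also have "\<dots> = (\<Sum>n<N. \<Sum>m<N. expectation (\<lambda>x. wb n m * d n m x))"
      using wd by (intro sum.cong refl) auto
    also have "\<dots> = expectation ?V"
      by (subst Bochner_Integration.integral_sum, intro Bochner_Integration.integrable_sum integrable_mult_right, use d_int in blast)
         (intro sum.cong refl Bochner_Integration.integral_sum[symmetric] integrable_mult_right, use d_int in blast)
    finally have WV: "expectation ?W = expectation ?V" .
    have "c * S s k l x \<le> ?V x" for x
      using c(2)[OF u_sum[OF l]] unfolding S_def d_def by blast
    then have "expectation (\<lambda>x. c * S s k l x) \<le> expectation ?V"
      using S_int[OF s] Vint by (intro integral_mono integrable_mult_right) auto
    then have cV: "c * expectation (S s k l) \<le> expectation ?W" using WV by simp
    have "S s (Suc k) l x \<le> S s k l x - \<beta> (s + k) / 2 * ?W x" for x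
      unfolding S_def u_step d_def
      using consensus_step_energy[of N "w (s + k) x" "\<beta> (s + k)" "u s k l x"] sym w01 \<beta>0 T[of "s + k"] s by auto
    then have "expectation (S s (Suc k) l) \<le> expectation (\<lambda>x. S s k l x - \<beta> (s + k) / 2 * ?W x)"
      using S_int[OF s] Wint by (intro integral_mono Bochner_Integration.integrable_diff integrable_mult_right) auto
    also have "\<dots> = expectation (S s k l) - \<beta> (s + k) / 2 * expectation ?W"
      using S_int[OF s] Wint by (subst Bochner_Integration.integral_diff) (auto intro: integrable_mult_right)
    also have "\<dots> \<le> expectation (S s k l) - \<beta> (s + k) / 2 * (c * expectation (S s k l))"
      using cV \<beta>0[of "s + k"] by (intro diff_left_mono mult_left_mono) auto
    finally show ?thesis by (simp add: algebra_simps)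
  qed
  have S_exp: "expectation (S s k l) \<le> N * exp (- (c / 2) * (\<Sum>j<k. \<beta> (s + j)))" if s: "s \<ge> T" and l: "l < N" for s k l
  proof (induction k)
    case 0
    have "expectation (S s 0 l) \<le> expectation (\<lambda>x. real N)"
      using S_int[OF s] S_bd[OF s] by (intro integral_mono) auto
    then show ?case by (simp add: prob_space)
  next
    case (Suc k)
    have nn: "0 \<le> expectation (S s k l)" by (rule integral_nonneg_AE) (use S_bd[OF s] in auto)
    have "expectation (S s (Suc k) l) \<le> (1 - c / 2 * \<beta> (s + k)) * expectation (S s k l)"
      by (rule S_step[OF s l])
    also have "\<dots> \<le> exp (- (c / 2 * \<beta> (s + k))) * expectation (S s k l)"
      using exp_ge_add_one_self[of "- (c / 2 * \<beta> (s + k))"] nn by (intro mult_right_mono) auto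
    also have "\<dots> \<le> exp (- (c / 2 * \<beta> (s + k))) * (N * exp (- (c / 2) * (\<Sum>j<k. \<beta> (s + j))))"
      using Suc by (intro mult_left_mono) auto
    also have "\<dots> = N * exp (- (c / 2) * (\<Sum>j<Suc k. \<beta> (s + j)))"
      by (simp add: exp_add[symmetric] algebra_simps)
    finally show ?case .
  qed
  define \<kappa> where "\<kappa> = c / 2 * b"
  have \<kappa>: "\<kappa> > 0" using c b by (simp add: \<kappa>_def)
  have S_dec: "expectation (S s k l) \<le> N * exp (- \<kappa> * real (s + k) powr (q - \<tau>))"
    if s: "s \<ge> T" and l: "l < N" and k: "real (s + k) powr q \<le> real k" for s k l
  proof (cases "s + k = 0")
    case True
    then show ?thesis using S_exp[OF s l, of k] by simp
  next
    case False
    have "b / real (s + k) powr \<tau> \<le> \<beta> (s + j)" if "j < k" for j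
      unfolding \<beta> using b that False by (intro divide_left_mono powr_mono2 mult_pos_pos) auto
    then have "(\<Sum>j<k. b / real (s + k) powr \<tau>) \<le> (\<Sum>j<k. \<beta> (s + j))"
      by (intro sum_mono) auto
    moreover have "b * real (s + k) powr (q - \<tau>) \<le> (\<Sum>j<k. b / real (s + k) powr \<tau>)"
    proof -
      have "b * real (s + k) powr (q - \<tau>) = real (s + k) powr q * (b / real (s + k) powr \<tau>)"
        by (simp add: powr_diff)
      also have "\<dots> \<le> real k * (b / real (s + k) powr \<tau>)" using k b by (intro mult_right_mono) auto
      finally show ?thesis by simp
    qed
    ultimately have "b * real (s + k) powr (q - \<tau>) \<le> (\<Sum>j<k. \<beta> (s + j))" by linarith
    then have "c / 2 * (b * real (s + k) powr (q - \<tau>)) \<le> c / 2 * (\<Sum>j<k. \<beta> (s + j))"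
      using c by (intro mult_left_mono) auto
    then have "exp (- (c / 2) * (\<Sum>j<k. \<beta> (s + j))) \<le> exp (- \<kappa> * real (s + k) powr (q - \<tau>))"
      by (simp add: \<kappa>_def)
    then have "N * exp (- (c / 2) * (\<Sum>j<k. \<beta> (s + j))) \<le> N * exp (- \<kappa> * real (s + k) powr (q - \<tau>))"
      by (intro mult_left_mono) auto
    then show ?thesis using S_exp[OF s l, of k] by linarith
  qed
  \<comment> \<open>The start times whose window ending at \<open>t\<close> is long enough; one
    event per \<open>t\<close> treats them all, since the claim is uniform in the start
    time.\<close>
  define A where "A t = {s. T \<le> s \<and> s \<le> t \<and> real t powr q \<le> real (t - s)}" for t
  have A_fin: "finite (A t)" for t by (rule finite_subset[of _ "{..t}"]) (auto simp: A_def)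
  have A_card: "card (A t) \<le> t + 1" for t
    using card_mono[of "{..t}" "A t"] by (auto simp: A_def)
  \<comment> \<open>\<open>t ^ 4\<close> is the square of the target \<open>t\<^sup>2\<close>, so
    \<open>X t x < 1\<close> pushes every deviation in the sum below
    \<open>1 / t\<^sup>2\<close>.\<close>
  define X where "X t x = real t ^ 4 * (\<Sum>s\<in>A t. \<Sum>l<N. S s (t - s) l x)" for t x
  have iS: "integrable M (\<lambda>x. \<Sum>s\<in>A t. \<Sum>l<N. S s (t - s) l x)" for t
    by (intro Bochner_Integration.integrable_sum S_int) (auto simp: A_def)
  let ?E = "\<lambda>t. real t ^ 4 * ((real t + 1) * (N * (N * exp (- \<kappa> * real t powr (q - \<tau>)))))"
  have "AE x in M. \<forall>\<^sub>F t in sequentially. X t x < 1"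
  proof (rule AE_eventually_less_1)
    show "integrable M (X t)" for t
      unfolding X_def using iS by (intro integrable_mult_right)
    show nn: "0 \<le> X t x" for t x
      unfolding X_def using S_bd by (intro mult_nonneg_nonneg sum_nonneg) (auto simp: A_def)
    have EX: "expectation (X t) \<le> ?E t" for t
    proof -
      have "expectation (X t) = real t ^ 4 * (\<Sum>s\<in>A t. \<Sum>l<N. expectation (S s (t - s) l))"
      proof -
        have "expectation (\<lambda>x. \<Sum>s\<in>A t. \<Sum>l<N. S s (t - s) l x) = (\<Sum>s\<in>A t. expectation (\<lambda>x. \<Sum>l<N. S s (t - s) l x))"
          by (intro Bochner_Integration.integral_sum Bochner_Integration.integrable_sum S_int) (auto simp: A_def)
        also have "\<dots> = (\<Sum>s\<in>A t. \<Sum>l<N. expectation (S s (t - s) l))"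
          by (intro sum.cong refl Bochner_Integration.integral_sum S_int) (auto simp: A_def)
        finally show ?thesis unfolding X_def by simp
      qed
      also have "\<dots> \<le> real t ^ 4 * (\<Sum>s\<in>A t. \<Sum>l<N. N * exp (- \<kappa> * real t powr (q - \<tau>)))"
      proof (intro mult_left_mono sum_mono)
        fix s l assume "s \<in> A t" "l \<in> {..<N}"
        then show "expectation (S s (t - s) l) \<le> N * exp (- \<kappa> * real t powr (q - \<tau>))"
          using S_dec[of s l "t - s"] by (auto simp: A_def)
      qed simp
      also have "\<dots> = real t ^ 4 * (real (card (A t)) * (N * (N * exp (- \<kappa> * real t powr (q - \<tau>)))))"
        by simp
      also have "\<dots> \<le> ?E t"
        using A_card[of t] by (intro mult_left_mono mult_right_mono) auto
      finally show ?thesis .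
    qed
    have "(\<lambda>t::nat. real t ^ 4 * ((real t + 1) * exp (- \<kappa> * real t powr (q - \<tau>)))) \<in> O(\<lambda>t. 1 / real t ^ 2)"
      using \<kappa> b(3) by real_asymp
    then have "summable (\<lambda>t::nat. real t ^ 4 * ((real t + 1) * exp (- \<kappa> * real t powr (q - \<tau>))))"
      by (rule summable_comparison_test_bigo[rotated])
         (use inverse_power_summable[of 2, where ?'a = real] in \<open>simp add: inverse_eq_divide norm_power\<close>)
    from summable_mult[OF this, of "real N * real N"]
    have sm: "summable (\<lambda>t::nat. ?E t)"
      by (simp add: mult_ac)
    have "norm (expectation (X t)) \<le> ?E t" for t
    proof -
      have "0 \<le> expectation (X t)" by (rule integral_nonneg_AE) (use nn in auto)
      then show ?thesis using EX[of t] by (simp only: real_norm_def abs_of_nonneg)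
    qed
    then show "summable (\<lambda>t. expectation (X t))"
      by (rule summable_comparison_test'[OF sm])
  qed
  then show ?thesis
  proof (rule AE_mp, intro AE_I2 impI)
    fix x assume "\<forall>\<^sub>F t in sequentially. X t x < 1"
    then obtain T' where T': "\<And>t. t \<ge> T' \<Longrightarrow> X t x < 1" unfolding eventually_sequentially by blast
    show "\<exists>T'. \<forall>s k n l. T \<le> s \<longrightarrow> n < N \<longrightarrow> l < N \<longrightarrow> T' \<le> s + k \<longrightarrow> real (s + k) powr q \<le> real k \<longrightarrow>
        \<bar>consensus_kernel N \<beta> (\<lambda>t. w t x) s k n l - 1 / N\<bar> \<le> 1 / (real (s + k))\<^sup>2"
    proof (intro exI[of _ "T' + 1"] allI impI)
      fix s k n l assume s: "T \<le> s" and n: "n < N" and l: "l < N" and t: "T' + 1 \<le> s + k"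
        and k: "real (s + k) powr q \<le> real k"
      define t where "t = s + k"
      have sA: "s \<in> A t" and kt: "k = t - s" using s k by (auto simp: A_def t_def)
      have t0: "t > 0" "t \<ge> T'" using t by (auto simp: t_def)
      have "(u s k l x n)\<^sup>2 \<le> S s k l x"
        unfolding S_def using n by (intro member_le_sum[of n _ "\<lambda>n. (u s k l x n)\<^sup>2"]) auto
      also have "\<dots> \<le> (\<Sum>l<N. S s k l x)"
        using l S_bd[OF s] by (intro member_le_sum[of l _ "\<lambda>l. S s k l x"]) auto
      also have "\<dots> \<le> (\<Sum>s\<in>A t. \<Sum>l<N. S s (t - s) l x)"
        unfolding kt using sA A_fin S_bd
        by (intro member_le_sum[of s _ "\<lambda>s. \<Sum>l<N. S s (t - s) l x"] sum_nonneg) (auto simp: A_def)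
      finally have "real t ^ 4 * (u s k l x n)\<^sup>2 \<le> X t x"
        unfolding X_def by (intro mult_left_mono) auto
      then have "(real t ^ 2 * \<bar>u s k l x n\<bar>)\<^sup>2 \<le> 1\<^sup>2"
        using T'[OF t0(2)] by (simp add: power_mult_distrib)
      then have "real t ^ 2 * \<bar>u s k l x n\<bar> \<le> 1" by (rule power2_le_imp_le) simp
      then have "\<bar>u s k l x n\<bar> \<le> 1 / (real t)\<^sup>2" using t0 by (simp add: field_simps)
      then show "\<bar>consensus_kernel N \<beta> (\<lambda>t. w t x) s k n l - 1 / N\<bar> \<le> 1 / (real (s + k))\<^sup>2"
        by (simp add: u_def t_def)
    qed
  qed
qed

end

section \<open>Noise processes\<close>

text \<open>\<open>gen_sets\<close> is only a family of sets; this is the measure carrying the same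
  sigma-algebra, so that measurability with respect to it can be expressed.\<close>

abbreviation gen_algebra :: "'a measure \<Rightarrow> ('i \<Rightarrow> 'a \<Rightarrow> real) \<Rightarrow> 'i set \<Rightarrow> 'a measure" where
  "gen_algebra M Z I \<equiv> sigma (space M) {Z i -` B \<inter> space M | i B. i \<in> I \<and> B \<in> sets borel}"

lemma borel_measurable_gen_algebra:
  assumes "i \<in> I" shows "Z i \<in> borel_measurable (gen_algebra M Z I)"
proof (rule measurableI)
  fix B :: "real set" assume "B \<in> sets borel"
  then show "Z i -` B \<inter> space (gen_algebra M Z I) \<in> sets (gen_algebra M Z I)"
    using assms by (auto simp: space_measure_of_conv sets_measure_of_conv intro!: sigma_sets.Basic)
qed simp

context prob_space
begin

lemma indep_varI_gen_sets:
  assumes "indep_set (gen_sets M Z I) (sets G)" "subalgebra M G" "U \<in> borel_measurable G"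
    and "X \<in> borel_measurable M" "X \<in> borel_measurable (gen_algebra M Z I)"
  shows "indep_var borel (X :: 'a \<Rightarrow> real) borel (U :: 'a \<Rightarrow> real)"
  using assms(1,2,3,4)
proof (rule indep_varI_indep_set)
  fix B :: "real set" assume "B \<in> sets borel"
  from measurable_sets[OF assms(5) this] show "X -` B \<inter> space M \<in> gen_sets M Z I"
    by (simp add: gen_sets_def space_measure_of_conv)
qed

lemma joint_law_expectation:
  assumes "joint_law M Z I = joint_law M Z' I"
    and "\<And>i. i \<in> I \<Longrightarrow> Z i \<in> borel_measurable M" "\<And>i. i \<in> I \<Longrightarrow> Z' i \<in> borel_measurable M"
    and "f \<in> borel_measurable (Pi\<^sub>M I (\<lambda>_. borel))"
  shows "expectation (\<lambda>x. f (restrict (\<lambda>i. Z i x) I) :: real) = expectation (\<lambda>x. f (restrict (\<lambda>i. Z' i x) I))"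
proof -
  have m: "(\<lambda>x. restrict (\<lambda>i. Z i x) I) \<in> measurable M (Pi\<^sub>M I (\<lambda>_. borel))"
    "(\<lambda>x. restrict (\<lambda>i. Z' i x) I) \<in> measurable M (Pi\<^sub>M I (\<lambda>_. borel))"
    using assms(2,3) by (auto intro: measurable_restrict)
  show ?thesis
    using integral_distr[OF m(1) assms(4)] integral_distr[OF m(2) assms(4)] assms(1)
    unfolding joint_law_def by simp
qed

context
  fixes F :: "nat \<Rightarrow> 'a measure" and Z :: "nat \<Rightarrow> nat \<Rightarrow> 'a \<Rightarrow> real" and d :: nat and \<epsilon> :: real
  assumes sub: "\<And>t. subalgebra M (F t)" and mono: "\<And>s t. s \<le> t \<Longrightarrow> sets (F s) \<subseteq> sets (F t)"
    and Z_meas: "\<And>t i. i < d \<Longrightarrow> Z t i \<in> borel_measurable (F (Suc t))"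
    and Z_indep: "\<And>t. indep_set (gen_sets M (Z t) {..<d}) (sets (F t))"
    and Z_ident: "\<And>t. joint_law M (Z t) {..<d} = joint_law M (Z 0) {..<d}"
    and Z_mean: "\<And>t i. i < d \<Longrightarrow> expectation (Z t i) = 0"
    and Z_sq: "\<And>t i. i < d \<Longrightarrow> integrable M (\<lambda>x. (Z t i x)\<^sup>2)"
    and \<epsilon>: "\<epsilon> > 0"
    and Z_mom: "\<And>t i. i < d \<Longrightarrow> integrable M (\<lambda>x. \<bar>Z t i x\<bar> powr (2 + \<epsilon>))"
begin

lemma noise_measurable: "i < d \<Longrightarrow> Z t i \<in> borel_measurable M"
  by (rule measurable_from_subalg[OF sub Z_meas])

lemma noise_indep:
  fixes X U :: "'a \<Rightarrow> real"
  assumes "U \<in> borel_measurable (F t)" "X \<in> borel_measurable M" "X \<in> borel_measurable (gen_algebra M (Z t) {..<d})"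
  shows "indep_var borel X borel U"
  using assms by (intro indep_varI_gen_sets[OF Z_indep[of t] sub])

text \<open>Functions of two coordinates cover every moment that occurs: variances, absolute moments
  and mixed products all become independent of time.\<close>

lemma noise_expectation:
  assumes "i < d" "j < d" and [measurable]: "(\<lambda>(a,b). g a b) \<in> borel_measurable (borel \<Otimes>\<^sub>M borel)"
  shows "expectation (\<lambda>x. g (Z t i x) (Z t j x) :: real) = expectation (\<lambda>x. g (Z 0 i x) (Z 0 j x))"
proof -
  have "(\<lambda>v. (\<lambda>(a,b). g a b) (v i, v j)) \<in> borel_measurable (Pi\<^sub>M {..<d} (\<lambda>_. borel))"
    using assms(1,2) by (intro measurable_compose[OF _ assms(3)] measurable_Pair measurable_component_singleton) auto
  then have "(\<lambda>v. g (v i) (v j)) \<in> borel_measurable (Pi\<^sub>M {..<d} (\<lambda>_. borel))" by simp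
  from joint_law_expectation[OF Z_ident noise_measurable noise_measurable this, of t]
  show ?thesis using assms(1,2) by simp
qed

lemma AE_noise_predictable_sum:
  assumes i: "i < d" and c: "\<And>s. c s \<in> borel_measurable (F s)" "\<And>s x. x \<in> space M \<Longrightarrow> \<bar>c s x\<bar> \<le> B" and r: "1 / 2 < r"
  shows "AE x in M. \<exists>C\<ge>0. \<forall>t. \<bar>\<Sum>s<t. c s x * Z s i x\<bar> \<le> C * (real t + 1) powr r"
proof (rule AE_predictable_sum_bound[of F, where q = 0 and B = B and V = "expectation (\<lambda>x. (Z 0 i x)\<^sup>2)"])
  show "indep_var borel (Z s i) borel U" if "U \<in> borel_measurable (F s)" for s U
    using i by (intro noise_indep[OF that] noise_measurable borel_measurable_gen_algebra[of i, where Z = "Z s"]) auto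
  show "expectation (\<lambda>x. (Z s i x)\<^sup>2) \<le> expectation (\<lambda>x. (Z 0 i x)\<^sup>2) * (real s + 1) powr 0" for s
    using noise_expectation[OF i i, of "\<lambda>a b. a\<^sup>2" s] by simp
qed (use sub mono Z_meas Z_sq Z_mean i c r in auto)

lemma AE_noise_average:
  assumes i: "i < d"
  shows "AE x in M. (\<lambda>t. (\<Sum>s<t. Z s i x) / real t) \<longlonglongrightarrow> 0"
proof -
  have "AE x in M. \<exists>C\<ge>0. \<forall>t. \<bar>\<Sum>s<t. 1 * Z s i x\<bar> \<le> C * (real t + 1) powr (3/4)"
    by (rule AE_noise_predictable_sum[OF i, where B = 1]) auto
  then show ?thesis
  proof (rule AE_mp, intro AE_I2 impI)
    fix x assume "\<exists>C\<ge>0. \<forall>t. \<bar>\<Sum>s<t. 1 * Z s i x\<bar> \<le> C * (real t + 1) powr (3/4)"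
    then obtain C where C: "\<And>t. \<bar>\<Sum>s<t. Z s i x\<bar> \<le> C * (real t + 1) powr (3/4)" by auto
    have "(\<lambda>t::nat. C * ((real t + 1) powr (3/4) / real t)) \<longlonglongrightarrow> 0"
      by (intro tendsto_mult_right_zero) real_asymp
    then show "(\<lambda>t. (\<Sum>s<t. Z s i x) / real t) \<longlonglongrightarrow> 0"
    proof (rule Lim_null_comparison[rotated], intro always_eventually allI)
      fix t
      show "norm ((\<Sum>s<t. Z s i x) / real t) \<le> C * ((real t + 1) powr (3/4) / real t)"
        using divide_right_mono[OF C[of t], of "real t"] by simp
    qed
  qed
qed

lemma AE_noise_growth:
  assumes i: "i < d" and p: "1 < p * (2 + \<epsilon>)"
  shows "AE x in M. \<forall>\<^sub>F s in sequentially. \<bar>Z s i x\<bar> \<le> (real s + 1) powr p"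
proof (rule AE_eventually_powr_bound[where \<kappa> = "2 + \<epsilon>" and V = "expectation (\<lambda>x. \<bar>Z 0 i x\<bar> powr (2 + \<epsilon>))"])
  show "expectation (\<lambda>x. \<bar>Z s i x\<bar> powr (2 + \<epsilon>)) \<le> expectation (\<lambda>x. \<bar>Z 0 i x\<bar> powr (2 + \<epsilon>))" for s
    using noise_expectation[OF i i, of "\<lambda>a b. \<bar>a\<bar> powr (2 + \<epsilon>)" s] by simp
qed (use Z_mom i \<epsilon> p in auto)

text \<open>Two factors with moments of order \<open>2 + \<epsilon>\<close> have a product with a
  moment of order \<open>1 + \<epsilon> / 2\<close>, enough for the strong law by truncation. The
  minimum in \<open>\<delta>\<close> respects the range \<open>\<delta> \<le> 1\<close> of that
  law.\<close>

lemma AE_noise_product_average: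
  assumes ij: "i < d" "j < d"
  shows "AE x in M. (\<lambda>t. (\<Sum>s<t. Z s i x * Z s j x) / real t) \<longlonglongrightarrow> expectation (\<lambda>x. Z 0 i x * Z 0 j x)"
proof -
  define \<delta> where "\<delta> = min 1 (\<epsilon> / 2)"
  have \<delta>: "0 < \<delta>" "\<delta> \<le> 1" "2 * (1 + \<delta>) \<le> 2 + \<epsilon>" using \<epsilon> by (auto simp: \<delta>_def min_def)
  have [measurable]: "Z s i \<in> borel_measurable M" "Z s j \<in> borel_measurable M" for s
    using ij by (auto intro: noise_measurable)
  have pt: "\<bar>a * b\<bar> powr (1 + \<delta>) \<le> 1 + \<bar>a\<bar> powr (2 + \<epsilon>) + \<bar>b\<bar> powr (2 + \<epsilon>)" for a b :: real
  proof -
    define m where "m = max \<bar>a\<bar> \<bar>b\<bar>"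
    have m: "\<bar>a\<bar> \<le> m" "\<bar>b\<bar> \<le> m" "0 \<le> m" by (auto simp: m_def)
    have "\<bar>a * b\<bar> \<le> m * m" unfolding abs_mult using m by (intro mult_mono) auto
    then have "\<bar>a * b\<bar> powr (1 + \<delta>) \<le> (m * m) powr (1 + \<delta>)" using \<delta> by (intro powr_mono2) auto
    also have "\<dots> = m powr (2 * (1 + \<delta>))"
      using m(3) by (simp add: powr_mult powr_add[symmetric])
    also have "\<dots> \<le> 1 + m powr (2 + \<epsilon>)"
    proof (cases "m \<le> 1")
      case True
      then have "m powr (2 * (1 + \<delta>)) \<le> 1" using m(3) \<delta> by (intro powr_le1) auto
      then show ?thesis using powr_ge_zero[of m "2 + \<epsilon>"] by linarith
    next
      case False
      then have "m powr (2 * (1 + \<delta>)) \<le> m powr (2 + \<epsilon>)" using \<delta> by (intro powr_mono) auto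
      then show ?thesis by simp
    qed
    also have "m powr (2 + \<epsilon>) \<le> \<bar>a\<bar> powr (2 + \<epsilon>) + \<bar>b\<bar> powr (2 + \<epsilon>)"
      unfolding m_def by (cases "\<bar>a\<bar> \<le> \<bar>b\<bar>") (auto simp: max_def)
    finally show ?thesis by simp
  qed
  have int: "integrable M (\<lambda>x. \<bar>Z s i x * Z s j x\<bar> powr (1 + \<delta>))" for s
    by (rule Bochner_Integration.integrable_bound[of M "\<lambda>x. 1 + \<bar>Z s i x\<bar> powr (2 + \<epsilon>) + \<bar>Z s j x\<bar> powr (2 + \<epsilon>)"])
       (use pt Z_mom ij in \<open>auto intro!: AE_I2 intro: order_trans[OF pt abs_ge_self]\<close>)
  have prod_int: "integrable M (\<lambda>x. Z s i x * Z s j x)" for s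
  proof (rule Bochner_Integration.integrable_bound[of M "\<lambda>x. (Z s i x)\<^sup>2 + (Z s j x)\<^sup>2"])
    have "\<bar>a * b\<bar> \<le> a\<^sup>2 + b\<^sup>2" for a b :: real
    proof -
      have "2 * (\<bar>a\<bar> * \<bar>b\<bar>) \<le> \<bar>a\<bar>\<^sup>2 + \<bar>b\<bar>\<^sup>2" using sum_squares_bound[of "\<bar>a\<bar>" "\<bar>b\<bar>"] by (simp add: mult_ac)
      moreover have "0 \<le> \<bar>a\<bar> * \<bar>b\<bar>" by simp
      ultimately show ?thesis unfolding abs_mult power2_abs by linarith
    qed
    then show "AE x in M. norm (Z s i x * Z s j x) \<le> norm ((Z s i x)\<^sup>2 + (Z s j x)\<^sup>2)"
      by (auto intro!: AE_I2)
  qed (use Z_sq ij in auto)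
  show ?thesis
  proof (rule AE_average_tendsto_mean[of F, where \<delta> = \<delta> and V = "expectation (\<lambda>x. \<bar>Z 0 i x * Z 0 j x\<bar> powr (1 + \<delta>))"])
    show "(\<lambda>x. Z s i x * Z s j x) \<in> borel_measurable (F (Suc s))" for s
      using ij by (intro borel_measurable_times Z_meas)
    show "indep_var borel (\<lambda>x. Z s i x * Z s j x) borel U" if "U \<in> borel_measurable (F s)" for s U
    proof (rule noise_indep[OF that])
      show "(\<lambda>x. Z s i x * Z s j x) \<in> borel_measurable (gen_algebra M (Z s) {..<d})"
        using ij by (intro borel_measurable_times borel_measurable_gen_algebra[where Z = "Z s"]) auto
    qed measurable
    show "expectation (\<lambda>x. \<bar>Z s i x * Z s j x\<bar> powr (1 + \<delta>)) \<le> expectation (\<lambda>x. \<bar>Z 0 i x * Z 0 j x\<bar> powr (1 + \<delta>))" for s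
      using noise_expectation[OF ij, of "\<lambda>a b. \<bar>a * b\<bar> powr (1 + \<delta>)" s] by simp
    show "expectation (\<lambda>x. Z s i x * Z s j x) = expectation (\<lambda>x. Z 0 i x * Z 0 j x)" for s
      using noise_expectation[OF ij, of "\<lambda>a b. a * b" s] by simp
  qed (use sub mono int prod_int \<delta> in auto)
qed

end

end

text \<open>The sum of products has \<open>t + 1\<close> terms but is divided by \<open>t\<close>,
  so it is the average at \<open>Suc t\<close> times \<open>(t + 1) / t\<close>. The constants
  \<open>h1\<close> and \<open>h2\<close> cancel in the limit and leave the noise
  covariance.\<close>

lemma sample_covariance_tendsto:
  fixes z1 z2 :: "nat \<Rightarrow> real"
  assumes a1: "(\<lambda>t. (\<Sum>s<t. z1 s) / real t) \<longlonglongrightarrow> 0" and a2: "(\<lambda>t. (\<Sum>s<t. z2 s) / real t) \<longlonglongrightarrow> 0"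
    and a12: "(\<lambda>t. (\<Sum>s<t. z1 s * z2 s) / real t) \<longlonglongrightarrow> R"
  shows "(\<lambda>t. (1 / real t) * (\<Sum>s\<le>t. (h1 + z1 s) * (h2 + z2 s))
     - ((1 / real t) * (\<Sum>s<t. h1 + z1 s)) * ((1 / real t) * (\<Sum>s<t. h2 + z2 s))) \<longlonglongrightarrow> R"
proof -
  let ?A = "\<lambda>t. h1 * h2 + h1 * ((\<Sum>s<t. z2 s) / real t) + h2 * ((\<Sum>s<t. z1 s) / real t) + (\<Sum>s<t. z1 s * z2 s) / real t"
  let ?M = "\<lambda>t. (h1 + (\<Sum>s<t. z1 s) / real t) * (h2 + (\<Sum>s<t. z2 s) / real t)"
  have A: "?A \<longlonglongrightarrow> h1 * h2 + h1 * 0 + h2 * 0 + R" by (intro tendsto_intros a1 a2 a12)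
  have r: "(\<lambda>t. (real t + 1) / real t) \<longlonglongrightarrow> 1" by real_asymp
  have M: "?M \<longlonglongrightarrow> (h1 + 0) * (h2 + 0)" by (intro tendsto_intros a1 a2)
  have "(\<lambda>t. (real t + 1) / real t * ?A (Suc t) - ?M t) \<longlonglongrightarrow> 1 * (h1 * h2 + h1 * 0 + h2 * 0 + R) - (h1 + 0) * (h2 + 0)"
    by (intro tendsto_diff tendsto_mult[OF r] M LIMSEQ_Suc[OF A])
  then have "(\<lambda>t. (real t + 1) / real t * ?A (Suc t) - ?M t) \<longlonglongrightarrow> R" by simp
  moreover have "\<forall>\<^sub>F t in sequentially. (real t + 1) / real t * ?A (Suc t) - ?M t =
     (1 / real t) * (\<Sum>s\<le>t. (h1 + z1 s) * (h2 + z2 s))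
     - ((1 / real t) * (\<Sum>s<t. h1 + z1 s)) * ((1 / real t) * (\<Sum>s<t. h2 + z2 s))"
    using eventually_gt_at_top[of 0]
  proof eventually_elim
    case (elim t)
    have s1: "(\<Sum>s\<le>t. (h1 + z1 s) * (h2 + z2 s)) = (real t + 1) * ?A (Suc t)"
    proof -
      have "(\<Sum>s<Suc t. (h1 + z1 s) * (h2 + z2 s)) = (real t + 1) * (h1 * h2) + h1 * (\<Sum>s<Suc t. z2 s)
         + h2 * (\<Sum>s<Suc t. z1 s) + (\<Sum>s<Suc t. z1 s * z2 s)"
        by (simp only: distrib_left distrib_right sum.distrib sum_distrib_left) (simp add: algebra_simps)
      also have "\<dots> = (real t + 1) * ?A (Suc t)"
      proof -
        have "n * (p + h1 * (X / n) + h2 * (Y / n) + Z / n) = n * p + h1 * X + h2 * Y + Z"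
          if "n \<noteq> 0" for n p X Y Z :: real using that by (simp add: field_simps)
        from this[of "real t + 1"] show ?thesis by (simp add: of_nat_Suc add.commute[of 1 "real t"])
      qed
      finally show ?thesis by (simp only: lessThan_Suc_atMost)
    qed
    have s2: "(1 / real t) * (\<Sum>s<t. h + z s) = h + (\<Sum>s<t. z s) / real t" for h and z :: "nat \<Rightarrow> real"
      using elim by (simp add: sum.distrib field_simps)
    show ?case unfolding s1 s2 by simp
  qed
  ultimately show ?thesis by (rule Lim_transform_eventually)
qed

section \<open>Matrix inverses\<close>

text \<open>\<open>invertible_mat\<close> leaves the shape of the inverse open; it is recovered from
  the shapes of the two products before determinants are multiplied.\<close>

lemma invertible_mat_det_nonzero:
  fixes A :: "real mat"
  assumes A: "A \<in> carrier_mat d d" and inv: "invertible_mat A"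
  shows "det A \<noteq> 0"
proof -
  obtain B where B: "A * B = 1\<^sub>m d" "B * A = 1\<^sub>m (dim_row B)"
    using inv A unfolding invertible_mat_def inverts_mat_def by auto
  have "dim_col B = d" using B(1) by (metis index_mult_mat(3) index_one_mat(3))
  moreover have "dim_row B = d" using B(2) A by (metis carrier_matD(2) index_mult_mat(3) index_one_mat(3))
  ultimately have "B \<in> carrier_mat d d" by auto
  then have "det A * det B = det (1\<^sub>m d :: real mat)"
    using det_mult[OF A] B(1) by metis
  then show ?thesis by auto
qed

text \<open>For nonzero determinant the choice in \<open>mat_inv\<close> is unique and given by the
  adjugate. Its entries are thus rational functions of the entries of \<open>A\<close>, the source
  of both measurability and continuity below.\<close>

lemma mat_inv_inverse:
  fixes A :: "real mat"
  assumes A: "A \<in> carrier_mat d d" and dt: "det A \<noteq> 0"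
  shows "mat_inv A = (1 / det A) \<cdot>\<^sub>m adj_mat A" (is "_ = ?B")
    and "mat_inv A \<in> carrier_mat d d" "A * mat_inv A = 1\<^sub>m d" "mat_inv A * A = 1\<^sub>m d"
proof -
  note adj = adj_mat[OF A]
  have B: "?B \<in> carrier_mat d d" "A * ?B = 1\<^sub>m d" "?B * A = 1\<^sub>m d"
    unfolding mult_smult_distrib[OF A adj(1)] mult_smult_assoc_mat[OF adj(1) A] adj(2,3)
    using adj(1) dt by (auto intro!: eq_matI)
  have uniq: "C = ?B" if "C \<in> carrier_mat d d" "A * C = 1\<^sub>m d" for C
  proof -
    have "C = (?B * A) * C" using B(3) that(1) by simp
    also have "\<dots> = ?B * (A * C)" using B(1) A that(1) by (intro assoc_mult_mat) auto
    also have "\<dots> = ?B" unfolding that(2) by (rule right_mult_one_mat[OF B(1)])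
    finally show ?thesis .
  qed
  have dr: "dim_row A = d" using A by simp
  show eq: "mat_inv A = ?B"
    unfolding mat_inv_def dr by (rule some_equality, intro conjI B) (use uniq in blast)
  show "mat_inv A \<in> carrier_mat d d" "A * mat_inv A = 1\<^sub>m d" "mat_inv A * A = 1\<^sub>m d"
    unfolding eq by (rule B)+
qed

lemma mat_inv_singular:
  fixes A :: "real mat"
  assumes A: "A \<in> carrier_mat d d" and dt: "det A = 0"
  shows "mat_inv A = (SOME B. False)"
proof -
  have "\<not> (B \<in> carrier_mat d d \<and> A * B = 1\<^sub>m d)" for B
  proof
    assume "B \<in> carrier_mat d d \<and> A * B = 1\<^sub>m d"
    then have "det A * det B = 1" using det_mult[OF A] by (metis det_one)
    with dt show False by simp
  qed
  then show ?thesis unfolding mat_inv_def using A by (intro arg_cong[where f = Eps]) auto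
qed

lemma mat_inv_index:
  fixes A :: "real mat"
  assumes A: "A \<in> carrier_mat d d" and dt: "det A \<noteq> 0" and ij: "i < d" "j < d"
  shows "mat_inv A $$ (i,j) = cofactor A j i / det A"
  using mat_inv_inverse(1)[OF A dt] ij A by (simp add: adj_mat_def)

lemma mat_delete_entry:
  assumes "A \<in> carrier_mat d d" "i < d" "j < d" "r < d - 1" "c < d - 1"
  shows "mat_delete A i j $$ (r,c) = A $$ (if r < i then r else Suc r, if c < j then c else Suc c)"
  using assms by (auto simp: mat_delete_def)

lemma borel_measurable_det:
  fixes A :: "'a \<Rightarrow> real mat"
  assumes A: "\<And>x. A x \<in> carrier_mat d d"
    and m: "\<And>i j. i < d \<Longrightarrow> j < d \<Longrightarrow> (\<lambda>x. A x $$ (i,j)) \<in> borel_measurable G"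
  shows "(\<lambda>x. det (A x)) \<in> borel_measurable G"
  unfolding det_def'[OF A]
  by (intro borel_measurable_sum borel_measurable_times borel_measurable_const borel_measurable_prod m)
     (auto simp: permutes_in_image dest: permutes_in_image)

lemma borel_measurable_cofactor:
  assumes A: "\<And>x. A x \<in> carrier_mat d d"
    and m: "\<And>i j. i < d \<Longrightarrow> j < d \<Longrightarrow> (\<lambda>x. A x $$ (i,j)) \<in> borel_measurable G"
    and ij: "i < d" "j < d"
  shows "(\<lambda>x. cofactor (A x) i j :: real) \<in> borel_measurable G"
proof -
  have "(\<lambda>x. det (mat_delete (A x) i j)) \<in> borel_measurable G"
  proof (rule borel_measurable_det[of _ "d - 1"])
    show "mat_delete (A x) i j \<in> carrier_mat (d - 1) (d - 1)" for x
      using A[of x] by (auto simp: mat_delete_def)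
    fix r c assume "r < d - 1" "c < d - 1"
    then show "(\<lambda>x. mat_delete (A x) i j $$ (r,c)) \<in> borel_measurable G"
      using ij by (subst mat_delete_entry[OF A]) (auto intro!: m)
  qed
  then show ?thesis unfolding cofactor_def by (intro borel_measurable_times) auto
qed

text \<open>At singular matrices \<open>mat_inv\<close> is one fixed junk matrix, so composing it with any
  function that is measurable on invertible matrices stays measurable.\<close>

lemma borel_measurable_mat_inv_functional:
  fixes \<Phi> :: "real mat \<Rightarrow> real"
  assumes A: "\<And>x. A x \<in> carrier_mat d d"
    and m: "\<And>i j. i < d \<Longrightarrow> j < d \<Longrightarrow> (\<lambda>x. A x $$ (i,j)) \<in> borel_measurable G"
    and \<Phi>: "\<And>B. B \<in> carrier_mat d d \<Longrightarrow> \<Phi> B = (\<Sum>k<d. \<Sum>l<d. c k l * B $$ (k,l))"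
  shows "(\<lambda>x. \<Phi> (mat_inv (A x))) \<in> borel_measurable G"
proof -
  \<comment> \<open>The junk matrix may have any shape, so the linear formula for
    \<open>\<Phi>\<close> is invoked only in the invertible branch.\<close>
  have eq: "\<Phi> (mat_inv (A x)) = (if det (A x) = 0 then \<Phi> (SOME B. False)
      else \<Sum>k<d. \<Sum>l<d. c k l * (cofactor (A x) l k / det (A x)))" for x
  proof (cases "det (A x) = 0")
    case True then show ?thesis using mat_inv_singular[OF A] by simp
  next
    case False
    then show ?thesis using \<Phi>[OF mat_inv_inverse(2)[OF A False]]
      by (simp add: mat_inv_index[OF A False])
  qed
  have [measurable]: "(\<lambda>x. det (A x)) \<in> borel_measurable G"
    by (rule borel_measurable_det[OF A m])
  show ?thesis unfolding eq
    by (intro measurable_If borel_measurable_sum borel_measurable_times borel_measurable_divide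
        borel_measurable_const borel_measurable_cofactor[OF A m]) (auto intro: m)
qed

lemma borel_measurable_mat_inv_index:
  assumes A: "\<And>x. A x \<in> carrier_mat d d"
    and m: "\<And>i j. i < d \<Longrightarrow> j < d \<Longrightarrow> (\<lambda>x. A x $$ (i,j)) \<in> borel_measurable G"
    and ij: "i < d" "j < d"
  shows "(\<lambda>x. mat_inv (A x) $$ (i,j)) \<in> borel_measurable G"
proof (rule borel_measurable_mat_inv_functional[OF A m, where c = "\<lambda>k l. of_bool (k = i) * of_bool (l = j)"])
  fix B :: "real mat"
  have "(\<Sum>k<d. \<Sum>l<d. of_bool (k = i) * of_bool (l = j) * B $$ (k,l)) = (\<Sum>k<d. if k = i then (\<Sum>l<d. if l = j then B $$ (k,l) else 0) else 0)"
    by (intro sum.cong refl) (auto intro!: sum.cong)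
  then show "B $$ (i,j) = (\<Sum>k<d. \<Sum>l<d. of_bool (k = i) * of_bool (l = j) * B $$ (k,l))"
    using ij by simp
qed auto

lemma tendsto_det:
  fixes A :: "nat \<Rightarrow> real mat"
  assumes A: "\<And>t. A t \<in> carrier_mat d d" and B: "B \<in> carrier_mat d d"
    and lim: "\<And>i j. i < d \<Longrightarrow> j < d \<Longrightarrow> (\<lambda>t. A t $$ (i,j)) \<longlonglongrightarrow> B $$ (i,j)"
  shows "(\<lambda>t. det (A t)) \<longlonglongrightarrow> det B"
  unfolding det_def'[OF A] det_def'[OF B]
  by (intro tendsto_sum tendsto_mult tendsto_const tendsto_prod lim)
     (auto simp: permutes_in_image dest: permutes_in_image)

lemma tendsto_mat_inv:
  fixes A :: "nat \<Rightarrow> real mat"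
  assumes A: "\<And>t. A t \<in> carrier_mat d d" and B: "B \<in> carrier_mat d d" and dB: "det B \<noteq> 0"
    and lim: "\<And>i j. i < d \<Longrightarrow> j < d \<Longrightarrow> (\<lambda>t. A t $$ (i,j)) \<longlonglongrightarrow> B $$ (i,j)"
  shows "\<forall>\<^sub>F t in sequentially. det (A t) \<noteq> 0"
    and "i < d \<Longrightarrow> j < d \<Longrightarrow> (\<lambda>t. mat_inv (A t) $$ (i,j)) \<longlonglongrightarrow> mat_inv B $$ (i,j)"
proof -
  note dl = tendsto_det[OF A B lim]
  show ev: "\<forall>\<^sub>F t in sequentially. det (A t) \<noteq> 0"
    by (rule tendsto_imp_eventually_ne[OF dl dB])
  assume ij: "i < d" "j < d"
  have "(\<lambda>t. det (mat_delete (A t) j i)) \<longlonglongrightarrow> det (mat_delete B j i)"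
  proof (rule tendsto_det[of _ "d - 1"])
    show "mat_delete (A t) j i \<in> carrier_mat (d - 1) (d - 1)" for t using A[of t] by (auto simp: mat_delete_def)
    show "mat_delete B j i \<in> carrier_mat (d - 1) (d - 1)" using B by (auto simp: mat_delete_def)
    fix r c assume rc: "r < d - 1" "c < d - 1"
    show "(\<lambda>t. mat_delete (A t) j i $$ (r,c)) \<longlonglongrightarrow> mat_delete B j i $$ (r,c)"
      using rc ij by (subst mat_delete_entry[OF A] mat_delete_entry[OF B], (auto)[4])+ (auto intro!: lim)
  qed
  then have "(\<lambda>t. cofactor (A t) j i / det (A t)) \<longlonglongrightarrow> cofactor B j i / det B"
    unfolding cofactor_def by (intro tendsto_intros dl dB)
  then have "(\<lambda>t. cofactor (A t) j i / det (A t)) \<longlonglongrightarrow> mat_inv B $$ (i,j)"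
    using mat_inv_index[OF B dB ij] by simp
  moreover have "\<forall>\<^sub>F t in sequentially. cofactor (A t) j i / det (A t) = mat_inv (A t) $$ (i,j)"
    using ev by eventually_elim (simp add: mat_inv_index[OF A _ ij])
  ultimately show "(\<lambda>t. mat_inv (A t) $$ (i,j)) \<longlonglongrightarrow> mat_inv B $$ (i,j)"
    by (rule Lim_transform_eventually)
qed

lemma mat_vec_index_sum:
  fixes A :: "real mat"
  assumes "A \<in> carrier_mat r c" "v \<in> carrier_vec c" "i < r"
  shows "(A *\<^sub>v v) $ i = (\<Sum>k<c. A $$ (i,k) * v $ k)"
  using assms by (simp add: scalar_prod_def atLeast0LessThan)

lemma mat_mult_index_sum:
  fixes A B :: "'b :: comm_semiring_1 mat"
  assumes "A \<in> carrier_mat r d" "B \<in> carrier_mat d c" "i < r" "j < c"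
  shows "(A * B) $$ (i,j) = (\<Sum>k<d. A $$ (i,k) * B $$ (k,j))"
  using assms by (simp add: scalar_prod_def atLeast0LessThan)

section \<open>The spectral gap of a mean Laplacian\<close>

text \<open>The all-ones vector and \<open>w\<close> are independent kernel vectors. As columns
  \<open>i\<close> and \<open>j\<close> of a basis matrix \<open>P\<close> they make the same
  columns of \<open>(X I - A) P\<close> equal to \<open>X\<close> times those of \<open>P\<close>,
  and pulling the two factors out of the determinant leaves \<open>X\<^sup>2\<close>.\<close>

lemma char_poly_double_kernel:
  fixes A :: "real mat" and w :: "nat \<Rightarrow> real"
  assumes A: "A \<in> carrier_mat N N" and ij: "i < N" "j < N" "i \<noteq> j"
    and ker1: "\<And>r. r < N \<Longrightarrow> (\<Sum>k<N. A $$ (r,k)) = 0"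
    and kerw: "\<And>r. r < N \<Longrightarrow> (\<Sum>k<N. A $$ (r,k) * w k) = 0"
    and w: "w i = 0" "w j \<noteq> 0"
  shows "[:0,1:]\<^sup>2 dvd char_poly A"
proof -
  interpret c: comm_ring_hom "\<lambda>a::real. [:a:]" by unfold_locales auto
  \<comment> \<open>The other columns are unit vectors; \<open>w i = 0\<close> and
    \<open>w j \<noteq> 0\<close> make \<open>P\<close> invertible.\<close>
  define P where "P = mat N N (\<lambda>(r,c). if c = i then 1 else if c = j then w r else of_bool (r = c) :: real)"
  define P' where "P' = map_mat (\<lambda>a. [:a:]) P"
  define X where "X = char_poly_matrix A * P'"
  define C where "C = mat N N (\<lambda>(r,c). if c = i \<or> c = j then [:P $$ (r,c):] else X $$ (r,c))"
  define D where "D = mat N N (\<lambda>(r,c). if r = c then (if c = i \<or> c = j then [:0,1:] else 1) else (0 :: real poly))"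
  have P: "P \<in> carrier_mat N N" "P' \<in> carrier_mat N N" and C: "C \<in> carrier_mat N N" and D: "D \<in> carrier_mat N N"
    and CP: "char_poly_matrix A \<in> carrier_mat N N"
    using A by (auto simp: P_def P'_def C_def D_def)
  have X: "X \<in> carrier_mat N N" unfolding X_def by (rule mult_carrier_mat[OF CP P(2)])
  have AP: "(\<Sum>k<N. A $$ (r,k) * P $$ (k,c)) = 0" if "r < N" "c = i \<or> c = j" for r c
    using that ker1[OF that(1)] kerw[OF that(1)] ij by (auto simp: P_def)
  have Xentry: "X $$ (r,c) = [:0,1:] * [:P $$ (r,c):]" if rc: "r < N" "c < N" and ci: "c = i \<or> c = j" for r c
  proof -
    have "X $$ (r,c) = (\<Sum>k<N. char_poly_matrix A $$ (r,k) * P' $$ (k,c))"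
      unfolding X_def by (rule mat_mult_index_sum[OF CP P(2) rc])
    also have "\<dots> = (\<Sum>k<N. (if r = k then [:0,1:] * [:P $$ (k,c):] else 0) - [:A $$ (r,k) * P $$ (k,c):])"
      using A rc P by (intro sum.cong refl) (auto simp: char_poly_matrix_def P'_def)
    also have "\<dots> = (\<Sum>k<N. if r = k then [:0,1:] * [:P $$ (k,c):] else 0) - [:\<Sum>k<N. A $$ (r,k) * P $$ (k,c):]"
      unfolding sum_subtractf c.hom_sum ..
    also have "\<dots> = [:0,1:] * [:P $$ (r,c):]" using rc AP[OF rc(1) ci] by simp
    finally show ?thesis .
  qed
  have "X = C * D"
  proof (rule eq_matI)
    fix r c assume "r < dim_row (C * D)" "c < dim_col (C * D)"
    then have rc: "r < N" "c < N" using C D by auto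
    have "(C * D) $$ (r,c) = (\<Sum>k<N. C $$ (r,k) * D $$ (k,c))" by (rule mat_mult_index_sum[OF C D rc])
    also have "\<dots> = (\<Sum>k<N. if k = c then C $$ (r,c) * (if c = i \<or> c = j then [:0,1:] else 1) else 0)"
      using rc by (intro sum.cong refl) (auto simp: D_def)
    also have "\<dots> = X $$ (r,c)"
      using rc Xentry[OF rc] by (simp add: C_def)
    finally show "X $$ (r,c) = (C * D) $$ (r,c)" ..
  qed (use C D X in auto)
  then have eq: "char_poly A * [:det P:] = det C * det D"
    using det_mult[OF CP P(2)] det_mult[OF C D] X_def
    by (simp add: char_poly_def P'_def)
  have "det D = prod_list (diag_mat D)"
    by (rule det_upper_triangular[OF _ D]) (auto simp: D_def)
  also have "\<dots> = (\<Prod>c = 0..<N. if c = i \<or> c = j then [:0,1:] else 1)"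
    using D by (simp add: prod_list_diag_prod D_def)
  also have "\<dots> = (\<Prod>c\<in>{i,j}. [:0,1:])"
    by (rule prod.mono_neutral_cong_right) (use ij in auto)
  also have "\<dots> = [:0,1:]\<^sup>2" using ij by (simp add: power2_eq_square)
  finally have dD: "det D = [:0,1:]\<^sup>2" .
  have dP: "det P \<noteq> 0"
  proof
    assume "det P = 0"
    then obtain v where v: "v \<in> carrier_vec N" "v \<noteq> 0\<^sub>v N" "P *\<^sub>v v = 0\<^sub>v N"
      using det_0_iff_vec_prod_zero[OF P(1)] by auto
    have row: "(\<Sum>k<N. P $$ (r,k) * v $ k) = 0" if "r < N" for r
      using mat_vec_index_sum[OF P(1) v(1) that] v(3) that by simp
    have rowr: "(\<Sum>k<N. P $$ (r,k) * v $ k) = v $ i + w r * v $ j + (if r = i \<or> r = j then 0 else v $ r)" if r: "r < N" for r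
    proof -
      have "(\<Sum>k<N. P $$ (r,k) * v $ k) = (\<Sum>k<N. (if k = i then v $ i else 0) + (if k = j then w r * v $ j else 0)
          + (if k = r then (if r = i \<or> r = j then 0 else v $ r) else 0))"
        using r ij by (intro sum.cong refl) (auto simp: P_def)
      then show ?thesis using ij r by (simp add: sum.distrib)
    qed
    have vi: "v $ i = 0" using row[OF ij(1)] rowr[OF ij(1)] w by simp
    have vj: "v $ j = 0" using row[OF ij(2)] rowr[OF ij(2)] w vi by simp
    have "v $ r = 0" if "r < N" for r
      using row[OF that] rowr[OF that] vi vj by (cases "r = i \<or> r = j") auto
    then have "v = 0\<^sub>v N" using v(1) by (intro eq_vecI) auto
    with v(2) show False by simp
  qed
  have "char_poly A = (char_poly A * [:det P:]) * [:1 / det P:]"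
    using dP by simp
  also have "\<dots> = [:0,1:]\<^sup>2 * (det C * [:1 / det P:])"
    unfolding eq dD by (simp only: mult_ac)
  finally show ?thesis by (metis dvd_triv_left)
qed

text \<open>A sorted list with a positive second entry contains at most one zero, whereas a double
  root puts 0 there at least twice.\<close>

lemma lambda2_nonpos_double_root:
  fixes A :: "real mat"
  assumes A: "A \<in> carrier_mat N N" and dv: "[:0,1:]\<^sup>2 dvd char_poly A"
  shows "lambda2 A \<le> 0"
proof (rule ccontr)
  assume pos: "\<not> lambda2 A \<le> 0"
  have nz: "char_poly A \<noteq> 0" using degree_monic_char_poly[OF A] by auto
  define xs where "xs = sorted_list_of_multiset (proots (char_poly A))"
  have "2 \<le> Polynomial.order 0 (char_poly A)"
    using order_divides[of 0 2 "char_poly A"] dv nz by simp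
  then have "2 \<le> count (mset xs) 0" unfolding xs_def using nz by simp
  moreover have "sorted xs" unfolding xs_def by simp
  moreover have "xs ! 1 > 0" using pos by (simp add: lambda2_def xs_def)
  ultimately show False
  proof (cases xs)
    case Nil then show ?thesis using \<open>2 \<le> count (mset xs) 0\<close> by simp
  next
    case (Cons x ys)
    show ?thesis
    proof (cases ys)
      case Nil then show ?thesis using \<open>2 \<le> count (mset xs) 0\<close> Cons by (simp split: if_splits)
    next
      case (Cons y zs)
      with \<open>xs = x # ys\<close> have xs: "xs = x # y # zs" by simp
      have "y > 0" "\<forall>z\<in>set zs. z \<ge> y" using \<open>xs ! 1 > 0\<close> \<open>sorted xs\<close> xs by auto
      then have "0 \<notin># mset (y # zs)" by fastforce
      then have "count (mset (y # zs)) 0 = 0" by (meson count_eq_zero_iff)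
      then have "count (mset xs) 0 \<le> 1" unfolding xs by simp
      then show ?thesis using \<open>2 \<le> count (mset xs) 0\<close> by simp
    qed
  qed
qed

text \<open>The eigenvalue is used only qualitatively, which avoids the spectral theorem. If a node
  were unreachable from node 0, the indicator of the reachable nodes would be a second kernel vector
  and 0 a double root. Reachability gives the inequality by chaining along paths, with a constant
  \<open>1 / K\<close> in place of the eigenvalue.\<close>

lemma laplacian_spectral_gap:
  fixes wb :: "nat \<Rightarrow> nat \<Rightarrow> real"
  assumes nn: "\<And>n l. n < N \<Longrightarrow> l < N \<Longrightarrow> 0 \<le> wb n l"
    and sym: "\<And>n l. n < N \<Longrightarrow> l < N \<Longrightarrow> wb n l = wb l n"
    and A: "A \<in> carrier_mat N N"
    and Au: "\<And>r u. r < N \<Longrightarrow> (\<Sum>k<N. A $$ (r,k) * u k) = (\<Sum>k<N. wb r k * (u r - u k))"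
    and l2: "lambda2 A > 0" and N: "N > 0"
  shows "\<exists>c>0. \<forall>u. (\<Sum>n<N. u n) = 0 \<longrightarrow> c * (\<Sum>n<N. (u n)\<^sup>2) \<le> (\<Sum>n<N. \<Sum>l<N. wb n l * (u n - u l)\<^sup>2)"
proof -
  define E where "E = {(i,j). i < N \<and> j < N \<and> wb i j > 0}"
  define q where "q u = (\<Sum>n<N. \<Sum>l<N. wb n l * (u n - u l)\<^sup>2)" for u :: "nat \<Rightarrow> real"
  have reach: "(0,j) \<in> E\<^sup>*" if "j < N" for j
  proof (rule ccontr)
    assume nr: "(0,j) \<notin> E\<^sup>*"
    define w where "w k = (of_bool ((0,k) \<in> E\<^sup>*) :: real)" for k
    have j0: "j \<noteq> 0" using nr by (metis rtrancl.rtrancl_refl)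
    have zero: "wb r k * (w r - w k) = 0" if "r < N" "k < N" for r k
    proof (cases "wb r k > 0")
      case True
      then have "(r,k) \<in> E" "(k,r) \<in> E" using that sym by (auto simp: E_def)
      then have "w r = w k" by (auto simp: w_def intro: rtrancl_into_rtrancl)
      then show ?thesis by simp
    next
      case False then show ?thesis using nn[OF that] by simp
    qed
    have "[:0,1:]\<^sup>2 dvd char_poly A"
    proof (rule char_poly_double_kernel[OF A \<open>j < N\<close> N j0, where w = w])
      show "(\<Sum>k<N. A $$ (r,k)) = 0" if "r < N" for r using Au[OF that, of "\<lambda>_. 1"] by simp
      show "(\<Sum>k<N. A $$ (r,k) * w k) = 0" if "r < N" for r
        unfolding Au[OF that] using zero that by (intro sum.neutral) auto
    qed (use nr in \<open>auto simp: w_def\<close>)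
    with lambda2_nonpos_double_root[OF A] l2 show False by simp
  qed
  have q_edge: "wb i j * (u i - u j)\<^sup>2 \<le> q u" if "i < N" "j < N" for i j u
  proof -
    have "wb i j * (u i - u j)\<^sup>2 \<le> (\<Sum>l<N. wb i l * (u i - u l)\<^sup>2)"
      using that nn by (intro member_le_sum[of j _ "\<lambda>l. wb i l * (u i - u l)\<^sup>2"]) auto
    also have "\<dots> \<le> q u" unfolding q_def
      using that nn by (intro member_le_sum[of i _ "\<lambda>i. \<Sum>l<N. wb i l * (u i - u l)\<^sup>2"]) (auto intro!: sum_nonneg)
    finally show ?thesis .
  qed
  have q0: "0 \<le> q u" for u unfolding q_def using nn by (intro sum_nonneg) auto
  have chain: "\<exists>C\<ge>0. \<forall>u. (u 0 - u j)\<^sup>2 \<le> C * q u" if "(0,j) \<in> E\<^sup>*" for j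
    using that
  proof (induction rule: rtrancl_induct)
    case base then show ?case using q0 by (intro exI[of _ 0]) auto
  next
    case (step j k)
    then obtain C where C: "C \<ge> 0" "\<And>u. (u 0 - u j)\<^sup>2 \<le> C * q u" by blast
    have e: "j < N" "k < N" "wb j k > 0" using step(2) by (auto simp: E_def)
    show ?case
    \<comment> \<open>\<open>(a + b)\<^sup>2 \<le> 2 * a\<^sup>2 + 2 * b\<^sup>2\<close> doubles the
      constant of the path so far and adds \<open>2 / wb j k\<close> for the new edge.\<close>
    proof (intro exI[of _ "2 * C + 2 / wb j k"] conjI allI)
      show "0 \<le> 2 * C + 2 / wb j k" using C e by simp
      fix u :: "nat \<Rightarrow> real"
      have "(u 0 - u k)\<^sup>2 = ((u 0 - u j) + (u j - u k))\<^sup>2" by simp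
      also have "\<dots> \<le> 2 * (u 0 - u j)\<^sup>2 + 2 * (u j - u k)\<^sup>2"
        using zero_le_power2[of "(u 0 - u j) - (u j - u k)"] by (simp only: power2_eq_square algebra_simps)
      also have "\<dots> \<le> 2 * (C * q u) + 2 * (q u / wb j k)"
        using C(2)[of u] q_edge[OF e(1,2), of u] e(3) by (intro add_mono mult_left_mono) (auto simp: field_simps)
      finally show "(u 0 - u k)\<^sup>2 \<le> (2 * C + 2 / wb j k) * q u" by (simp add: algebra_simps)
    qed
  qed
  then have "\<forall>j\<in>{..<N}. \<exists>C\<ge>0. \<forall>u. (u 0 - u j)\<^sup>2 \<le> C * q u" using reach by auto
  then obtain C where C: "\<And>j. j < N \<Longrightarrow> C j \<ge> 0" "\<And>j u. j < N \<Longrightarrow> (u 0 - u j)\<^sup>2 \<le> C j * q u"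
    unfolding bchoice_iff by (metis lessThan_iff)
  define K where "K = (\<Sum>j<N. C j) + 1"
  have K: "K > 0" unfolding K_def using C(1) by (intro add_nonneg_pos sum_nonneg) auto
  show ?thesis
  proof (intro exI[of _ "1 / K"] conjI allI impI)
    show "0 < 1 / K" using K by simp
    fix u :: "nat \<Rightarrow> real" assume su: "(\<Sum>n<N. u n) = 0"
    have "(\<Sum>n<N. (u n)\<^sup>2) \<le> (\<Sum>n<N. (u n)\<^sup>2) + N * (u 0)\<^sup>2" by simp
    \<comment> \<open>For mean-zero \<open>u\<close> the mixed terms vanish, so comparing every node
      with node 0 controls the full sum of squares.\<close>
    also have "\<dots> = (\<Sum>n<N. (u 0 - u n)\<^sup>2)"
    proof -
      have "(\<Sum>n<N. (u 0 - u n)\<^sup>2) = (\<Sum>n<N. (u 0)\<^sup>2 + (u n)\<^sup>2 - 2 * u 0 * u n)"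
        by (intro sum.cong refl) (simp add: power2_diff)
      also have "\<dots> = N * (u 0)\<^sup>2 + (\<Sum>n<N. (u n)\<^sup>2) - 2 * u 0 * (\<Sum>n<N. u n)"
        by (simp add: sum.distrib sum_subtractf sum_distrib_left)
      finally show ?thesis using su by simp
    qed
    also have "\<dots> \<le> (\<Sum>n<N. C n * q u)" using C(2) by (intro sum_mono) auto
    also have "\<dots> \<le> K * q u" unfolding K_def using q0[of u] by (simp add: sum_distrib_right[symmetric] distrib_right)
    finally show "1 / K * (\<Sum>n<N. (u n)\<^sup>2) \<le> (\<Sum>n<N. \<Sum>l<N. wb n l * (u n - u l)\<^sup>2)"
      using K unfolding q_def[symmetric] by (simp add: field_simps)
  qed
qed

text \<open>Off the diagonal the value -1 marks an edge, and on the diagonal a degree is never -1.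
  The edge indicators therefore determine the whole matrix, which reduces random Laplacians to 0/1
  weights.\<close>

lemma laplacian_index:
  assumes "is_graph_laplacian N A" "r < N" "k < N"
  shows "A $$ (r,k) = (if r = k then \<Sum>j<N. of_bool (A $$ (r,j) = -1) else - of_bool (A $$ (r,k) = -1))"
    and "A $$ (r,k) = -1 \<longleftrightarrow> A $$ (k,r) = -1" and "A $$ (r,r) \<noteq> -1"
proof -
  obtain E where E: "\<And>i j. E i j = E j i" "\<And>i. \<not> E i i"
    and A: "A = Matrix.mat N N (\<lambda>(i,j). if i = j then real (card {k. k < N \<and> E i k}) else if E i j then -1 else 0)"
    using assms(1) unfolding is_graph_laplacian_def by blast
  have ne: "real x \<noteq> -1" for x by (metis of_nat_0_le_iff neg_0_le_iff_le not_one_le_zero)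
  have iff: "A $$ (i,j) = -1 \<longleftrightarrow> E i j" if "i < N" "j < N" for i j
    using that E(2) ne by (auto simp: A)
  show "A $$ (r,k) = -1 \<longleftrightarrow> A $$ (k,r) = -1" using iff assms E by simp
  show "A $$ (r,r) \<noteq> -1" using iff assms E by simp
  have "(\<Sum>j<N. of_bool (A $$ (r,j) = -1)) = (\<Sum>j<N. of_bool (E r j) :: real)"
    using iff assms(2) by (intro sum.cong refl) simp
  also have "\<dots> = real (card {k. k < N \<and> E r k})"
  proof -
    have "(\<Sum>j<N. of_bool (E r j) :: real) = (\<Sum>j\<in>{k. k < N \<and> E r k}. 1)"
      by (rule sum.mono_neutral_cong_right) auto
    then show ?thesis by simp
  qed
  finally have deg: "(\<Sum>j<N. of_bool (A $$ (r,j) = -1)) = real (card {k. k < N \<and> E r k})" .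
  have entry: "A $$ (r,k) = (if r = k then real (card {k. k < N \<and> E r k}) else if E r k then -1 else 0)"
    using assms(2,3) by (simp add: A)
  show "A $$ (r,k) = (if r = k then \<Sum>j<N. of_bool (A $$ (r,j) = -1) else - of_bool (A $$ (r,k) = -1))"
    unfolding deg iff[OF assms(2,3)] unfolding entry by simp
qed

lemma laplacian_apply:
  fixes wb :: "nat \<Rightarrow> nat \<Rightarrow> real"
  assumes "r < N" "wb r r = 0"
  shows "(\<Sum>k<N. (if r = k then \<Sum>j<N. wb r j else - wb r k) * u k) = (\<Sum>k<N. wb r k * (u r - u k))"
proof -
  have "(\<Sum>k<N. (if r = k then \<Sum>j<N. wb r j else - wb r k) * u k)
      = (\<Sum>k<N. (if r = k then (\<Sum>j<N. wb r j) * u k else 0) - wb r k * u k)"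
    using assms by (intro sum.cong refl) auto
  also have "\<dots> = (\<Sum>j<N. wb r j) * u r - (\<Sum>k<N. wb r k * u k)"
    using assms by (simp add: sum_subtractf)
  finally show ?thesis by (simp add: right_diff_distrib sum_subtractf sum_distrib_right)
qed

text \<open>This exhibits the entry as linear in \<open>B\<close>, the form under which functions of
  \<open>mat_inv\<close> were shown to be measurable.\<close>

lemma congruence_index:
  fixes B H :: "real mat"
  assumes B: "B \<in> carrier_mat d d" and H: "H \<in> carrier_mat d m" and ij: "i < m" "j < m"
  shows "(H\<^sup>T * B * H) $$ (i,j) = (\<Sum>k<d. \<Sum>l<d. (H $$ (k,i) * H $$ (l,j)) * B $$ (k,l))"
proof -
  have HT: "H\<^sup>T \<in> carrier_mat m d" using H by simp
  have "(H\<^sup>T * B * H) $$ (i,j) = (\<Sum>l<d. (H\<^sup>T * B) $$ (i,l) * H $$ (l,j))"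
    using HT B H ij by (intro mat_mult_index_sum) auto
  also have "\<dots> = (\<Sum>l<d. (\<Sum>k<d. H $$ (k,i) * B $$ (k,l)) * H $$ (l,j))"
    using HT B H ij by (intro sum.cong refl) (subst mat_mult_index_sum[OF HT B], auto)
  also have "\<dots> = (\<Sum>k<d. \<Sum>l<d. (H $$ (k,i) * H $$ (l,j)) * B $$ (k,l))"
    unfolding sum_distrib_right by (subst sum.swap) (simp add: mult_ac)
  finally show ?thesis .
qed

lemma gain_index:
  fixes A B H :: "real mat"
  assumes A: "A \<in> carrier_mat m m" and B: "B \<in> carrier_mat d d" and H: "H \<in> carrier_mat d m" and ij: "i < m" "j < d"
  shows "(A * H\<^sup>T * B) $$ (i,j) = (\<Sum>p<m. \<Sum>r<d. A $$ (i,p) * H $$ (r,p) * B $$ (r,j))"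
proof -
  have HT: "H\<^sup>T \<in> carrier_mat m d" using H by simp
  have "(A * H\<^sup>T * B) $$ (i,j) = (\<Sum>r<d. (A * H\<^sup>T) $$ (i,r) * B $$ (r,j))"
    using A HT B ij by (intro mat_mult_index_sum) auto
  also have "\<dots> = (\<Sum>r<d. (\<Sum>p<m. A $$ (i,p) * H $$ (r,p)) * B $$ (r,j))"
    using A HT H ij by (intro sum.cong refl) (subst mat_mult_index_sum[OF A HT], auto)
  also have "\<dots> = (\<Sum>p<m. \<Sum>r<d. A $$ (i,p) * H $$ (r,p) * B $$ (r,j))"
    unfolding sum_distrib_right by (rule sum.swap)
  finally show ?thesis .
qed

lemma borel_measurable_of_bool_eq:
  fixes f :: "'a \<Rightarrow> real"
  assumes [measurable]: "f \<in> borel_measurable G"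
  shows "(\<lambda>x. of_bool (f x = c) :: real) \<in> borel_measurable G"
  unfolding of_bool_def by measurable

lemma convergent_uniform_bound:
  fixes f :: "'i \<Rightarrow> nat \<Rightarrow> real"
  assumes "finite I" "\<And>i. i \<in> I \<Longrightarrow> f i \<longlonglongrightarrow> l i"
  shows "\<exists>B\<ge>0. \<forall>i\<in>I. \<forall>t. \<bar>f i t\<bar> \<le> B"
proof -
  have "\<forall>i\<in>I. \<exists>b. \<forall>t. \<bar>f i t\<bar> \<le> b"
  proof
    fix i assume "i \<in> I"
    then have "Bseq (f i)" using assms(2) convergentI convergent_imp_Bseq by blast
    then show "\<exists>b. \<forall>t. \<bar>f i t\<bar> \<le> b" unfolding Bseq_def by auto
  qed
  then obtain b where b: "\<And>i t. i \<in> I \<Longrightarrow> \<bar>f i t\<bar> \<le> b i" by metis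
  have b0: "0 \<le> b i" if "i \<in> I" for i using b[OF that, of 0] by linarith
  show ?thesis
  proof (intro exI[of _ "\<Sum>i\<in>I. b i"] conjI ballI allI)
    show "0 \<le> (\<Sum>i\<in>I. b i)" using b0 by (rule sum_nonneg)
    fix i t assume "i \<in> I"
    then show "\<bar>f i t\<bar> \<le> (\<Sum>i\<in>I. b i)"
      using b[of i t] member_le_sum[of i I b] b0 assms(1) by force
  qed
qed

lemma vnorm_index_le:
  fixes v :: "real vec"
  assumes "v \<in> carrier_vec d" "i < d" shows "\<bar>v $ i\<bar> \<le> vnorm v"
proof -
  have "(v $ i)\<^sup>2 \<le> (\<Sum>i<dim_vec v. (v $ i)\<^sup>2)"
    using assms by (intro member_le_sum[of i _ "\<lambda>i. (v $ i)\<^sup>2"]) auto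
  then show ?thesis unfolding vnorm_def by (metis real_sqrt_abs real_sqrt_le_iff)
qed

lemma tendsto_vnorm_0:
  fixes v :: "nat \<Rightarrow> real vec"
  assumes "\<And>t. v t \<in> carrier_vec d" "\<And>i. i < d \<Longrightarrow> (\<lambda>t. c t * v t $ i) \<longlonglongrightarrow> 0" "\<And>t. c t \<ge> 0"
  shows "(\<lambda>t. c t * vnorm (v t)) \<longlonglongrightarrow> 0"
proof -
  have "(\<lambda>t. sqrt (\<Sum>i<d. (c t * v t $ i)\<^sup>2)) \<longlonglongrightarrow> sqrt (\<Sum>i<d. 0\<^sup>2)"
    using assms(2) by (intro tendsto_real_sqrt tendsto_sum tendsto_power) auto
  moreover have "sqrt (\<Sum>i<d. (c t * v t $ i)\<^sup>2) = c t * vnorm (v t)" for t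
    using assms(1)[of t] assms(3)[of t]
    by (simp add: vnorm_def power_mult_distrib sum_distrib_left[symmetric] real_sqrt_mult)
  ultimately show ?thesis by simp
qed

theorem theorem3p2:
  fixes M :: "'a measure" and F :: "nat \<Rightarrow> 'a measure"
    and N m :: nat and Md :: "nat \<Rightarrow> nat"
    and H :: "nat \<Rightarrow> real mat" and theta :: "real vec"
    and zeta :: "nat \<Rightarrow> nat \<Rightarrow> 'a \<Rightarrow> real vec"
    and R :: "nat \<Rightarrow> real mat"
    and L :: "nat \<Rightarrow> 'a \<Rightarrow> real mat"
    and a b tau2 eps1 :: real and gamma :: "nat \<Rightarrow> real"
    and x :: "nat \<Rightarrow> nat \<Rightarrow> 'a \<Rightarrow> real vec"
    and Q G :: "nat \<Rightarrow> nat \<Rightarrow> 'a \<Rightarrow> real mat"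
    and x0 Q0 Q1 G0 :: "nat \<Rightarrow> _"
    and y :: "nat \<Rightarrow> nat \<Rightarrow> 'a \<Rightarrow> real vec"
    and alpha beta :: "nat \<Rightarrow> real"
    and K :: "nat \<Rightarrow> nat \<Rightarrow> 'a \<Rightarrow> real mat"
    and Omega :: "nat \<Rightarrow> nat \<Rightarrow> 'a \<Rightarrow> nat set"
    and n :: nat and tau :: real
  assumes prob: "prob_space M"
    \<comment> \<open>filtration\<close>
    and filt_sub: "\<And>t. subalgebra M (F t)"
    and filt_mono: "\<And>s t. s \<le> t \<Longrightarrow> sets (F s) \<subseteq> sets (F t)"
    \<comment> \<open>observation model\<close>
    and theta_dim: "theta \<in> carrier_vec m"
    and H_dim: "\<And>n. n < N \<Longrightarrow> H n \<in> carrier_mat (Md n) m"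
    and zeta_dim: "\<And>n t \<omega>. n < N \<Longrightarrow> zeta n t \<omega> \<in> carrier_vec (Md n)"
    and y_def: "\<And>n t \<omega>. y n t \<omega> = H n *\<^sub>v theta + zeta n t \<omega>"
    and zeta_meas: "\<And>n t i. n < N \<Longrightarrow> i < Md n \<Longrightarrow>
          (\<lambda>\<omega>. zeta n t \<omega> $ i) \<in> borel_measurable (F (Suc t))"
    and zeta_indep: "\<And>n t. n < N \<Longrightarrow>
          prob_space.indep_set M (gen_sets M (\<lambda>i \<omega>. zeta n t \<omega> $ i) {..<Md n}) (sets (F t))"
    and zeta_ident: "\<And>n t. n < N \<Longrightarrow>
          joint_law M (\<lambda>i \<omega>. zeta n t \<omega> $ i) {..<Md n} = joint_law M (\<lambda>i \<omega>. zeta n 0 \<omega> $ i) {..<Md n}"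
    and zeta_mean: "\<And>n t i. n < N \<Longrightarrow> i < Md n \<Longrightarrow>
          integrable M (\<lambda>\<omega>. zeta n t \<omega> $ i) \<and> prob_space.expectation M (\<lambda>\<omega>. zeta n t \<omega> $ i) = 0"
    and zeta_sq: "\<And>n t i. n < N \<Longrightarrow> i < Md n \<Longrightarrow> integrable M (\<lambda>\<omega>. (zeta n t \<omega> $ i)^2)"
    and R_def: "\<And>n. R n = mat (Md n) (Md n) (\<lambda>(i,j).
          prob_space.expectation M (\<lambda>\<omega>. zeta n 0 \<omega> $ i * zeta n 0 \<omega> $ j))"
    and R_inv: "\<And>n. n < N \<Longrightarrow> invertible_mat (R n)"
    and uncorr: "\<And>n l s t i j. n < N \<Longrightarrow> l < N \<Longrightarrow> n \<noteq> l \<Longrightarrow> i < Md n \<Longrightarrow> j < Md l \<Longrightarrow>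
          prob_space.expectation M (\<lambda>\<omega>. zeta n s \<omega> $ i * zeta l t \<omega> $ j) = 0"
    \<comment> \<open>communication model\<close>
    and L_lap: "\<And>t \<omega>. is_graph_laplacian N (L t \<omega>)"
    and Omega_def: "\<And>n t \<omega>. Omega n t \<omega> = {l. l < N \<and> L t \<omega> $$ (n,l) = -1}"
    \<comment> \<open>(A.1)\<close>
    and A1: "invertible_mat (mat m m (\<lambda>(i,j). (1 / real N) *
          (\<Sum>n<N. ((H n)\<^sup>T * mat_inv (R n) * H n) $$ (i,j))))"
    \<comment> \<open>(A.2)\<close>
    and L_meas: "\<And>t i j. i < N \<Longrightarrow> j < N \<Longrightarrow>
          (\<lambda>\<omega>. L t \<omega> $$ (i,j)) \<in> borel_measurable (F (Suc t))"
    and L_indep: "\<And>t. prob_space.indep_set M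
          (gen_sets M (\<lambda>(i,j) \<omega>. L t \<omega> $$ (i,j)) ({..<N} \<times> {..<N})) (sets (F t))"
    and L_ident: "\<And>t. joint_law M (\<lambda>(i,j) \<omega>. L t \<omega> $$ (i,j)) ({..<N} \<times> {..<N})
                    = joint_law M (\<lambda>(i,j) \<omega>. L 0 \<omega> $$ (i,j)) ({..<N} \<times> {..<N})"
    and A2: "lambda2 (mat N N (\<lambda>(i,j). prob_space.expectation M (\<lambda>\<omega>. L 0 \<omega> $$ (i,j)))) > 0"
    \<comment> \<open>(A.3)\<close>
    and A3: "prob_space.indep_set M
          (gen_sets M (\<lambda>(t,i,j) \<omega>. L t \<omega> $$ (i,j)) (UNIV \<times> {..<N} \<times> {..<N}))
          (gen_sets M (\<lambda>(n,t,i) \<omega>. zeta n t \<omega> $ i) {(n,t,i). n < N \<and> i < Md n})"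
    \<comment> \<open>(A.4)\<close>
    and eps1_pos: "eps1 > 0"
    and A4: "\<And>n t. n < N \<Longrightarrow> integrable M (\<lambda>\<omega>. vnorm (zeta n t \<omega>) powr (2 + eps1))"
    \<comment> \<open>(A.5) with tau1 = 1 and a \<ge> 1\<close>
    and a_ge: "a \<ge> 1" and b_pos: "b > 0"
    and tau2_pos: "0 < tau2" and tau2_le: "tau2 \<le> 1"
    and A5: "1 > tau2 + 1 / (2 + eps1) + 1 / 2"
    \<comment> \<open>weights\<close>
    and alpha_def: "\<And>t. alpha t = a / (real t + 1) powr 1"
    and beta_def: "\<And>t. beta t = b / (real t + 1) powr tau2"
    and gamma_pos: "\<And>t. gamma t > 0" and gamma_lim: "gamma \<longlonglongrightarrow> 0"
    \<comment> \<open>algorithm\<close>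
    and x_init: "\<And>n \<omega>. n < N \<Longrightarrow> x n 0 \<omega> = x0 n" and x0_dim: "\<And>n. n < N \<Longrightarrow> x0 n \<in> carrier_vec m"
    and K_def: "\<And>n t \<omega>. K n t \<omega> = mat_inv (G n t \<omega> + gamma t \<cdot>\<^sub>m 1\<^sub>m m) * (H n)\<^sup>T
          * mat_inv (Q n t \<omega> + gamma t \<cdot>\<^sub>m 1\<^sub>m (Md n))"
    and x_step: "\<And>n t \<omega>. n < N \<Longrightarrow> x n (Suc t) \<omega> =
          x n t \<omega> - beta t \<cdot>\<^sub>v vec m (\<lambda>i. \<Sum>l\<in>Omega n t \<omega>. (x n t \<omega> $ i - x l t \<omega> $ i))
          + alpha t \<cdot>\<^sub>v (K n t \<omega> *\<^sub>v (y n t \<omega> - H n *\<^sub>v x n t \<omega>))"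
    and Q_init0: "\<And>n \<omega>. n < N \<Longrightarrow> Q n 0 \<omega> = Q0 n" and Q0_psd: "\<And>n. n < N \<Longrightarrow> psd_mat (Md n) (Q0 n)"
    and Q_init1: "\<And>n \<omega>. n < N \<Longrightarrow> Q n 1 \<omega> = Q1 n" and Q1_psd: "\<And>n. n < N \<Longrightarrow> psd_mat (Md n) (Q1 n)"
    and Q_step: "\<And>n t \<omega>. n < N \<Longrightarrow> t \<ge> 1 \<Longrightarrow> Q n (Suc t) \<omega> = mat (Md n) (Md n) (\<lambda>(i,j).
          (1 / real t) * (\<Sum>s\<le>t. y n s \<omega> $ i * y n s \<omega> $ j)
          - ((1 / real t) * (\<Sum>s<t. y n s \<omega> $ i)) * ((1 / real t) * (\<Sum>s<t. y n s \<omega> $ j)))"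
    and G_init: "\<And>n \<omega>. n < N \<Longrightarrow> G n 0 \<omega> = G0 n" and G0_psd: "\<And>n. n < N \<Longrightarrow> psd_mat m (G0 n)"
    and G_step: "\<And>n t \<omega>. n < N \<Longrightarrow> G n (Suc t) \<omega> =
          G n t \<omega> - beta t \<cdot>\<^sub>m mat m m (\<lambda>(i,j). \<Sum>l\<in>Omega n t \<omega>. (G n t \<omega> $$ (i,j) - G l t \<omega> $$ (i,j)))
          + alpha t \<cdot>\<^sub>m ((H n)\<^sup>T * mat_inv (Q n t \<omega> + gamma t \<cdot>\<^sub>m 1\<^sub>m (Md n)) * H n - G n t \<omega>)"
    \<comment> \<open>conclusion for agent n and exponent tau\<close>
    and n_lt: "n < N" and tau_nonneg: "0 \<le> tau" and tau_lt: "tau < 1 / 2"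
  shows "AE \<omega> in M. ((\<lambda>t. (real t + 1) powr tau * vnorm (x n t \<omega> - theta)) \<longlongrightarrow> 0) sequentially"
proof -
  interpret prob_space M by (rule prob)
  have N0: "N > 0" using n_lt by simp
  have alpha: "alpha t = a / (real t + 1)" for t by (simp add: alpha_def)

  \<comment> \<open>Link weights and the spectral gap of their mean\<close>
  define w where "w t \<omega> n l = (of_bool (L t \<omega> $$ (n,l) = -1) :: real)" for t \<omega> n l
  have w_sym: "w t \<omega> n l = w t \<omega> l n" if "n < N" "l < N" for t \<omega> n l
    using laplacian_index(2)[OF L_lap that] by (simp add: w_def)
  have w01: "0 \<le> w t \<omega> n l \<and> w t \<omega> n l \<le> 1" for t \<omega> n l by (simp add: w_def)
  have Omega_sum: "(\<Sum>l\<in>Omega n t \<omega>. f l) = (\<Sum>l<N. w t \<omega> n l * f l)" for n t \<omega> and f :: "nat \<Rightarrow> real"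
    unfolding Omega_def w_def by (rule sum.mono_neutral_cong_left) auto
  have w_meas: "(\<lambda>\<omega>. w t \<omega> n l) \<in> borel_measurable (F (Suc t))" if "n < N" "l < N" for t n l
    unfolding w_def using that by (intro borel_measurable_of_bool_eq L_meas)
  have L_M: "(\<lambda>\<omega>. L t \<omega> $$ (n,l)) \<in> borel_measurable M" if "n < N" "l < N" for t n l
    by (rule measurable_from_subalg[OF filt_sub L_meas[OF that]])
  have w_ind: "indep_var borel (\<lambda>\<omega>. w t \<omega> n l) borel U" if nl: "n < N" "l < N" and U: "U \<in> borel_measurable (F t)"
    for t n l and U :: "'a \<Rightarrow> real"
  proof (rule indep_varI_gen_sets[OF L_indep filt_sub U])
    show "(\<lambda>\<omega>. w t \<omega> n l) \<in> borel_measurable M"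
      by (rule measurable_from_subalg[OF filt_sub w_meas[OF nl]])
    have "(\<lambda>(i,j) \<omega>. L t \<omega> $$ (i,j)) (n,l) \<in>
        borel_measurable (gen_algebra M (\<lambda>(i,j) \<omega>. L t \<omega> $$ (i,j)) ({..<N} \<times> {..<N}))"
      using nl by (intro borel_measurable_gen_algebra) auto
    then show "(\<lambda>\<omega>. w t \<omega> n l) \<in> borel_measurable (gen_algebra M (\<lambda>(i,j) \<omega>. L t \<omega> $$ (i,j)) ({..<N} \<times> {..<N}))"
      unfolding w_def by (intro borel_measurable_of_bool_eq) simp
  qed
  define wb where "wb n l = expectation (\<lambda>\<omega>. w 0 \<omega> n l)" for n l
  have w_mean: "expectation (\<lambda>\<omega>. w t \<omega> n l) = wb n l" if nl: "n < N" "l < N" for t n l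
  proof -
    have f: "(\<lambda>v. of_bool (v (n,l) = (-1 :: real)) :: real) \<in> borel_measurable (Pi\<^sub>M ({..<N} \<times> {..<N}) (\<lambda>_. borel))"
      using nl by (intro borel_measurable_of_bool_eq measurable_component_singleton) auto
    show ?thesis
      using joint_law_expectation[OF L_ident _ _ f, of t] L_M nl by (auto simp: wb_def w_def)
  qed
  have w_int: "integrable M (\<lambda>\<omega>. w 0 \<omega> n l)" if "n < N" "l < N" for n l
    by (rule integrable_const_bound[where B = 1])
       (use w01 that measurable_from_subalg[OF filt_sub w_meas] in auto)
  \<comment> \<open>By linearity the mean Laplacian is the Laplacian of the mean weights
    \<open>wb\<close>, so the eigenvalue assumption yields the gap inequality for
    \<open>wb\<close>.\<close>
  obtain c where c: "c > 0" "\<And>u. (\<Sum>n<N. u n) = 0 \<Longrightarrow> c * (\<Sum>n<N. (u n)\<^sup>2) \<le> (\<Sum>n<N. \<Sum>l<N. wb n l * (u n - u l)\<^sup>2)"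
  proof -
    have wb0: "wb r r = 0" if "r < N" for r
      using laplacian_index(3)[OF L_lap that that] by (simp add: wb_def w_def)
    have EL: "expectation (\<lambda>\<omega>. L 0 \<omega> $$ (r,k)) = (if r = k then \<Sum>j<N. wb r j else - wb r k)" if "r < N" "k < N" for r k
    proof -
      have "L 0 \<omega> $$ (r,k) = (if r = k then \<Sum>j<N. w 0 \<omega> r j else - w 0 \<omega> r k)" for \<omega>
        unfolding w_def by (rule laplacian_index(1)[OF L_lap that])
      then have "expectation (\<lambda>\<omega>. L 0 \<omega> $$ (r,k)) = expectation (\<lambda>\<omega>. if r = k then \<Sum>j<N. w 0 \<omega> r j else - w 0 \<omega> r k)"
        by presburger
      also have "\<dots> = (if r = k then \<Sum>j<N. wb r j else - wb r k)"
        using w_int that by (simp add: wb_def Bochner_Integration.integral_sum)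
      finally show ?thesis .
    qed
    have "\<exists>c>0. \<forall>u. (\<Sum>n<N. u n) = 0 \<longrightarrow> c * (\<Sum>n<N. (u n)\<^sup>2) \<le> (\<Sum>n<N. \<Sum>l<N. wb n l * (u n - u l)\<^sup>2)"
    proof (rule laplacian_spectral_gap[OF _ _ _ _ A2 N0])
      show "0 \<le> wb n l" for n l unfolding wb_def by (rule integral_nonneg_AE) (simp add: w_def)
      show "wb n l = wb l n" if "n < N" "l < N" for n l unfolding wb_def using w_sym[OF that] by simp
      show "(\<Sum>k<N. Matrix.mat N N (\<lambda>(i,j). expectation (\<lambda>\<omega>. L 0 \<omega> $$ (i,j))) $$ (r,k) * u k) = (\<Sum>k<N. wb r k * (u r - u k))"
        if "r < N" for r u
        using laplacian_apply[of r N wb u] wb0 that by (simp add: EL)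
    qed simp
    then show thesis using that by blast
  qed

  \<comment> \<open>Exponents and kernel bounds\<close>
  define \<delta> where "\<delta> = (1 / 2 - tau2 - 1 / (2 + eps1)) / 3"
  \<comment> \<open>\<open>\<delta>\<close> is a third of the slack in the step size condition: one
    share lifts \<open>p\<close> above \<open>1 / (2 + eps1)\<close>, one lifts \<open>q\<close>
    above \<open>tau2\<close>, and the last keeps \<open>p + q\<close> below
    \<open>1 / 2\<close>.\<close>
  define p where "p = 1 / (2 + eps1) + \<delta>"
  define q where "q = tau2 + \<delta>"
  have \<delta>: "\<delta> > 0" using A5 by (simp add: \<delta>_def)
  have pq: "0 \<le> p" "0 \<le> q" "p + q < 1 / 2" "tau2 < q"
  proof -
    have "3 * \<delta> = 1 / 2 - tau2 - 1 / (2 + eps1)" by (simp add: \<delta>_def)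
    then show "p + q < 1 / 2" unfolding p_def q_def using \<delta> by linarith
  qed (use \<delta> eps1_pos tau2_pos in \<open>auto simp: p_def q_def\<close>)
  have p_mom: "1 < p * (2 + eps1)" using \<delta> eps1_pos by (simp add: p_def distrib_right)
  have beta_pos: "0 \<le> beta t" for t using b_pos by (simp add: beta_def)
  obtain T0 where T0: "\<And>t. t \<ge> T0 \<Longrightarrow> beta t * real N \<le> 1 / 2"
  proof -
    have "(\<lambda>t::nat. b / (real t + 1) powr tau2 * real N) \<longlonglongrightarrow> 0" using tau2_pos by real_asymp
    then have "\<forall>\<^sub>F t in sequentially. beta t * real N < 1 / 2"
      unfolding beta_def[symmetric] by (rule order_tendstoD(2)) simp
    then show thesis using that unfolding eventually_sequentially by (meson less_imp_le)
  qed
  have ker1: "\<bar>consensus_kernel N beta (\<lambda>t. w t \<omega>) s k n l - 1 / N\<bar> \<le> 1" if "s \<ge> T0" "n < N" for \<omega> s k n l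
    using that w01 T0 beta_pos by (intro consensus_kernel_dist) auto
  have AE_ker: "AE \<omega> in M. \<exists>T'. \<forall>s k n l. T0 \<le> s \<longrightarrow> n < N \<longrightarrow> l < N \<longrightarrow> T' \<le> s + k \<longrightarrow> real (s + k) powr q \<le> real k \<longrightarrow>
        \<bar>consensus_kernel N beta (\<lambda>t. w t \<omega>) s k n l - 1 / N\<bar> \<le> 1 / (real (s + k))\<^sup>2"
    by (rule AE_consensus_kernel_decay[of F N w wb c beta b tau2])
       (use filt_sub filt_mono w_meas w_ind w_sym w01 w_mean c beta_def b_pos tau2_pos pq(4) T0 N0 in auto)

  \<comment> \<open>Almost sure properties of the noise\<close>
  have zeta_M: "(\<lambda>\<omega>. zeta n t \<omega> $ i) \<in> borel_measurable M" if "n < N" "i < Md n" for n t i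
    by (rule measurable_from_subalg[OF filt_sub zeta_meas[OF that]])
  have zeta_mom: "integrable M (\<lambda>\<omega>. \<bar>zeta n t \<omega> $ i\<bar> powr (2 + eps1))" if ni: "n < N" "i < Md n" for n t i
  proof (rule Bochner_Integration.integrable_bound[OF A4[OF ni(1), of t]])
    show "(\<lambda>\<omega>. \<bar>zeta n t \<omega> $ i\<bar> powr (2 + eps1)) \<in> borel_measurable M"
      using zeta_M[OF ni] by measurable
    show "AE \<omega> in M. norm (\<bar>zeta n t \<omega> $ i\<bar> powr (2 + eps1)) \<le> norm (vnorm (zeta n t \<omega>) powr (2 + eps1))"
      using vnorm_index_le[OF zeta_dim[OF ni(1)] ni(2)] eps1_pos by (intro AE_I2) (auto intro!: powr_mono2)
  qed
  note noise_facts = filt_sub filt_mono zeta_meas zeta_indep zeta_ident conjunct2[OF zeta_mean] zeta_sq eps1_pos zeta_mom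
  have AE_avg: "AE \<omega> in M. \<forall>n i. n < N \<longrightarrow> i < Md n \<longrightarrow> (\<lambda>t. (\<Sum>s<t. zeta n s \<omega> $ i) / real t) \<longlonglongrightarrow> 0"
    unfolding AE_all_countable
  proof (intro allI AE_impI)
    fix n i assume n: "n < N" and i: "i < Md n"
    show "AE \<omega> in M. (\<lambda>t. (\<Sum>s<t. zeta n s \<omega> $ i) / real t) \<longlonglongrightarrow> 0"
      by (rule AE_noise_average[of F "Md n" "\<lambda>t i \<omega>. zeta n t \<omega> $ i" eps1]) (rule noise_facts n i | assumption)+
  qed
  have AE_prod: "AE \<omega> in M. \<forall>n i j. n < N \<longrightarrow> i < Md n \<longrightarrow> j < Md n \<longrightarrow>
      (\<lambda>t. (\<Sum>s<t. zeta n s \<omega> $ i * zeta n s \<omega> $ j) / real t) \<longlonglongrightarrow> R n $$ (i,j)"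
    unfolding AE_all_countable
  proof (intro allI AE_impI)
    fix n i j assume n: "n < N" and ij: "i < Md n" "j < Md n"
    have "AE \<omega> in M. (\<lambda>t. (\<Sum>s<t. zeta n s \<omega> $ i * zeta n s \<omega> $ j) / real t)
        \<longlonglongrightarrow> expectation (\<lambda>\<omega>. zeta n 0 \<omega> $ i * zeta n 0 \<omega> $ j)"
      by (rule AE_noise_product_average[of F "Md n" "\<lambda>t i \<omega>. zeta n t \<omega> $ i" eps1]) (rule noise_facts n ij | assumption)+
    then show "AE \<omega> in M. (\<lambda>t. (\<Sum>s<t. zeta n s \<omega> $ i * zeta n s \<omega> $ j) / real t) \<longlonglongrightarrow> R n $$ (i,j)"
      using ij by (simp add: R_def)
  qed
  have AE_growth: "AE \<omega> in M. \<forall>n i. n < N \<longrightarrow> i < Md n \<longrightarrow> (\<forall>\<^sub>F s in sequentially. \<bar>zeta n s \<omega> $ i\<bar> \<le> (real s + 1) powr p)"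
    unfolding AE_all_countable
  proof (intro allI AE_impI)
    fix n i assume n: "n < N" and i: "i < Md n"
    show "AE \<omega> in M. \<forall>\<^sub>F s in sequentially. \<bar>zeta n s \<omega> $ i\<bar> \<le> (real s + 1) powr p"
      by (rule AE_noise_growth[of F "Md n" "\<lambda>t i \<omega>. zeta n t \<omega> $ i" eps1]) (rule noise_facts n i p_mom | assumption)+
  qed

  \<comment> \<open>Regularised matrices and their adaptedness\<close>
  have Q_car: "Q n t \<omega> \<in> carrier_mat (Md n) (Md n)" if "n < N" for n t \<omega>
  proof (cases "t \<le> 1")
    case True
    then have "t = 0 \<or> t = 1" by auto
    then show ?thesis using Q_init0 Q_init1 Q0_psd Q1_psd that by (auto simp: psd_mat_def)
  next
    case False
    then obtain s where "t = Suc s" "s \<ge> 1" by (cases t) auto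
    then show ?thesis using Q_step[OF that, of s \<omega>] by simp
  qed
  \<comment> \<open>Matrix sums and differences take the shape of their right operand, here
    \<open>G n t\<close> itself, so a junk inverse in the innovation cannot spoil the shape.\<close>
  have G_car: "G n t \<omega> \<in> carrier_mat m m" if "n < N" for n t \<omega>
  proof (induction t)
    case 0 then show ?case using G_init G0_psd that by (auto simp: psd_mat_def)
  next
    case (Suc t) then show ?case unfolding G_step[OF that] by auto
  qed
  define QQ where "QQ n t \<omega> = Q n t \<omega> + gamma t \<cdot>\<^sub>m 1\<^sub>m (Md n)" for n t \<omega>
  define GG where "GG n t \<omega> = G n t \<omega> + gamma t \<cdot>\<^sub>m 1\<^sub>m m" for n t \<omega>
  have QQ: "QQ n t \<omega> \<in> carrier_mat (Md n) (Md n)" for n t \<omega> by (simp add: QQ_def)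
  have GG: "GG n t \<omega> \<in> carrier_mat m m" for n t \<omega> by (simp add: GG_def)
  have QQ_index: "QQ n t \<omega> $$ (i,j) = Q n t \<omega> $$ (i,j) + gamma t * of_bool (i = j)" if "n < N" "i < Md n" "j < Md n" for n t \<omega> i j
    using that by (simp add: QQ_def)
  have GG_index: "GG n t \<omega> $$ (i,j) = G n t \<omega> $$ (i,j) + gamma t * of_bool (i = j)" if "n < N" "i < m" "j < m" for n t \<omega> i j
    using that by (simp add: GG_def)
  define u where "u n t \<omega> i j = ((H n)\<^sup>T * mat_inv (QQ n t \<omega>) * H n) $$ (i,j)" for n t \<omega> i j
  have G_rec: "G n (Suc t) \<omega> $$ (i,j) = consensus_step N (beta t) (w t \<omega>) (\<lambda>n. G n t \<omega> $$ (i,j)) n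
      + a / (real t + 1) * (u n t \<omega> i j - G n t \<omega> $$ (i,j))" if n: "n < N" and ij: "i < m" "j < m" for n t \<omega> i j
    using G_car[OF n, of t \<omega>] ij H_dim[OF n]
    by (simp add: G_step[OF n] consensus_step_def Omega_sum alpha u_def QQ_def)

  have up: "f \<in> borel_measurable (F s) \<Longrightarrow> s \<le> t \<Longrightarrow> f \<in> borel_measurable (F t)" for f :: "'a \<Rightarrow> real" and s t
    by (rule filtration_measurable_mono[of F]) (use filt_sub filt_mono in auto)
  have y_meas: "(\<lambda>\<omega>. y n s \<omega> $ i) \<in> borel_measurable (F t)" if "n < N" "i < Md n" "s < t" for n s i t
  proof -
    have "y n s \<omega> $ i = (H n *\<^sub>v theta) $ i + zeta n s \<omega> $ i" for \<omega>
      using zeta_dim[OF that(1), of s \<omega>] that by (simp add: y_def)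
    moreover have "(\<lambda>\<omega>. zeta n s \<omega> $ i) \<in> borel_measurable (F t)"
      using that by (intro up[OF zeta_meas]) auto
    ultimately show ?thesis by simp
  qed
  have Q_meas: "(\<lambda>\<omega>. Q n t \<omega> $$ (i,j)) \<in> borel_measurable (F t)" if n: "n < N" and ij: "i < Md n" "j < Md n" for n t i j
  proof (cases "t \<le> 1")
    case True
    then have "t = 0 \<or> t = 1" by auto
    then show ?thesis using Q_init0[OF n] Q_init1[OF n] by auto
  next
    case False
    then obtain s where s: "t = Suc s" "s \<ge> 1" by (cases t) auto
    have "(\<lambda>\<omega>. (1 / real s) * (\<Sum>r\<le>s. y n r \<omega> $ i * y n r \<omega> $ j)
          - ((1 / real s) * (\<Sum>r<s. y n r \<omega> $ i)) * ((1 / real s) * (\<Sum>r<s. y n r \<omega> $ j))) \<in> borel_measurable (F t)"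
      using n ij s by (intro borel_measurable_diff borel_measurable_times borel_measurable_sum borel_measurable_const y_meas) auto
    then show ?thesis using s ij by (simp add: Q_step[OF n s(2)])
  qed
  have QQ_meas: "(\<lambda>\<omega>. QQ n t \<omega> $$ (i,j)) \<in> borel_measurable (F t)" if "n < N" "i < Md n" "j < Md n" for n t i j
    using Q_meas[OF that] by (simp add: QQ_index[OF that])
  have u_meas: "(\<lambda>\<omega>. u n t \<omega> i j) \<in> borel_measurable (F t)" if n: "n < N" and ij: "i < m" "j < m" for n t i j
    unfolding u_def
    by (rule borel_measurable_mat_inv_functional[OF QQ QQ_meas[OF n] congruence_index[OF _ H_dim[OF n] ij]])
  have G_meas: "(\<lambda>\<omega>. G n t \<omega> $$ (i,j)) \<in> borel_measurable (F t)" if "n < N" and ij: "i < m" "j < m" for n t i j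
    using that(1)
  proof (induction t arbitrary: n)
    case 0 then show ?case using G_init by simp
  next
    case (Suc t)
    have g: "(\<lambda>\<omega>. G n t \<omega> $$ (i,j)) \<in> borel_measurable (F (Suc t))" if "n < N" for n
      by (rule up[OF Suc.IH[OF that]]) simp
    have "(\<lambda>\<omega>. u n t \<omega> i j) \<in> borel_measurable (F (Suc t))"
      by (rule up[OF u_meas[OF Suc.prems ij]]) simp
    then show ?case
      unfolding G_rec[OF Suc.prems ij] consensus_step_def using Suc.prems
      by (intro borel_measurable_add borel_measurable_diff borel_measurable_times borel_measurable_sum
          borel_measurable_const g w_meas) auto
  qed
  have GG_meas: "(\<lambda>\<omega>. GG n t \<omega> $$ (i,j)) \<in> borel_measurable (F t)" if "n < N" "i < m" "j < m" for n t i j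
    using G_meas[OF that] by (simp add: GG_index[OF that])

  \<comment> \<open>Limiting gains and their truncation\<close>
  define Sc where "Sc = Matrix.mat m m (\<lambda>(i,j). (1 / real N) * (\<Sum>n<N. ((H n)\<^sup>T * mat_inv (R n) * H n) $$ (i,j)))"
  have Sc: "Sc \<in> carrier_mat m m" by (simp add: Sc_def)
  have det_Sc: "det Sc \<noteq> 0" using invertible_mat_det_nonzero[OF Sc] A1 by (simp add: Sc_def)
  have R_car: "R n \<in> carrier_mat (Md n) (Md n)" for n by (simp add: R_def)
  have det_R: "det (R n) \<noteq> 0" if "n < N" for n by (rule invertible_mat_det_nonzero[OF R_car R_inv[OF that]])
  \<comment> \<open>These are the entries of the gain as soon as both inverses exist. Earlier they
    are still measurable, entry by entry, so they serve as predictable coefficients at all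
    times.\<close>
  define kk where "kk n t \<omega> i k = (\<Sum>p<m. \<Sum>r<Md n. mat_inv (GG n t \<omega>) $$ (i,p) * H n $$ (r,p) * mat_inv (QQ n t \<omega>) $$ (r,k))"
    for n t \<omega> i k
  define Kinf where "Kinf n i k = (\<Sum>p<m. \<Sum>r<Md n. mat_inv Sc $$ (i,p) * H n $$ (r,p) * mat_inv (R n) $$ (r,k))" for n i k
  \<comment> \<open>The sum bound needs a deterministic bound on the coefficients, whereas the gains
    are bounded only path by path. Cutting off at the deterministic limit plus one supplies it and
    almost surely changes only finitely many terms.\<close>
  define ck where "ck n i k t \<omega> = (if \<bar>kk n t \<omega> i k\<bar> \<le> \<bar>Kinf n i k\<bar> + 1 then kk n t \<omega> i k else 0)" for n i k t \<omega>
  have kk_meas: "(\<lambda>\<omega>. kk n t \<omega> i k) \<in> borel_measurable (F t)" if "n < N" "i < m" "k < Md n" for n t i k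
    unfolding kk_def using that
    by (intro borel_measurable_sum borel_measurable_times borel_measurable_const
        borel_measurable_mat_inv_index[OF GG GG_meas] borel_measurable_mat_inv_index[OF QQ QQ_meas]) auto
  have ck_meas: "ck n i k t \<in> borel_measurable (F t)" if "n < N" "i < m" "k < Md n" for n t i k
  proof -
    have [measurable]: "(\<lambda>\<omega>. kk n t \<omega> i k) \<in> borel_measurable (F t)" by (rule kk_meas[OF that])
    show ?thesis unfolding ck_def by measurable
  qed
  \<comment> \<open>The midpoint of \<open>1 / 2\<close> and \<open>1 - tau\<close>.\<close>
  define r where "r = 3 / 4 - tau / 2"
  have r: "1 / 2 < r" "tau + r < 1" using tau_lt by (auto simp: r_def)
  have AE_mart: "AE \<omega> in M. \<forall>n i k. n < N \<longrightarrow> i < m \<longrightarrow> k < Md n \<longrightarrow>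
      (\<exists>C\<ge>0. \<forall>t. \<bar>\<Sum>s<t. ck n i k s \<omega> * zeta n s \<omega> $ k\<bar> \<le> C * (real t + 1) powr r)"
    unfolding AE_all_countable
  proof (intro allI AE_impI)
    fix n i k assume n: "n < N" and i: "i < m" and k: "k < Md n"
    have bd: "\<bar>ck n i k s \<omega>\<bar> \<le> \<bar>Kinf n i k\<bar> + 1" for s \<omega> by (simp add: ck_def)
    show "AE \<omega> in M. \<exists>C\<ge>0. \<forall>t. \<bar>\<Sum>s<t. ck n i k s \<omega> * zeta n s \<omega> $ k\<bar> \<le> C * (real t + 1) powr r"
      by (rule AE_noise_predictable_sum[of F "Md n" "\<lambda>t i \<omega>. zeta n t \<omega> $ i" eps1, where B = "\<bar>Kinf n i k\<bar> + 1"])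
         (rule noise_facts n k ck_meas[OF n i k] bd r(1) | assumption)+
  qed

  \<comment> \<open>Convergence along a fixed path\<close>
  show ?thesis
    using AE_ker AE_avg AE_prod AE_growth AE_mart
  proof eventually_elim
    case (elim \<omega>)
    note avg = elim(2) and prd = elim(3) and growth = elim(4) and mart = elim(5)
    obtain T' where ker2: "\<And>s k n l. T0 \<le> s \<Longrightarrow> n < N \<Longrightarrow> l < N \<Longrightarrow> T' \<le> s + k \<Longrightarrow> real (s + k) powr q \<le> real k \<Longrightarrow>
        \<bar>consensus_kernel N beta (\<lambda>t. w t \<omega>) s k n l - 1 / N\<bar> \<le> 1 / (real (s + k))\<^sup>2"
      using elim(1) by blast
    have Q_lim: "(\<lambda>t. Q n t \<omega> $$ (i,j)) \<longlonglongrightarrow> R n $$ (i,j)" if n: "n < N" and ij: "i < Md n" "j < Md n" for n i j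
    proof -
      let ?h = "\<lambda>i. (H n *\<^sub>v theta) $ i"
      have yi: "y n s \<omega> $ i = ?h i + zeta n s \<omega> $ i" if "i < Md n" for s i
        using zeta_dim[OF n, of s \<omega>] that by (simp add: y_def)
      have "(\<lambda>t. (1 / real t) * (\<Sum>s\<le>t. (?h i + zeta n s \<omega> $ i) * (?h j + zeta n s \<omega> $ j))
          - ((1 / real t) * (\<Sum>s<t. ?h i + zeta n s \<omega> $ i)) * ((1 / real t) * (\<Sum>s<t. ?h j + zeta n s \<omega> $ j))) \<longlonglongrightarrow> R n $$ (i,j)"
        using avg prd n ij by (intro sample_covariance_tendsto) auto
      moreover have "\<forall>\<^sub>F t in sequentially. (1 / real t) * (\<Sum>s\<le>t. (?h i + zeta n s \<omega> $ i) * (?h j + zeta n s \<omega> $ j))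
          - ((1 / real t) * (\<Sum>s<t. ?h i + zeta n s \<omega> $ i)) * ((1 / real t) * (\<Sum>s<t. ?h j + zeta n s \<omega> $ j)) = Q n (Suc t) \<omega> $$ (i,j)"
        using eventually_ge_at_top[of 1]
        by eventually_elim (simp only: Q_step[OF n] index_mat ij yi[OF ij(1)] yi[OF ij(2)] split)
      ultimately have "(\<lambda>t. Q n (Suc t) \<omega> $$ (i,j)) \<longlonglongrightarrow> R n $$ (i,j)" by (rule Lim_transform_eventually)
      then show ?thesis by (rule LIMSEQ_imp_Suc)
    qed
    have QQ_lim: "(\<lambda>t. QQ n t \<omega> $$ (i,j)) \<longlonglongrightarrow> R n $$ (i,j)" if "n < N" "i < Md n" "j < Md n" for n i j
      unfolding QQ_index[OF that] using tendsto_add[OF Q_lim[OF that] tendsto_mult_left_zero[OF gamma_lim]] by simp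
    have QQ_det: "\<forall>\<^sub>F t in sequentially. det (QQ n t \<omega>) \<noteq> 0" if "n < N" for n
      by (rule tendsto_mat_inv(1)[OF QQ R_car det_R[OF that] QQ_lim[OF that]])
    have QQ_inv: "(\<lambda>t. mat_inv (QQ n t \<omega>) $$ (i,j)) \<longlonglongrightarrow> mat_inv (R n) $$ (i,j)" if "n < N" "i < Md n" "j < Md n" for n i j
      by (rule tendsto_mat_inv(2)[OF QQ R_car det_R[OF that(1)] QQ_lim[OF that(1)] that(2,3)])
    define S where "S n i j = ((H n)\<^sup>T * mat_inv (R n) * H n) $$ (i,j)" for n i j
    have Sc_index: "Sc $$ (i,j) = (\<Sum>n<N. S n i j) / N" if "i < m" "j < m" for i j
      using that by (simp add: Sc_def S_def)
    have u_lim: "(\<lambda>t. u n t \<omega> i j) \<longlonglongrightarrow> S n i j" if n: "n < N" and ij: "i < m" "j < m" for n i j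
    proof -
      have "(\<lambda>t. \<Sum>k<Md n. \<Sum>l<Md n. (H n $$ (k,i) * H n $$ (l,j)) * mat_inv (QQ n t \<omega>) $$ (k,l)) \<longlonglongrightarrow> S n i j"
        unfolding S_def congruence_index[OF mat_inv_inverse(2)[OF R_car det_R[OF n]] H_dim[OF n] ij]
        by (intro tendsto_sum tendsto_mult tendsto_const QQ_inv n) auto
      moreover have "\<forall>\<^sub>F t in sequentially. (\<Sum>k<Md n. \<Sum>l<Md n. (H n $$ (k,i) * H n $$ (l,j)) * mat_inv (QQ n t \<omega>) $$ (k,l)) = u n t \<omega> i j"
        using QQ_det[OF n]
      proof eventually_elim
        case (elim t)
        show ?case unfolding u_def congruence_index[OF mat_inv_inverse(2)[OF QQ elim] H_dim[OF n] ij] ..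
      qed
      ultimately show ?thesis by (rule Lim_transform_eventually)
    qed

    have G_lim: "(\<lambda>t. G n t \<omega> $$ (i,j)) \<longlonglongrightarrow> Sc $$ (i,j)" if n: "n < N" and ij: "i < m" "j < m" for n i j
    proof -
      \<comment> \<open>Each entry of \<open>G\<close> is a one-dimensional problem with feedback 1
        and rate exponent 0, whose inputs are convergent instead of noisy. Their network mean tends
        to zero because \<open>Sc\<close> is the mean of the limits \<open>S n\<close>. The index
        \<open>k\<close> is the dummy coordinate of that problem.\<close>
      define \<xi> where "\<xi> t n k = u n t \<omega> i j - Sc $$ (i,j)" for t n and k :: nat
      have \<xi>_lim: "(\<lambda>t. \<xi> t n k) \<longlonglongrightarrow> S n i j - Sc $$ (i,j)" if "n < N" for n k
        unfolding \<xi>_def using u_lim[OF that ij] by (intro tendsto_diff tendsto_const)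
      obtain B where B: "B \<ge> 0" "\<And>n t. n < N \<Longrightarrow> \<bar>\<xi> t n 0\<bar> \<le> B"
      proof -
        have "\<exists>B\<ge>0. \<forall>n\<in>{..<N}. \<forall>t. \<bar>\<xi> t n 0\<bar> \<le> B"
          by (rule convergent_uniform_bound[OF _ \<xi>_lim]) auto
        then show thesis using that by blast
      qed
      have "(\<lambda>t. (\<Sum>n<N. \<xi> t n 0) / N) \<longlonglongrightarrow> (\<Sum>n<N. S n i j - Sc $$ (i,j)) / N"
        using \<xi>_lim N0 by (intro tendsto_divide tendsto_sum tendsto_const) auto
      also have "(\<Sum>n<N. S n i j - Sc $$ (i,j)) / N = 0"
        using N0 by (simp add: sum_subtractf Sc_index[OF ij] diff_divide_distrib)
      finally have \<xi>0: "(\<lambda>t. (\<Sum>n<N. \<xi> t n 0) / N) \<longlonglongrightarrow> 0" .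
      have "(\<lambda>t. (real t + 1) powr 0 * (G n t \<omega> $$ (i,j) - Sc $$ (i,j))) \<longlonglongrightarrow> 0"
      proof (rule consensus_innovation_tendsto_0[where e = "\<lambda>t n k. G n t \<omega> $$ (i,j) - Sc $$ (i,j)" and d = 1 and i = 0
            and \<xi> = \<xi> and C = "\<lambda>_ _ _ _. 1" and T = T0 and T' = T' and \<beta> = beta and w = "\<lambda>t. w t \<omega>"
            and a = a and B = "B + 1" and p = p and q = q])
        fix t n and k :: nat assume "T0 \<le> t" "n < N"
        show "G n (Suc t) \<omega> $$ (i,j) - Sc $$ (i,j) = consensus_step N (beta t) (w t \<omega>) (\<lambda>n. G n t \<omega> $$ (i,j) - Sc $$ (i,j)) n
           + a / (real t + 1) * (\<xi> t n k - (\<Sum>l<(1::nat). 1 * (G n t \<omega> $$ (i,j) - Sc $$ (i,j))))"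
          unfolding G_rec[OF \<open>n < N\<close> ij] by (simp add: consensus_step_def \<xi>_def)
      next
        fix t n and k :: nat assume "T0 \<le> t" "n < N" "k < 1"
        have "\<bar>\<xi> t n k\<bar> \<le> (B + 1) * 1" using B(2)[OF \<open>n < N\<close>, of t] \<open>k < 1\<close> by simp
        also have "\<dots> \<le> (B + 1) * (real t + 1) powr p"
          using pq B by (intro mult_left_mono ge_one_powr_ge_zero) auto
        finally show "\<bar>\<xi> t n k\<bar> \<le> (B + 1) * (real t + 1) powr p" .
      next
        fix k :: nat assume "k < 1"
        then have "(\<lambda>t. (\<Sum>s<t. (\<Sum>n<N. \<xi> s n k) / N) / real t) \<longlonglongrightarrow> 0"
          using cesaro_mean_tendsto_0[OF \<xi>0] by simp
        then show "(\<lambda>t. (real t + 1) powr 0 * ((\<Sum>s<t. (\<Sum>n<N. \<xi> s n k) / N) / real t)) \<longlonglongrightarrow> 0"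
          by simp
      qed (use w_sym ker1 ker2 B a_ge N0 pq n in auto)
      then have "(\<lambda>t. G n t \<omega> $$ (i,j) - Sc $$ (i,j)) \<longlonglongrightarrow> 0" by simp
      then show ?thesis by (simp add: Lim_null[symmetric])
    qed
    have GG_lim: "(\<lambda>t. GG n t \<omega> $$ (i,j)) \<longlonglongrightarrow> Sc $$ (i,j)" if "n < N" "i < m" "j < m" for n i j
      unfolding GG_index[OF that] using tendsto_add[OF G_lim[OF that] tendsto_mult_left_zero[OF gamma_lim]] by simp
    have GG_det: "\<forall>\<^sub>F t in sequentially. det (GG n t \<omega>) \<noteq> 0" if "n < N" for n
      by (rule tendsto_mat_inv(1)[OF GG Sc det_Sc GG_lim[OF that]])
    have GG_inv: "(\<lambda>t. mat_inv (GG n t \<omega>) $$ (i,j)) \<longlonglongrightarrow> mat_inv Sc $$ (i,j)" if "n < N" "i < m" "j < m" for n i j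
      by (rule tendsto_mat_inv(2)[OF GG Sc det_Sc GG_lim[OF that(1)] that(2,3)])

    have kk_lim: "(\<lambda>t. kk n t \<omega> i k) \<longlonglongrightarrow> Kinf n i k" if "n < N" "i < m" "k < Md n" for n i k
      unfolding kk_def Kinf_def using that
      by (intro tendsto_sum tendsto_mult tendsto_const GG_inv QQ_inv) auto
    \<comment> \<open>Averaging the limiting feedback over the network gives the inverse of
      \<open>Sc\<close> times \<open>Sc\<close>. This identity normalises the contraction rate of
      the average error to \<open>a\<close>.\<close>
    have Kinf_H: "(\<Sum>n<N. \<Sum>k<Md n. Kinf n i k * H n $$ (k,j)) / N = of_bool (i = j)" if ij: "i < m" "j < m" for i j
    proof -
      have "(\<Sum>k<Md n. Kinf n i k * H n $$ (k,j)) = (\<Sum>p<m. mat_inv Sc $$ (i,p) * S n p j)" if n: "n < N" for n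
      proof -
        have "(\<Sum>k<Md n. Kinf n i k * H n $$ (k,j))
          = (\<Sum>k<Md n. \<Sum>p<m. \<Sum>r<Md n. mat_inv Sc $$ (i,p) * H n $$ (r,p) * mat_inv (R n) $$ (r,k) * H n $$ (k,j))"
          by (simp add: Kinf_def sum_distrib_right)
        also have "\<dots> = (\<Sum>p<m. \<Sum>r<Md n. \<Sum>k<Md n. mat_inv Sc $$ (i,p) * H n $$ (r,p) * mat_inv (R n) $$ (r,k) * H n $$ (k,j))"
          by (subst sum.swap) (intro sum.cong refl sum.swap)
        also have "\<dots> = (\<Sum>p<m. mat_inv Sc $$ (i,p) * S n p j)"
          unfolding S_def using ij
          by (intro sum.cong refl) (simp add: congruence_index[OF mat_inv_inverse(2)[OF R_car det_R[OF n]] H_dim[OF n]] sum_distrib_left mult_ac)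
        finally show ?thesis .
      qed
      then have "(\<Sum>n<N. \<Sum>k<Md n. Kinf n i k * H n $$ (k,j)) / N = (\<Sum>n<N. \<Sum>p<m. mat_inv Sc $$ (i,p) * S n p j) / N" by simp
      also have "\<dots> = (\<Sum>p<m. mat_inv Sc $$ (i,p) * Sc $$ (p,j))"
        by (subst sum.swap, subst sum_divide_distrib, intro sum.cong refl)
           (simp add: Sc_index ij sum_distrib_left[symmetric])
      also have "\<dots> = (mat_inv Sc * Sc) $$ (i,j)"
        by (rule mat_mult_index_sum[symmetric, OF mat_inv_inverse(2)[OF Sc det_Sc] Sc ij])
      also have "\<dots> = of_bool (i = j)" using mat_inv_inverse(4)[OF Sc det_Sc] ij by simp
      finally show ?thesis .
    qed

    define C where "C t n i j = (\<Sum>k<Md n. kk n t \<omega> i k * H n $$ (k,j))" for t n i j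
    define \<xi> where "\<xi> t n i = (\<Sum>k<Md n. kk n t \<omega> i k * zeta n t \<omega> $ k)" for t n i
    define e where "e t n i = x n t \<omega> $ i - theta $ i" for t n i
    obtain B1 where B1: "B1 \<ge> 0" "\<And>n i j t. n < N \<Longrightarrow> i < m \<Longrightarrow> j < m \<Longrightarrow> \<bar>C t n i j\<bar> \<le> B1"
    proof -
      have "\<exists>B\<ge>0. \<forall>z\<in>{..<N} \<times> {..<m} \<times> {..<m}. \<forall>t. \<bar>C t (fst z) (fst (snd z)) (snd (snd z))\<bar> \<le> B"
        by (rule convergent_uniform_bound[where l = "\<lambda>z. \<Sum>k<Md (fst z). Kinf (fst z) (fst (snd z)) k * H (fst z) $$ (k, snd (snd z))"])
           (auto simp: C_def intro!: tendsto_sum tendsto_mult kk_lim)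
      then show thesis using that by fastforce
    qed
    obtain B2 where B2: "B2 \<ge> 0" "\<And>n i k t. n < N \<Longrightarrow> i < m \<Longrightarrow> k < Md n \<Longrightarrow> \<bar>kk n t \<omega> i k\<bar> \<le> B2"
    proof -
      have "\<exists>B\<ge>0. \<forall>z\<in>(SIGMA n:{..<N}. {..<m} \<times> {..<Md n}). \<forall>t. \<bar>kk (fst z) t \<omega> (fst (snd z)) (snd (snd z))\<bar> \<le> B"
        by (rule convergent_uniform_bound[where l = "\<lambda>z. Kinf (fst z) (fst (snd z)) (snd (snd z))"]) (auto intro!: kk_lim)
      then show thesis using that by fastforce
    qed
    obtain T1 where T1: "\<And>n t. t \<ge> T1 \<Longrightarrow> n < N \<Longrightarrow> det (QQ n t \<omega>) \<noteq> 0 \<and> det (GG n t \<omega>) \<noteq> 0 \<and>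
        (\<forall>k<Md n. \<bar>zeta n t \<omega> $ k\<bar> \<le> (real t + 1) powr p)"
    proof -
      have "\<forall>\<^sub>F t in sequentially. \<forall>n\<in>{..<N}. det (QQ n t \<omega>) \<noteq> 0 \<and> det (GG n t \<omega>) \<noteq> 0 \<and>
        (\<forall>k\<in>{..<Md n}. \<bar>zeta n t \<omega> $ k\<bar> \<le> (real t + 1) powr p)"
        using QQ_det GG_det growth
        by (intro eventually_ball_finite ballI eventually_conj) auto
      then show thesis using that unfolding eventually_sequentially by (metis lessThan_iff)
    qed
    have K_car: "K n t \<omega> \<in> carrier_mat m (Md n)" and K_index: "\<And>i k. i < m \<Longrightarrow> k < Md n \<Longrightarrow> K n t \<omega> $$ (i,k) = kk n t \<omega> i k"
      if "t \<ge> T1" "n < N" for n t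
    proof -
      note c1 = mat_inv_inverse(2)[OF GG conjunct1[OF conjunct2[OF T1[OF that]]]]
      note c2 = mat_inv_inverse(2)[OF QQ conjunct1[OF T1[OF that]]]
      have Kd: "K n t \<omega> = mat_inv (GG n t \<omega>) * (H n)\<^sup>T * mat_inv (QQ n t \<omega>)"
        by (simp add: K_def GG_def QQ_def)
      show "K n t \<omega> \<in> carrier_mat m (Md n)" unfolding Kd using c1 c2 H_dim[OF that(2)] by auto
      show "K n t \<omega> $$ (i,k) = kk n t \<omega> i k" if "i < m" "k < Md n" for i k
        unfolding Kd kk_def by (rule gain_index[OF c1 c2 H_dim[OF \<open>n < N\<close>] that])
    qed
    \<comment> \<open>A vector sum takes the dimension of its right operand, so one step with a
      well-shaped gain restores the dimension of the estimate, whatever junk gains did before. Hence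
      the error recursion is claimed only from \<open>Suc T1\<close> on.\<close>
    have x_car: "x n (Suc t) \<omega> \<in> carrier_vec m" if "t \<ge> T1" "n < N" for n t
      unfolding x_step[OF that(2)] using K_car[OF that] by (intro carrier_vecI) auto
    have e_rec: "e (Suc t) n i = consensus_step N (beta t) (w t \<omega>) (\<lambda>n. e t n i) n
        + a / (real t + 1) * (\<xi> t n i - (\<Sum>j<m. C t n i j * e t n j))" if t: "t \<ge> Suc T1" and n: "n < N" and i: "i < m" for t n i
    proof -
      have xc: "x n t \<omega> \<in> carrier_vec m" using x_car[of "t - 1" n] t n by (cases t) auto
      have tT: "t \<ge> T1" using t by simp
      define v where "v = y n t \<omega> - H n *\<^sub>v x n t \<omega>"
      have vc: "v \<in> carrier_vec (Md n)" unfolding v_def using H_dim[OF n] by (intro carrier_vecI) simp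
      have vk: "v $ k = zeta n t \<omega> $ k - (\<Sum>j<m. H n $$ (k,j) * e t n j)" if k: "k < Md n" for k
      proof -
        have "v $ k = (H n *\<^sub>v theta) $ k + zeta n t \<omega> $ k - (H n *\<^sub>v x n t \<omega>) $ k"
          using k H_dim[OF n] zeta_dim[OF n, of t \<omega>] by (simp add: v_def y_def)
        then show ?thesis
          unfolding mat_vec_index_sum[OF H_dim[OF n] theta_dim k] mat_vec_index_sum[OF H_dim[OF n] xc k]
          by (simp add: e_def right_diff_distrib sum_subtractf)
      qed
      have "(K n t \<omega> *\<^sub>v v) $ i = (\<Sum>k<Md n. kk n t \<omega> i k * v $ k)"
        unfolding mat_vec_index_sum[OF K_car[OF tT n] vc i] using K_index[OF tT n i] by (intro sum.cong) auto
      also have "\<dots> = \<xi> t n i - (\<Sum>k<Md n. \<Sum>j<m. kk n t \<omega> i k * H n $$ (k,j) * e t n j)"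
        by (simp add: vk \<xi>_def right_diff_distrib sum_subtractf sum_distrib_left mult_ac)
      also have "(\<Sum>k<Md n. \<Sum>j<m. kk n t \<omega> i k * H n $$ (k,j) * e t n j) = (\<Sum>j<m. C t n i j * e t n j)"
        unfolding C_def sum_distrib_right by (rule sum.swap)
      finally have Kv: "(K n t \<omega> *\<^sub>v v) $ i = \<xi> t n i - (\<Sum>j<m. C t n i j * e t n j)" .
      have "x n (Suc t) \<omega> $ i = x n t \<omega> $ i - beta t * (\<Sum>l<N. w t \<omega> n l * (x n t \<omega> $ i - x l t \<omega> $ i))
          + a / (real t + 1) * (K n t \<omega> *\<^sub>v v) $ i"
        unfolding x_step[OF n] v_def[symmetric] using K_car[OF tT n] i by (simp add: Omega_sum alpha)
      then show ?thesis unfolding Kv by (simp add: e_def consensus_step_def)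
    qed
    \<comment> \<open>Truncated gains replace the true ones at the cost of finitely many terms, at
      most \<open>C1\<close> in total. The main part grows with exponent \<open>r\<close>, and
      \<open>tau + r < 1\<close> lets division by \<open>t\<close> win.\<close>
    have \<xi>_sum: "(\<lambda>t. (real t + 1) powr tau * ((\<Sum>s<t. (\<Sum>n<N. \<xi> s n i) / N) / real t)) \<longlonglongrightarrow> 0" if i: "i < m" for i
    proof -
      let ?z = "\<lambda>n k s. kk n s \<omega> i k * zeta n s \<omega> $ k"
      have one: "(\<lambda>t. (real t + 1) powr tau * ((\<Sum>s<t. ?z n k s) / real t)) \<longlonglongrightarrow> 0"
        if n: "n < N" and k: "k < Md n" for n k
      proof -
        obtain C0 where C0: "C0 \<ge> 0" "\<And>t. \<bar>\<Sum>s<t. ck n i k s \<omega> * zeta n s \<omega> $ k\<bar> \<le> C0 * (real t + 1) powr r"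
          using mart n i k by blast
        have "\<forall>\<^sub>F t in sequentially. \<bar>kk n t \<omega> i k - Kinf n i k\<bar> < 1"
          using tendstoD[OF kk_lim[OF n i k], of 1] by (simp add: dist_real_def)
        then obtain T2 where T2: "\<And>t. t \<ge> T2 \<Longrightarrow> \<bar>kk n t \<omega> i k - Kinf n i k\<bar> < 1"
          unfolding eventually_sequentially by blast
        define d where "d s = kk n s \<omega> i k * zeta n s \<omega> $ k - ck n i k s \<omega> * zeta n s \<omega> $ k" for s
        have d0: "d s = 0" if "s \<ge> T2" for s
        proof -
          have "\<bar>kk n s \<omega> i k\<bar> \<le> \<bar>Kinf n i k\<bar> + 1" using T2[OF that] by linarith
          then show ?thesis by (simp add: d_def ck_def)
        qed
        define C1 where "C1 = (\<Sum>s<T2. \<bar>d s\<bar>)"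
        have dsum: "\<bar>\<Sum>s<t. d s\<bar> \<le> C1" for t
        proof -
          have "\<bar>\<Sum>s<t. d s\<bar> \<le> (\<Sum>s<t. \<bar>d s\<bar>)" by (rule sum_abs)
          also have "\<dots> = (\<Sum>s\<in>{..<t} \<inter> {..<T2}. \<bar>d s\<bar>)"
            by (rule sum.mono_neutral_right) (use d0 in \<open>auto simp: not_less[symmetric]\<close>)
          also have "\<dots> \<le> C1" unfolding C1_def by (rule sum_mono2) auto
          finally show ?thesis .
        qed
        have "(\<lambda>t::nat. C0 * ((real t + 1) powr tau * (real t + 1) powr r / real t) + C1 * ((real t + 1) powr tau / real t)) \<longlonglongrightarrow> 0"
        proof (rule tendsto_add_zero; rule tendsto_mult_right_zero)
          show "(\<lambda>t::nat. (real t + 1) powr tau * (real t + 1) powr r / real t) \<longlonglongrightarrow> 0"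
            using r by real_asymp
          show "(\<lambda>t::nat. (real t + 1) powr tau / real t) \<longlonglongrightarrow> 0"
            using tau_lt by real_asymp
        qed
        then show ?thesis
        proof (rule Lim_null_comparison[rotated], intro always_eventually allI)
          fix t :: nat
          have "(\<Sum>s<t. ?z n k s) = (\<Sum>s<t. ck n i k s \<omega> * zeta n s \<omega> $ k) + (\<Sum>s<t. d s)"
            by (simp add: d_def sum_subtractf)
          then have "\<bar>\<Sum>s<t. ?z n k s\<bar> \<le> C0 * (real t + 1) powr r + C1"
            using C0(2)[of t] dsum[of t] by linarith
          then have "(real t + 1) powr tau * (\<bar>\<Sum>s<t. ?z n k s\<bar> / real t)
              \<le> (real t + 1) powr tau * ((C0 * (real t + 1) powr r + C1) / real t)"
            by (intro mult_left_mono divide_right_mono) auto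
          then show "norm ((real t + 1) powr tau * ((\<Sum>s<t. ?z n k s) / real t))
             \<le> C0 * ((real t + 1) powr tau * (real t + 1) powr r / real t) + C1 * ((real t + 1) powr tau / real t)"
            by (simp add: abs_mult add_divide_distrib distrib_left mult_ac)
        qed
      qed
      have eq: "(real t + 1) powr tau * ((\<Sum>s<t. (\<Sum>n<N. \<xi> s n i) / N) / real t)
          = (\<Sum>n<N. \<Sum>k<Md n. (real t + 1) powr tau * ((\<Sum>s<t. ?z n k s) / real t)) / N" for t
      proof -
        have "(\<Sum>s<t. \<Sum>n<N. \<xi> s n i) = (\<Sum>n<N. \<Sum>k<Md n. \<Sum>s<t. ?z n k s)"
          unfolding \<xi>_def by (subst sum.swap) (intro sum.cong refl sum.swap)
        then show ?thesis
          by (simp add: sum_divide_distrib[symmetric] sum_distrib_left[symmetric])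
      qed
      have "(\<lambda>t. (\<Sum>n<N. \<Sum>k<Md n. (real t + 1) powr tau * ((\<Sum>s<t. ?z n k s) / real t)) / N) \<longlonglongrightarrow> 0"
        using one by (intro tendsto_divide_zero tendsto_null_sum) auto
      then show ?thesis unfolding eq .
    qed
    define T where "T = max T0 (Suc T1)"
    \<comment> \<open>In the common bound \<open>B\<close>, the part \<open>B1\<close> serves the
      feedback matrices, and the sum of the dimensions times \<open>B2\<close> serves the noise
      inputs, each a sum of \<open>Md n\<close> products.\<close>
    have lim: "(\<lambda>t. (real t + 1) powr tau * e t n i) \<longlonglongrightarrow> 0" if i: "i < m" for i
    proof (rule consensus_innovation_tendsto_0[where e = e and d = m and \<xi> = \<xi> and C = C and T = T and T' = T'
          and \<beta> = beta and w = "\<lambda>t. w t \<omega>" and a = a and p = p and q = q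
          and B = "B1 + (\<Sum>n<N. real (Md n)) * B2"])
      have S0: "0 \<le> (\<Sum>n<N. real (Md n)) * B2" using B2 by (intro mult_nonneg_nonneg sum_nonneg) auto
      show "0 \<le> B1 + (\<Sum>n<N. real (Md n)) * B2" using B1 S0 by simp
      show "\<bar>C t n i j\<bar> \<le> B1 + (\<Sum>n<N. real (Md n)) * B2" if "n < N" "i < m" "j < m" for t n i j
        using B1(2)[OF that, of t] S0 by linarith
      show "(\<lambda>t. (\<Sum>n<N. C t n i j) / N) \<longlonglongrightarrow> of_bool (i = j)" if "i < m" "j < m" for i j
        unfolding Kinf_H[OF that, symmetric] C_def using that N0
        by (intro tendsto_divide tendsto_sum tendsto_mult tendsto_const kk_lim) auto
      show "\<bar>\<xi> t n i\<bar> \<le> (B1 + (\<Sum>n<N. real (Md n)) * B2) * (real t + 1) powr p" if t: "T \<le> t" and n: "n < N" and i: "i < m" for t n i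
      proof -
        have "\<bar>\<xi> t n i\<bar> \<le> (\<Sum>k<Md n. B2 * (real t + 1) powr p)"
          unfolding \<xi>_def using B2 T1[of t n] t n i
          by (intro order_trans[OF sum_abs] sum_mono) (auto simp: abs_mult T_def intro!: mult_mono)
        also have "\<dots> = real (Md n) * B2 * (real t + 1) powr p" by simp
        also have "\<dots> \<le> (B1 + (\<Sum>n<N. real (Md n)) * B2) * (real t + 1) powr p"
        proof (rule mult_right_mono)
          have "real (Md n) \<le> (\<Sum>n<N. real (Md n))" using n by (intro member_le_sum) auto
          then have "real (Md n) * B2 \<le> (\<Sum>n<N. real (Md n)) * B2" using B2 by (intro mult_right_mono)
          then show "real (Md n) * B2 \<le> B1 + (\<Sum>n<N. real (Md n)) * B2" using B1 by linarith
        qed simp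
        finally show ?thesis .
      qed
    qed (use e_rec w_sym ker1 ker2 \<xi>_sum a_ge N0 pq tau_nonneg tau_lt n_lt i in \<open>auto simp: T_def\<close>)
    show ?case
    proof (rule tendsto_vnorm_0[of _ m])
      show "x n t \<omega> - theta \<in> carrier_vec m" for t using theta_dim by (intro carrier_vecI) simp
      show "(\<lambda>t. (real t + 1) powr tau * (x n t \<omega> - theta) $ i) \<longlonglongrightarrow> 0" if "i < m" for i
        using lim[OF that] that theta_dim by (simp add: e_def)
    qed simp
  qed
qed

end
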